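(* Let $n \geq 1$ be a natural number, and let $K \subset \mathbb{R}^n$ be a nonempty convex body with intrinsic volume random variable $Z_K$. The variance satisfies $$\operatorname{Var}[Z_K] \leq 4n.$$ Furthermore, for all $t$ in the range $0 \leq t \leq \sqrt{n}$, we have the tail inequality $$\mathbb{P}\left\{ |Z_K - \mathbb{E} Z_K| \geq t\sqrt{n} \right\} \leq 2 e^{-3t^2/28}.$$
   Context: A convex body in $\mathbb{R}^n$ is a compact convex subset. Let $B_m$ denote the Euclidean unit ball of $\mathbb{R}^m$ and $\kappa_m := \mathrm{Vol}_m(B_m) = \pi^{m/2}/\Gamma(1+m/2)$ (so $\kappa_0 = 1$). Intrinsic volumes: for $j = 0,1,\dots,n$, let $P_j \in \mathbb{R}^{n\times n}$ be the orthogonal projector onto a fixed $j$-dimensional subspace of $\mathbb{R}^n$, and let $Q$ be a random rotation drawn from the Haar probability measure on the group of $n \times n$ orthogonal matrices with determinant one. For a nonempty convex body $K \subset \mathbb{R}^n$, $$V_j(K) := \binom{n}{j} \frac{\kappa_n}{\kappa_j \kappa_{n-j}} \mathbb{E}_Q\big[\mathrm{Vol}_j(P_j Q K)\big],$$ where $\mathrm{Vol}_j$ is $j$-dimensional Lebesgue measure on the $j$-dimensional range of $P_j$ (with $\mathrm{Vol}_0$ of a single point equal to $1$). Total intrinsic volume: $W(K) := \sum_{j=0}^n V_j(K)$. The intrinsic volume random variable $Z_K$ takes values in $\{0,1,\dots,n\}$ with distribution $\mathbb{P}\{Z_K = j\} = V_j(K)/W(K)$ for $j=0,1,\dots,n$.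 *)

theory Defs
  imports "HOL-Probability.Probability"
begin

text \<open>
  The ambient space is \<open>real ^ 'n\<close> with \<open>n = CARD('n)\<close>. The data that are fixed once and for all
  (the Haar measure \<open>H\<close> and the projectors \<open>P j\<close>) are explicit parameters; theorems
  quantify over all admissible choices.
\<close>

text \<open>
  A left-invariant Borel probability measure on the compact group of rotations is automatically
  right-invariant, regular and unique.
\<close>

definition haar_prob_SO :: "(real ^ 'n ^ 'n) measure \<Rightarrow> bool" where
  "haar_prob_SO H \<longleftrightarrow>
     prob_space H \<and>
     space H = {Q. rotation_matrix Q} \<and>
     sets H = sets (restrict_space borel {Q. rotation_matrix Q}) \<and>
     (\<forall>R. rotation_matrix R \<longrightarrow> distr H H (\<lambda>Q. R ** Q) = H)"

definition orthogonal_projector_onto :: "real ^ 'n ^ 'n \<Rightarrow> (real ^ 'n) set \<Rightarrow> bool" where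
  "orthogonal_projector_onto P L \<longleftrightarrow>
     subspace L \<and> (\<forall>x. P *v x \<in> L \<and> (\<forall>y\<in>L. orthogonal (x - P *v x) y))"

definition projector_family :: "(nat \<Rightarrow> real ^ 'n ^ 'n) \<Rightarrow> bool" where
  "projector_family P \<longleftrightarrow>
     (\<forall>j\<le>CARD('n). \<exists>L. dim L = j \<and> orthogonal_projector_onto (P j) L)"

definition orthonormal_basis_of :: "'a::euclidean_space set \<Rightarrow> 'a set \<Rightarrow> bool" where
  "orthonormal_basis_of L B \<longleftrightarrow>
     pairwise orthogonal B \<and> (\<forall>b\<in>B. norm b = 1) \<and> span B = L"

text \<open>
  \<open>dim L\<close>-dimensional Lebesgue measure on a linear subspace \<open>L\<close>, built like \<^const>\<open>lborel\<close> but from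
  an orthonormal basis of \<open>L\<close>; it lives on the whole space and is concentrated on \<open>L\<close>. By
  rotation invariance the choice of the basis is immaterial. For \<open>L = {0}\<close> the basis is empty
  and the measure is the unit point mass at 0.
\<close>

definition subspace_lborel :: "'a::euclidean_space set \<Rightarrow> 'a measure" where
  "subspace_lborel L =
     (let B = (SOME B. orthonormal_basis_of L B)
      in distr (\<Pi>\<^sub>M b\<in>B. lborel) borel (\<lambda>c. \<Sum>b\<in>B. c b *\<^sub>R b))"

definition intrinsic_volume ::
  "(real ^ 'n ^ 'n) measure \<Rightarrow> (nat \<Rightarrow> real ^ 'n ^ 'n) \<Rightarrow> nat \<Rightarrow> (real ^ 'n) set \<Rightarrow> real" where
  "intrinsic_volume H P j K =
     real (CARD('n) choose j) * unit_ball_vol (real CARD('n))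
       / (unit_ball_vol (real j) * unit_ball_vol (real (CARD('n) - j)))
     * (\<integral>Q. measure (subspace_lborel (range ((*v) (P j)))) ((\<lambda>x. P j *v (Q *v x)) ` K) \<partial>H)"

definition total_intrinsic_volume ::
  "(real ^ 'n ^ 'n) measure \<Rightarrow> (nat \<Rightarrow> real ^ 'n ^ 'n) \<Rightarrow> (real ^ 'n) set \<Rightarrow> real" where
  "total_intrinsic_volume H P K = (\<Sum>j=0..CARD('n). intrinsic_volume H P j K)"

definition intrinsic_volume_rv ::
  "(real ^ 'n ^ 'n) measure \<Rightarrow> (nat \<Rightarrow> real ^ 'n ^ 'n) \<Rightarrow> (real ^ 'n) set \<Rightarrow>
   'w measure \<Rightarrow> ('w \<Rightarrow> nat) \<Rightarrow> bool" where
  "intrinsic_volume_rv H P K M Z \<longleftrightarrow>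
     prob_space M \<and>
     Z \<in> measurable M (count_space {0..CARD('n)}) \<and>
     (\<forall>j\<in>{0..CARD('n)}. \<P>(\<omega> in M. Z \<omega> = j) = intrinsic_volume H P j K / total_intrinsic_volume H P K)"

end

theory Submission
  imports Defs "HOL-Real_Asymp.Real_Asymp"
begin

text \<open>
  Write \<open>V\<^sub>j\<close> for the intrinsic volumes of \<open>K\<close>. The Steiner formula gives
  \<open>\<integral> exp (- \<pi> s dist(x, K)\<^sup>2) dx = \<Sum> s\<^bsup>-(n-j)/2\<^esup> V\<^sub>j\<close>, and the substitution \<open>y = s x\<close> turns
  \<open>s\<^bsup>n\<^esup>\<close> times this integral into \<open>\<integral> exp (- \<pi> dist(y, s K)\<^sup>2 / s) dy\<close>. The exponent
  \<open>dist(y, s K)\<^sup>2 / s\<close> is jointly convex in \<open>(s, y)\<close>, so by Prekopa-Leindler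
  \<open>s \<mapsto> \<Sum> s\<^bsup>(n+j)/2\<^esup> V\<^sub>j\<close> is log-concave. Its tangent line at \<open>s = 1\<close> bounds the moment generating
  function of \<open>a = (n + Z) / 2\<close> by that of a Poisson variable with the same mean \<open>E a \<le> n\<close>. This yields
  \<open>Var a \<le> E a\<close> and Bennett tails.

  The Steiner formula for intrinsic volumes defined by mean projections is proved with zonotopes:
  adding a segment \<open>[-w, w]\<close> to a convex body increases its volume by \<open>2 |w|\<close> times the volume of
  the projection along \<open>w\<close>. Iterating, the mean over rotations \<open>Q\<close> of the volume of \<open>Q K + r Z\<close>, for a
  zonotope \<open>Z\<close>, is a polynomial in \<open>r\<close> whose coefficients are multiples (depending only on \<open>Z\<close>) of the
  mean projections of \<open>K\<close>. Zonotopes approximate the ball, and the limits of the multiples are found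
  by taking \<open>K\<close> to be the ball itself.
\<close>

section \<open>Orthonormal bases and Lebesgue measure\<close>

text \<open>Two obstacles shape the proof. The definition of intrinsic volumes uses
  lower-dimensional measures that vary with the subspace, so each projection is traded for a
  full-dimensional cylinder over it, on which \<open>lborel\<close>, Fubini and orthogonal maps act
  directly. And a sum with a ball cannot be built up one piece at a time, whereas a sum with
  segments can; the ball is reached because averaging
  \<open>\<bar>(Q *v e) \<bullet> x\<bar>\<close> over rotations gives a multiple of
  \<open>norm x\<close>, which finite sums of such terms approximate. The weight contains pi because
  \<open>unit_ball_vol k = pi powr (k / 2) / Gamma (k / 2 + 1)\<close>: the radial integral supplies
  exactly the Gamma factor and the power of pi that cancel this constant. Constants:
  \<open>Z = 2 a - n\<close>, so the variance bound for \<open>a\<close> is multiplied by 4. A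
  deviation \<open>t * sqrt n\<close> of \<open>Z\<close> is a deviation \<open>n * u\<close> of
  \<open>a\<close> with \<open>u = t / (2 * sqrt n)\<close>. The range of \<open>t\<close> says
  \<open>u \<le> 1 / 2\<close>, where the Poisson rate is at least \<open>3 / 7 * u\<^sup>2\<close>,
  and \<open>n * (3 / 7 * u\<^sup>2) = 3 * t\<^sup>2 / 28\<close>.\<close>

lemma lborel_eqI_translation_invariant:
  fixes \<mu> :: "'a::euclidean_space measure"
  assumes sets_mu: "sets \<mu> = sets borel"
    and transl: "\<And>a. distr \<mu> borel (\<lambda>x. x + a) = \<mu>"
    and cball: "\<And>r. r > 0 \<Longrightarrow> emeasure \<mu> (cball 0 r) = emeasure lborel (cball 0 r :: 'a set)"
  shows "\<mu> = lborel"
proof -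
  note sets_mu [measurable_cong]
  have space_mu [simp]: "space \<mu> = UNIV"
    using sets_eq_imp_space_eq[OF sets_mu] by simp
  have "sigma_finite_measure \<mu>"
  proof
    show "\<exists>A. countable A \<and> A \<subseteq> sets \<mu> \<and> \<Union>A = space \<mu> \<and> (\<forall>a\<in>A. emeasure \<mu> a \<noteq> \<infinity>)"
    proof (intro exI[of _ "range (\<lambda>k. cball 0 (real (Suc k)))"] conjI ballI)
      have "\<exists>k. norm x \<le> real (Suc k)" for x :: 'a
        using real_arch_simple[of "norm x"] by (metis le_Suc_eq of_nat_mono order_trans lessI less_imp_le)
      then show "\<Union> (range (\<lambda>k. cball 0 (real (Suc k)))) = space \<mu>"
        by (auto simp del: of_nat_Suc)
      fix a assume "a \<in> range (\<lambda>k. cball (0::'a) (real (Suc k)))"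
      then show "emeasure \<mu> a \<noteq> \<infinity>"
        using emeasure_bounded_finite[of "cball (0::'a) _"] cball by (auto simp: less_top)
    qed (auto simp: sets_mu)
  qed
  then interpret pair_sigma_finite lborel \<mu>
    by (simp add: pair_sigma_finite_def sigma_finite_lborel)
  have neg: "distr lborel borel (\<lambda>y. x - y) = lborel" for x :: 'a
    using lborel_affine[of "-1" x] by (simp add: density_1)
  have pos: "distr lborel borel (\<lambda>y. x + y) = lborel" for x :: 'a
    using lborel_affine[of "1" x] by (simp add: density_1)
  let ?B = "cball (0::'a) 1"
  have [measurable]: "?B \<in> sets borel" by simp
  show ?thesis
  proof (rule measure_eqI)
    fix A assume "A \<in> sets \<mu>"
    then have A[measurable]: "A \<in> sets borel" by (simp add: sets_mu)
    \<comment> \<open>The double integral of \<open>indicator A x * indicator ?B (x + y)\<close> is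
      evaluated in both orders. Invariance of \<open>lborel\<close> separates the factors in one
      order; invariance of \<open>\<mu>\<close> and reflection of \<open>lborel\<close> separate
      them in the other.\<close>
    have "emeasure \<mu> A * emeasure lborel ?B
        = (\<integral>\<^sup>+x. indicator A x * (\<integral>\<^sup>+y. indicator ?B y \<partial>distr lborel borel (\<lambda>y. x + y)) \<partial>\<mu>)"
      by (simp add: pos nn_integral_multc sets_mu)
    also have "\<dots> = (\<integral>\<^sup>+x. (\<integral>\<^sup>+y. indicator A x * indicator ?B (x + y) \<partial>lborel) \<partial>\<mu>)"
      by (intro nn_integral_cong) (simp add: nn_integral_distr nn_integral_cmult del: nn_integral_indicator)
    also have "\<dots> = (\<integral>\<^sup>+y. (\<integral>\<^sup>+x. indicator A x * indicator ?B (x + y) \<partial>\<mu>) \<partial>lborel)"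
      by (intro Fubini') measurable
    also have "\<dots> = (\<integral>\<^sup>+y. (\<integral>\<^sup>+x. indicator A (x - y) * indicator ?B x \<partial>distr \<mu> borel (\<lambda>x. x + y)) \<partial>lborel)"
      by (intro nn_integral_cong, subst nn_integral_distr) auto
    also have "\<dots> = (\<integral>\<^sup>+y. (\<integral>\<^sup>+x. indicator A (x - y) * indicator ?B x \<partial>\<mu>) \<partial>lborel)"
      by (simp add: transl)
    also have "\<dots> = (\<integral>\<^sup>+x. (\<integral>\<^sup>+y. indicator A (x - y) * indicator ?B x \<partial>lborel) \<partial>\<mu>)"
      by (intro Fubini'[symmetric]) measurable
    also have "\<dots> = (\<integral>\<^sup>+x. (\<integral>\<^sup>+y. indicator A y \<partial>distr lborel borel (\<lambda>y. x - y)) * indicator ?B x \<partial>\<mu>)"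
      by (intro nn_integral_cong) (simp add: nn_integral_distr nn_integral_multc del: nn_integral_indicator)
    also have "\<dots> = emeasure lborel A * emeasure lborel ?B"
      by (simp add: neg nn_integral_cmult sets_mu cball)
    finally have eq: "emeasure \<mu> A * emeasure lborel ?B = emeasure lborel A * emeasure lborel ?B" .
    have "emeasure lborel ?B \<noteq> 0" "emeasure lborel ?B \<noteq> \<infinity>"
      using unit_ball_vol_pos[of "real DIM('a)"] by (auto simp: emeasure_cball simp del: unit_ball_vol_pos)
    with eq show "emeasure \<mu> A = emeasure lborel A"
      by (metis ennreal_mult_divide_eq infinity_ennreal_def)
  qed (simp add: sets_mu)
qed

text \<open>The preimage of a centred ball is the ball itself, and \<open>T\<close> carries
  translations to translations, so the uniqueness criterion applies.\<close>

lemma distr_lborel_orthogonal: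
  fixes T :: "'a::euclidean_space \<Rightarrow> 'a"
  assumes T: "orthogonal_transformation T"
  shows "distr lborel borel T = lborel"
proof (rule lborel_eqI_translation_invariant)
  have lin: "linear T" using T by (simp add: orthogonal_transformation_linear)
  have T_meas[measurable]: "T \<in> borel_measurable borel"
    by (intro borel_measurable_continuous_onI linear_continuous_on) (use lin in \<open>simp add: linear_conv_bounded_linear\<close>)
  show "emeasure (distr lborel borel T) (cball 0 r) = emeasure lborel (cball (0::'a) r)" for r
  proof -
    have "T -` cball 0 r = cball 0 r"
      by (auto simp: orthogonal_transformation_norm[OF T])
    then show ?thesis by (subst emeasure_distr) auto
  qed
  show "distr (distr lborel borel T) borel (\<lambda>x. x + a) = distr lborel borel T" for a
  proof -
    obtain b where b: "T b = a"
      using orthogonal_transformation_surj[OF T] by (metis surjD)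
    have pos: "distr lborel borel (\<lambda>x. b + x) = lborel"
      using lborel_affine[of "1" b] by (simp add: density_1)
    have "distr (distr lborel borel T) borel (\<lambda>x. x + a) = distr lborel borel (T \<circ> (\<lambda>x. b + x))"
      by (subst distr_distr) (auto simp: o_def linear_add[OF lin] b add.commute)
    also have "\<dots> = distr (distr lborel borel (\<lambda>x. b + x)) borel T"
      by (subst distr_distr) auto
    finally show ?thesis by (simp add: pos)
  qed
qed simp

definition orthonormal :: "'a::real_inner set \<Rightarrow> bool" where
  "orthonormal B \<longleftrightarrow> pairwise orthogonal B \<and> (\<forall>b\<in>B. norm b = 1)"

lemma orthonormal_basis_of_iff: "orthonormal_basis_of L B \<longleftrightarrow> orthonormal B \<and> span B = L"
  by (auto simp: orthonormal_basis_of_def orthonormal_def)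

section \<open>Coordinates with respect to orthonormal sets\<close>

lemma orthonormal_finite:
  fixes B :: "'a::euclidean_space set"
  shows "orthonormal B \<Longrightarrow> finite B"
  by (simp add: orthonormal_def pairwise_orthogonal_imp_finite)

lemma orthonormal_independent:
  "orthonormal B \<Longrightarrow> independent B"
  unfolding orthonormal_def by (intro pairwise_orthogonal_independent) auto

lemma orthonormal_inner:
  "orthonormal B \<Longrightarrow> a \<in> B \<Longrightarrow> b \<in> B \<Longrightarrow> a \<bullet> b = (if a = b then 1 else 0)"
  unfolding orthonormal_def pairwise_def orthogonal_def by (auto simp: norm_eq_1)

lemma orthonormal_inner_sum:
  assumes "orthonormal B" "finite B" "a \<in> B"
  shows "(\<Sum>b\<in>B. c b *\<^sub>R b) \<bullet> a = c a"
proof -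
  have "(\<Sum>b\<in>B. c b *\<^sub>R b) \<bullet> a = (\<Sum>b\<in>B. if b = a then c b else 0)"
    unfolding inner_sum_left by (intro sum.cong refl) (simp add: orthonormal_inner[OF assms(1) _ assms(3)])
  then show ?thesis using assms by simp
qed

lemma orthonormal_norm_sum:
  assumes "orthonormal B" "finite B"
  shows "norm (\<Sum>b\<in>B. c b *\<^sub>R b) = sqrt (\<Sum>b\<in>B. (c b)\<^sup>2)"
proof -
  have "(\<Sum>b\<in>B. c b *\<^sub>R b) \<bullet> (\<Sum>b\<in>B. c b *\<^sub>R b) = (\<Sum>b\<in>B. (c b)\<^sup>2)"
    by (subst inner_sum_right) (auto simp: orthonormal_inner_sum[OF assms] power2_eq_square intro!: sum.cong)
  then show ?thesis by (simp add: norm_eq_sqrt_inner)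
qed

lemma orthonormal_expansion:
  assumes "orthonormal B" "finite B" "x \<in> span B"
  shows "(\<Sum>b\<in>B. (x \<bullet> b) *\<^sub>R b) = x"
proof -
  obtain c where c: "x = (\<Sum>b\<in>B. c b *\<^sub>R b)"
    using assms(3) by (auto simp: span_finite[OF assms(2)])
  show ?thesis unfolding c
    by (intro sum.cong refl) (simp add: orthonormal_inner_sum[OF assms(1,2)])
qed

lemma card_orthonormal:
  fixes B :: "'a::euclidean_space set"
  assumes "orthonormal B" shows "card B = dim (span B)"
  using dim_eq_card_independent[OF orthonormal_independent[OF assms]] by simp

text \<open>Uniqueness once more: a translation shifts each coordinate separately, and a ball in
  coordinates has the known volume. This permits Fubini along any orthonormal basis, in particular
  one adapted to a subspace.\<close>

lemma distr_PiM_orthonormal_basis: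
  fixes B :: "'a::euclidean_space set"
  assumes B: "orthonormal B" and span_B: "span B = UNIV"
  shows "distr (\<Pi>\<^sub>M b\<in>B. lborel) borel (\<lambda>c. \<Sum>b\<in>B. c b *\<^sub>R b) = lborel"
proof (rule lborel_eqI_translation_invariant)
  have fin: "finite B" using B by (rule orthonormal_finite)
  have card_B: "card B = DIM('a)" using card_orthonormal[OF B] span_B by simp
  interpret product_sigma_finite "\<lambda>_::'a. lborel :: real measure"
    by standard
  let ?P = "\<Pi>\<^sub>M b\<in>B. (lborel :: real measure)"
  let ?f = "\<lambda>c::'a \<Rightarrow> real. \<Sum>b\<in>B. c b *\<^sub>R b"
  have [measurable]: "?f \<in> borel_measurable ?P" by measurable
  show "emeasure (distr ?P borel ?f) (cball 0 r) = emeasure lborel (cball (0::'a) r)" if "r > 0" for r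
  proof -
    have "emeasure (distr ?P borel ?f) (cball 0 r) = emeasure ?P (?f -` cball 0 r \<inter> space ?P)"
      by (subst emeasure_distr) auto
    also have "?f -` cball 0 r \<inter> space ?P = {c. sqrt (\<Sum>b\<in>B. (c b)\<^sup>2) \<le> r} \<inter> space ?P"
      by (auto simp: orthonormal_norm_sum[OF B fin])
    also have "emeasure ?P \<dots> = emeasure lborel (cball (0::'a) r)"
      using that by (subst emeasure_cball_aux[OF fin]) (auto simp: emeasure_cball card_B)
    finally show ?thesis .
  qed
  show "distr (distr ?P borel ?f) borel (\<lambda>x. x + a) = distr ?P borel ?f" for a
  proof -
    let ?g = "\<lambda>c. \<lambda>b\<in>B. c b + a \<bullet> b"
    have shift: "distr ?P ?P ?g = ?P"
    proof (rule PiM_eqI)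
      fix A :: "'a \<Rightarrow> real set" assume A: "\<And>i. i \<in> B \<Longrightarrow> A i \<in> sets lborel"
      have "emeasure (distr ?P ?P ?g) (Pi\<^sub>E B A) = emeasure ?P (?g -` Pi\<^sub>E B A \<inter> space ?P)"
        using A fin by (subst emeasure_distr) (auto intro!: sets_PiM_I_finite)
      also have "?g -` Pi\<^sub>E B A \<inter> space ?P = Pi\<^sub>E B (\<lambda>b. (\<lambda>y. y + a \<bullet> b) -` A b)"
        by (auto simp: space_PiM PiE_def Pi_def extensional_def)
      also have "emeasure ?P \<dots> = (\<Prod>b\<in>B. emeasure lborel ((\<lambda>y. y + a \<bullet> b) -` A b))"
      proof (rule emeasure_PiM[OF fin])
        fix b assume "b \<in> B"
        then have [measurable]: "A b \<in> sets borel" using A by simp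
        have "(\<lambda>y. y + a \<bullet> b) -` A b \<inter> space borel \<in> sets borel"
          by measurable
        then show "(\<lambda>y. y + a \<bullet> b) -` A b \<in> sets lborel" by simp
      qed
      also have "\<dots> = (\<Prod>b\<in>B. emeasure lborel (A b))"
      proof (intro prod.cong refl)
        fix b assume "b \<in> B"
        then have [measurable]: "A b \<in> sets borel" using A by simp
        have "emeasure lborel (A b) = emeasure (distr lborel borel (\<lambda>y. a \<bullet> b + y)) (A b)"
          using lborel_affine[of "1" "a \<bullet> b"] by (simp add: density_1)
        then show "emeasure lborel ((\<lambda>y. y + a \<bullet> b) -` A b) = emeasure lborel (A b)"
          by (subst (asm) emeasure_distr) (auto simp: add.commute[of _ "a \<bullet> b"])
      qed
      finally show "emeasure (distr ?P ?P ?g) (Pi\<^sub>E B A) = (\<Prod>b\<in>B. emeasure lborel (A b))" .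
    qed (use fin in auto)
    have "(\<Sum>b\<in>B. (a \<bullet> b) *\<^sub>R b) = a"
      using orthonormal_expansion[OF B fin] span_B by simp
    then have "?f (?g c) = ?f c + a" for c
      by (simp add: scaleR_add_left sum.distrib)
    then have "distr (distr ?P borel ?f) borel (\<lambda>x. x + a) = distr (distr ?P ?P ?g) borel ?f"
      by (subst (1 2) distr_distr) (auto simp: o_def)
    then show ?thesis by (simp add: shift)
  qed
qed simp

lemma orthonormal_insert:
  assumes "orthonormal D" "norm u = 1" "\<And>d. d \<in> D \<Longrightarrow> u \<bullet> d = 0"
  shows "orthonormal (insert u D)"
  using assms unfolding orthonormal_def by (auto simp: pairwise_insert orthogonal_def inner_commute)

lemma orthonormal_Un_complement:
  fixes B D :: "'a::euclidean_space set"
  assumes B: "orthonormal B" and D: "orthonormal D"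
    and span_D: "span D = {y. \<forall>x\<in>span B. orthogonal x y}"
  shows "orthonormal (B \<union> D)" "span (B \<union> D) = UNIV" "B \<inter> D = {}"
proof -
  have perp: "b \<bullet> d = 0" if "b \<in> B" "d \<in> D" for b d
    using that span_base[of d D] span_base[of b B] span_D by (auto simp: orthogonal_def)
  show "orthonormal (B \<union> D)"
    using B D perp unfolding orthonormal_def pairwise_def orthogonal_def
    by (metis Un_iff inner_commute)
  show "B \<inter> D = {}"
  proof (rule ccontr)
    assume "B \<inter> D \<noteq> {}"
    then obtain b where "b \<in> B" "b \<in> D" by auto
    then show False using perp[of b b] B by (auto simp: orthonormal_def)
  qed
  have "x \<in> span (B \<union> D)" for x
  proof -
    have fin: "finite B" using B by (rule orthonormal_finite)
    define p where "p = (\<Sum>b\<in>B. (x \<bullet> b) *\<^sub>R b)"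
    have p: "p \<in> span B" unfolding p_def by (intro span_sum span_scale span_base)
    have "orthogonal (x - p) b" if "b \<in> B" for b
      using orthonormal_inner_sum[OF B fin that] by (simp add: orthogonal_def p_def inner_diff_left)
    then have "orthogonal (x - p) y" if "y \<in> span B" for y
      using orthogonal_to_span[OF that] \<open>\<And>b. b \<in> B \<Longrightarrow> orthogonal (x - p) b\<close> by blast
    then have "x - p \<in> span D"
      by (auto simp: span_D orthogonal_commute)
    with p have "p + (x - p) \<in> span (B \<union> D)"
      by (meson span_add span_mono subset_eq sup_ge1 sup_ge2)
    then show ?thesis by simp
  qed
  then show "span (B \<union> D) = UNIV" by auto
qed

section \<open>Cylinders over projections\<close>

text \<open>
  For orthonormal \<open>D\<close>, the set \<open>cyl D A\<close> is the product of the projection of \<open>A\<close> to the orthogonal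
  complement of \<open>D\<close> with a unit cube in the span of \<open>D\<close>. Its full-dimensional volume \<open>cyl_vol D A\<close>
  is therefore the lower-dimensional volume of the projection.
\<close>

definition cyl :: "'a::real_inner set \<Rightarrow> 'a set \<Rightarrow> 'a set" where
  "cyl D A = {z. (\<forall>d\<in>D. 0 \<le> z \<bullet> d \<and> z \<bullet> d \<le> 1) \<and> (\<exists>y\<in>span D. z + y \<in> A)}"

definition cyl_vol :: "'a::euclidean_space set \<Rightarrow> 'a set \<Rightarrow> real" where
  "cyl_vol D A = measure lborel (cyl D A)"

definition seg_sum :: "'a::real_vector set \<Rightarrow> 'a \<Rightarrow> 'a set" where
  "seg_sum A w = {a + t *\<^sub>R w | a t. a \<in> A \<and> \<bar>t\<bar> \<le> 1}"

definition unit_cube :: "'a::real_inner set \<Rightarrow> 'a set" where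
  "unit_cube D = {q \<in> span D. \<forall>d\<in>D. 0 \<le> q \<bullet> d \<and> q \<bullet> d \<le> 1}"

lemma cyl_empty [simp]: "cyl {} A = A"
  by (simp add: cyl_def)

text \<open>Projecting out a set of directions can be done one direction at a time: a shift along
  \<open>u\<close> leaves the coordinates along \<open>D\<close> unchanged. This is how
  \<open>D\<close> grows in the zonotope induction.\<close>

lemma cyl_insert:
  assumes "\<And>d. d \<in> D \<Longrightarrow> u \<bullet> d = 0"
  shows "cyl (insert u D) A = cyl {u} (cyl D A)"
proof (intro set_eqI iffI)
  fix z assume "z \<in> cyl (insert u D) A"
  then obtain y where z: "\<forall>d\<in>insert u D. 0 \<le> z \<bullet> d \<and> z \<bullet> d \<le> 1" and y: "y \<in> span (insert u D)" "z + y \<in> A"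
    by (auto simp: cyl_def)
  from y obtain k where k: "y - k *\<^sub>R u \<in> span D"
    using span_breakdown_eq[of y u D] by auto
  have "z + k *\<^sub>R u \<in> cyl D A"
    using z k y assms by (auto simp: cyl_def inner_add_left intro!: bexI[of _ "y - k *\<^sub>R u"])
  then show "z \<in> cyl {u} (cyl D A)"
    using z by (auto simp: cyl_def[of "{u}"] span_singleton)
next
  fix z assume "z \<in> cyl {u} (cyl D A)"
  then obtain k y where z: "0 \<le> z \<bullet> u" "z \<bullet> u \<le> 1" "\<forall>d\<in>D. 0 \<le> (z + k *\<^sub>R u) \<bullet> d \<and> (z + k *\<^sub>R u) \<bullet> d \<le> 1"
    and y: "y \<in> span D" "z + k *\<^sub>R u + y \<in> A"
    by (auto simp: cyl_def span_singleton)
  have "k *\<^sub>R u + y \<in> span (insert u D)"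
    using y(1) by (auto simp: span_breakdown_eq intro!: exI[of _ k])
  then show "z \<in> cyl (insert u D) A"
    using z y assms by (auto simp: cyl_def inner_add_left add.assoc intro!: bexI[of _ "k *\<^sub>R u + y"])
qed

text \<open>The projection forgets the part \<open>w - v\<close> of the segment, and the remaining
  part \<open>v\<close> does not disturb the cube constraints because it is orthogonal to
  \<open>D\<close>.\<close>

lemma cyl_seg_sum:
  assumes "\<And>d. d \<in> D \<Longrightarrow> v \<bullet> d = 0" and "w - v \<in> span D"
  shows "cyl D (seg_sum A w) = seg_sum (cyl D A) v"
proof (intro set_eqI iffI)
  fix z assume "z \<in> cyl D (seg_sum A w)"
  then obtain y a t where z: "\<forall>d\<in>D. 0 \<le> z \<bullet> d \<and> z \<bullet> d \<le> 1" "y \<in> span D" "a \<in> A" "\<bar>t\<bar> \<le> 1"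
      "z + y = a + t *\<^sub>R w"
    by (auto simp: cyl_def seg_sum_def)
  have "z - t *\<^sub>R v + (y - t *\<^sub>R (w - v)) = a"
    using z(5) by (simp add: algebra_simps)
  moreover have "y - t *\<^sub>R (w - v) \<in> span D"
    by (rule span_diff[OF z(2) span_scale[OF assms(2)]])
  ultimately have "z - t *\<^sub>R v \<in> cyl D A"
    using z assms unfolding cyl_def by (auto simp: inner_diff_left)
  then show "z \<in> seg_sum (cyl D A) v"
    using z unfolding seg_sum_def by (auto intro!: exI[of _ "z - t *\<^sub>R v"] exI[of _ t])
next
  fix z assume "z \<in> seg_sum (cyl D A) v"
  then obtain x t y where z: "z = x + t *\<^sub>R v" "\<bar>t\<bar> \<le> 1" "\<forall>d\<in>D. 0 \<le> x \<bullet> d \<and> x \<bullet> d \<le> 1" "y \<in> span D"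
      "x + y \<in> A"
    by (auto simp: cyl_def seg_sum_def)
  have "y + t *\<^sub>R (w - v) \<in> span D"
    using z(4) assms(2) by (intro span_add span_scale)
  moreover have "z + (y + t *\<^sub>R (w - v)) = (x + y) + t *\<^sub>R w"
    using z by (simp add: algebra_simps)
  ultimately show "z \<in> cyl D (seg_sum A w)"
    using z assms unfolding cyl_def seg_sum_def
    by (auto simp: inner_add_left intro!: bexI[of _ "y + t *\<^sub>R (w - v)"] exI[of _ "x + y"] exI[of _ t])
qed

lemma compact_unit_cube:
  fixes D :: "'a::euclidean_space set"
  assumes "orthonormal D"
  shows "compact (unit_cube D)"
proof -
  have fin: "finite D" using assms by (rule orthonormal_finite)
  have "norm q \<le> real (card D)" if "q \<in> unit_cube D" for q
  proof -
    have "norm q = norm (\<Sum>d\<in>D. (q \<bullet> d) *\<^sub>R d)"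
      using that orthonormal_expansion[OF assms fin] by (simp add: unit_cube_def)
    also have "\<dots> \<le> (\<Sum>d\<in>D. norm ((q \<bullet> d) *\<^sub>R d))" by (rule norm_sum)
    also have "\<dots> \<le> (\<Sum>d\<in>D. 1)"
      using that assms by (intro sum_mono) (auto simp: unit_cube_def orthonormal_def)
    finally show ?thesis by simp
  qed
  then have "bounded (unit_cube D)" unfolding bounded_iff by blast
  moreover have "closed (unit_cube D)"
  proof -
    have "unit_cube D = span D \<inter> (\<Inter>d\<in>D. {q. 0 \<le> q \<bullet> d} \<inter> {q. q \<bullet> d \<le> 1})"
      by (auto simp: unit_cube_def)
    also have "closed \<dots>"
      by (intro closed_Int closed_INT ballI closed_subspace subspace_span closed_Collect_le continuous_intros)
    finally show ?thesis .
  qed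
  ultimately show ?thesis by (simp add: compact_eq_bounded_closed)
qed

text \<open>A continuous parametrization over a product. It yields compactness of cylinders here and
  joint measurability in the rotation later.\<close>

lemma cyl_eq_image:
  fixes D :: "'a::euclidean_space set"
  assumes "orthonormal D"
  shows "cyl D A = (\<lambda>(a, q). a - (\<Sum>d\<in>D. (a \<bullet> d) *\<^sub>R d) + q) ` (A \<times> unit_cube D)"
proof (intro set_eqI iffI)
  have fin: "finite D" using assms by (rule orthonormal_finite)
  note inner = orthonormal_inner_sum[OF assms fin]
  {
    fix z assume "z \<in> cyl D A"
    then obtain y where z: "\<forall>d\<in>D. 0 \<le> z \<bullet> d \<and> z \<bullet> d \<le> 1" "y \<in> span D" "z + y \<in> A"
      by (auto simp: cyl_def)
    let ?q = "\<Sum>d\<in>D. (z \<bullet> d) *\<^sub>R d"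
    have "?q \<in> unit_cube D"
      using z by (auto simp: unit_cube_def inner intro!: span_sum intro: span_scale span_base)
    moreover have "z = (z + y) - (\<Sum>d\<in>D. ((z + y) \<bullet> d) *\<^sub>R d) + ?q"
      using orthonormal_expansion[OF assms fin z(2)]
      by (simp add: inner_add_left scaleR_add_left sum.distrib)
    ultimately show "z \<in> (\<lambda>(a, q). a - (\<Sum>d\<in>D. (a \<bullet> d) *\<^sub>R d) + q) ` (A \<times> unit_cube D)"
      using z(3) by (auto intro!: image_eqI[of _ _ "(z + y, ?q)"])
  next
    fix z assume "z \<in> (\<lambda>(a, q). a - (\<Sum>d\<in>D. (a \<bullet> d) *\<^sub>R d) + q) ` (A \<times> unit_cube D)"
    then obtain a q where z: "z = a - (\<Sum>d\<in>D. (a \<bullet> d) *\<^sub>R d) + q" "a \<in> A" "q \<in> unit_cube D"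
      by auto
    have "(\<Sum>d\<in>D. (a \<bullet> d) *\<^sub>R d) - q \<in> span D"
      using z(3) by (auto simp: unit_cube_def intro!: span_diff span_sum intro: span_scale span_base)
    then show "z \<in> cyl D A"
      using z by (auto simp: cyl_def unit_cube_def inner inner_add_left inner_diff_left
          intro!: bexI[of _ "(\<Sum>d\<in>D. (a \<bullet> d) *\<^sub>R d) - q"])
  }
qed

lemma compact_cyl:
  fixes D :: "'a::euclidean_space set"
  assumes "orthonormal D" "compact A"
  shows "compact (cyl D A)"
  unfolding cyl_eq_image[OF assms(1)] case_prod_beta
  by (intro compact_continuous_image compact_Times compact_unit_cube assms continuous_intros)

lemma convex_cyl:
  assumes "convex A"
  shows "convex (cyl D A)"
proof (rule convexI)
  fix x y and u v :: real
  assume xy: "x \<in> cyl D A" "y \<in> cyl D A" and uv: "0 \<le> u" "0 \<le> v" "u + v = 1"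
  from xy obtain p q where pq: "p \<in> span D" "q \<in> span D" "x + p \<in> A" "y + q \<in> A"
    by (auto simp: cyl_def)
  have "u *\<^sub>R (x + p) + v *\<^sub>R (y + q) \<in> A"
    using assms pq uv by (simp add: convexD)
  moreover have "u *\<^sub>R (x + p) + v *\<^sub>R (y + q) = (u *\<^sub>R x + v *\<^sub>R y) + (u *\<^sub>R p + v *\<^sub>R q)"
    by (simp add: algebra_simps)
  moreover have "u *\<^sub>R p + v *\<^sub>R q \<in> span D"
    using pq by (intro span_add span_scale)
  moreover have "0 \<le> (u *\<^sub>R x + v *\<^sub>R y) \<bullet> d \<and> (u *\<^sub>R x + v *\<^sub>R y) \<bullet> d \<le> 1" if "d \<in> D" for d
  proof -
    have "0 \<le> x \<bullet> d" "x \<bullet> d \<le> 1" "0 \<le> y \<bullet> d" "y \<bullet> d \<le> 1"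
      using xy that by (auto simp: cyl_def)
    then show ?thesis
      using uv convex_bound_le[of "x \<bullet> d" 1 "y \<bullet> d" u v] by (auto simp: inner_add_left)
  qed
  ultimately show "u *\<^sub>R x + v *\<^sub>R y \<in> cyl D A"
    unfolding cyl_def by auto
qed

lemma seg_sum_eq_image: "seg_sum A w = (\<lambda>(a, t). a + t *\<^sub>R w) ` (A \<times> {-1..1})"
  by (auto simp: seg_sum_def image_iff abs_le_iff) (metis minus_le_iff)

lemma compact_seg_sum:
  fixes A :: "'a::real_normed_vector set"
  assumes "compact A"
  shows "compact (seg_sum A w)"
  unfolding seg_sum_eq_image case_prod_beta
  by (intro compact_continuous_image compact_Times assms continuous_intros) auto

lemma convex_seg_sum:
  assumes "convex A"
  shows "convex (seg_sum A w)"
proof (rule convexI)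
  fix x y and u v :: real
  assume xy: "x \<in> seg_sum A w" "y \<in> seg_sum A w" and uv: "0 \<le> u" "0 \<le> v" "u + v = 1"
  from xy obtain a b s t where *: "x = a + s *\<^sub>R w" "y = b + t *\<^sub>R w" "a \<in> A" "b \<in> A" "\<bar>s\<bar> \<le> 1" "\<bar>t\<bar> \<le> 1"
    by (auto simp: seg_sum_def)
  have "u *\<^sub>R x + v *\<^sub>R y = (u *\<^sub>R a + v *\<^sub>R b) + (u * s + v * t) *\<^sub>R w"
    by (simp add: * algebra_simps)
  moreover have "u *\<^sub>R a + v *\<^sub>R b \<in> A"
    using assms * uv by (simp add: convexD)
  moreover have "\<bar>u * s + v * t\<bar> \<le> 1"
    using * uv convex_bound_le[of s 1 t u v] convex_bound_le[of "-s" 1 "-t" u v]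
    by (auto simp: abs_le_iff)
  ultimately show "u *\<^sub>R x + v *\<^sub>R y \<in> seg_sum A w"
    unfolding seg_sum_def by blast
qed

text \<open>Fubini along the lines parallel to \<open>u\<close>: \<open>N\<close> is the product
  measure over an orthonormal basis of the complement of \<open>u\<close>, and \<open>T y\<close> is
  the base point of the line with coordinates \<open>y\<close>.\<close>

lemma lborel_slices:
  fixes u :: "'a::euclidean_space"
  assumes "norm u = 1"
  obtains T and N :: "('a \<Rightarrow> real) measure" where
    "\<And>y. T y \<bullet> u = 0"
    "\<And>S. S \<in> sets borel \<Longrightarrow> (\<lambda>y. emeasure lborel {s. T y + s *\<^sub>R u \<in> S}) \<in> borel_measurable N"
    "\<And>S. S \<in> sets borel \<Longrightarrow> emeasure lborel S = (\<integral>\<^sup>+y. emeasure lborel {s. T y + s *\<^sub>R u \<in> S} \<partial>N)"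
proof -
  have on_u: "orthonormal {u}" using assms by (simp add: orthonormal_def)
  obtain B where B: "pairwise orthogonal B" "\<And>x. x \<in> B \<Longrightarrow> norm x = 1"
      "span B = {y. \<forall>x\<in>span {u}. orthogonal x y}"
    using orthonormal_basis_subspace[OF subspace_orthogonal_to_vectors] by metis
  then have on_B: "orthonormal B" by (simp add: orthonormal_def)
  then have fin: "finite B" by (rule orthonormal_finite)
  have on: "orthonormal (insert u B)" "span (insert u B) = UNIV" and u: "u \<notin> B"
    using orthonormal_Un_complement[OF on_u on_B B(3)] by auto
  interpret product_sigma_finite "\<lambda>_::'a. lborel :: real measure" by standard
  let ?N = "\<Pi>\<^sub>M b\<in>B. (lborel :: real measure)"
  interpret finite_product_sigma_finite "\<lambda>_::'a. lborel :: real measure" B by standard (rule fin)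
  define T where "T y = (\<Sum>b\<in>B. y b *\<^sub>R b)" for y
  have T_meas [measurable]: "T \<in> borel_measurable ?N"
    unfolding T_def by measurable
  show thesis
  proof (rule that[of T ?N])
    show "T y \<bullet> u = 0" for y
    proof -
      have "b \<bullet> u = 0" if "b \<in> B" for b
        using orthonormal_inner[OF on(1), of b u] that u by auto
      then show ?thesis by (simp add: T_def inner_sum_left)
    qed
    fix S :: "'a set" assume S [measurable]: "S \<in> sets borel"
    have "(\<lambda>y. \<integral>\<^sup>+s. indicator S (T y + s *\<^sub>R u) \<partial>lborel) \<in> borel_measurable ?N"
      by measurable
    moreover have ind: "(\<integral>\<^sup>+s. indicator S (T y + s *\<^sub>R u) \<partial>lborel) = emeasure lborel {s. T y + s *\<^sub>R u \<in> S}" for y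
    proof -
      have [measurable]: "{s. T y + s *\<^sub>R u \<in> S} \<in> sets lborel" by measurable
      have "(\<integral>\<^sup>+s. indicator S (T y + s *\<^sub>R u) \<partial>lborel) = (\<integral>\<^sup>+s. indicator {s. T y + s *\<^sub>R u \<in> S} s \<partial>lborel)"
        by (intro nn_integral_cong) (simp add: indicator_def)
      then show ?thesis by simp
    qed
    ultimately show "(\<lambda>y. emeasure lborel {s. T y + s *\<^sub>R u \<in> S}) \<in> borel_measurable ?N"
      by simp
    have "emeasure lborel S = emeasure (distr (\<Pi>\<^sub>M b\<in>insert u B. lborel) borel (\<lambda>c. \<Sum>b\<in>insert u B. c b *\<^sub>R b)) S"
      by (subst distr_PiM_orthonormal_basis[OF on]) simp
    also have "\<dots> = (\<integral>\<^sup>+c. indicator S (\<Sum>b\<in>insert u B. c b *\<^sub>R b) \<partial>(\<Pi>\<^sub>M b\<in>insert u B. lborel))"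
      by (simp add: nn_integral_distr flip: nn_integral_indicator)
    also have "\<dots> = (\<integral>\<^sup>+y. (\<integral>\<^sup>+s. indicator S (\<Sum>b\<in>insert u B. (y(u := s)) b *\<^sub>R b) \<partial>lborel) \<partial>?N)"
      by (rule product_nn_integral_insert[OF fin u]) measurable
    also have "\<dots> = (\<integral>\<^sup>+y. (\<integral>\<^sup>+s. indicator S (T y + s *\<^sub>R u) \<partial>lborel) \<partial>?N)"
    proof (intro nn_integral_cong)
      fix y s
      have "(\<Sum>b\<in>insert u B. (y(u := s)) b *\<^sub>R b) = T y + s *\<^sub>R u"
        using fin u by (auto simp: T_def intro!: sum.cong)
      then show "(indicator S (\<Sum>b\<in>insert u B. (y(u := s)) b *\<^sub>R b) :: ennreal) = indicator S (T y + s *\<^sub>R u)"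
        by simp
    qed
    finally show "emeasure lborel S = (\<integral>\<^sup>+y. emeasure lborel {s. T y + s *\<^sub>R u \<in> S} \<partial>?N)"
      by (simp add: ind)
  qed
qed

text \<open>By convexity each line parallel to \<open>u\<close> meets \<open>C\<close> in an
  interval. Adding the segment lengthens it by \<open>2 * l\<close> if it is nonempty, and the
  cylinder meets the line in a unit interval in exactly that case.\<close>

lemma measure_seg_sum:
  fixes C :: "'a::euclidean_space set"
  assumes C: "compact C" "convex C" and u: "norm u = 1" and l: "0 \<le> l"
  shows "measure lborel (seg_sum C (l *\<^sub>R u)) = measure lborel C + 2 * l * measure lborel (cyl {u} C)"
proof -
  have on: "orthonormal {u}" using u by (simp add: orthonormal_def)
  obtain T and N :: "('a \<Rightarrow> real) measure" where
    T: "\<And>y. T y \<bullet> u = 0" and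
    meas: "\<And>S. S \<in> sets borel \<Longrightarrow> (\<lambda>y. emeasure lborel {s. T y + s *\<^sub>R u \<in> S}) \<in> borel_measurable N" and
    vol: "\<And>S. S \<in> sets borel \<Longrightarrow> emeasure lborel S = (\<integral>\<^sup>+y. emeasure lborel {s. T y + s *\<^sub>R u \<in> S} \<partial>N)"
    using lborel_slices[OF u] by blast
  have cpt: "compact (seg_sum C (l *\<^sub>R u))" "compact (cyl {u} C)"
    using C on by (auto intro: compact_seg_sum compact_cyl)
  have borel: "C \<in> sets borel" "seg_sum C (l *\<^sub>R u) \<in> sets borel" "cyl {u} C \<in> sets borel"
    using C cpt by (auto intro: borel_compact)
  have slice: "emeasure lborel {s. T y + s *\<^sub>R u \<in> seg_sum C (l *\<^sub>R u)} =
      emeasure lborel {s. T y + s *\<^sub>R u \<in> C} + ennreal (2 * l) * emeasure lborel {s. T y + s *\<^sub>R u \<in> cyl {u} C}" for y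
  proof -
    let ?I = "{s. T y + s *\<^sub>R u \<in> C}"
    have inner_u: "(T y + s *\<^sub>R u) \<bullet> u = s" for s
      using T u by (simp add: inner_add_left norm_eq_1)
    have "closed ?I"
    proof -
      have "closed ((\<lambda>s. T y + s *\<^sub>R u) -` C)"
        by (intro closed_vimage compact_imp_closed C continuous_intros)
      then show ?thesis by (simp add: vimage_def)
    qed
    moreover have "bounded ?I"
    proof -
      have "?I \<subseteq> (\<lambda>x. x \<bullet> u) ` C"
        using inner_u by (auto intro!: rev_image_eqI)
      moreover have "bounded ((\<lambda>x. x \<bullet> u) ` C)"
        by (intro compact_imp_bounded compact_continuous_image C continuous_intros)
      ultimately show ?thesis by (rule bounded_subset[rotated])
    qed
    moreover have "convex ?I"
    proof (rule convexI)
      fix s t and a b :: real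
      assume *: "s \<in> ?I" "t \<in> ?I" "0 \<le> a" "0 \<le> b" "a + b = 1"
      have "a *\<^sub>R (T y + s *\<^sub>R u) + b *\<^sub>R (T y + t *\<^sub>R u) \<in> C"
        using * C by (auto intro: convexD)
      moreover have "a *\<^sub>R (T y + s *\<^sub>R u) + b *\<^sub>R (T y + t *\<^sub>R u) = (a + b) *\<^sub>R T y + (a * s + b * t) *\<^sub>R u"
        by (simp add: algebra_simps)
      ultimately show "a *\<^sub>R s + b *\<^sub>R t \<in> ?I" using * by simp
    qed
    ultimately obtain \<alpha> \<beta> where I: "?I = {\<alpha>..\<beta>}"
      using connected_compact_interval_1[of ?I] by (auto simp: compact_eq_bounded_closed convex_connected)
    have C_iff: "T y + s *\<^sub>R u \<in> C \<longleftrightarrow> s \<in> {\<alpha>..\<beta>}" for s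
      using I by blast
    have "T y + s *\<^sub>R u \<in> seg_sum C (l *\<^sub>R u) \<longleftrightarrow> (\<exists>t. \<bar>t\<bar> \<le> 1 \<and> T y + (s - t * l) *\<^sub>R u \<in> C)" for s
    proof -
      have "T y + s *\<^sub>R u = a + t *\<^sub>R l *\<^sub>R u \<longleftrightarrow> T y + (s - t * l) *\<^sub>R u = a" for a t
        by (auto simp: algebra_simps)
      then show ?thesis unfolding seg_sum_def by auto
    qed
    then have seg: "{s. T y + s *\<^sub>R u \<in> seg_sum C (l *\<^sub>R u)} = {s. \<exists>t. \<bar>t\<bar> \<le> 1 \<and> s - t * l \<in> {\<alpha>..\<beta>}}"
      by (simp only: C_iff)
    have "T y + s *\<^sub>R u \<in> cyl {u} C \<longleftrightarrow> 0 \<le> s \<and> s \<le> 1 \<and> (\<exists>k. T y + (s + k) *\<^sub>R u \<in> C)" for s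
      by (auto simp: cyl_def inner_u span_singleton scaleR_add_left add.assoc)
    then have cyl: "{s. T y + s *\<^sub>R u \<in> cyl {u} C} = {s. 0 \<le> s \<and> s \<le> 1 \<and> (\<exists>k. s + k \<in> {\<alpha>..\<beta>})}"
      by (simp only: C_iff)
    show ?thesis
    \<comment> \<open>A line that misses \<open>C\<close> is represented by
      \<open>\<beta> < \<alpha>\<close>.\<close>
    proof (cases "\<alpha> \<le> \<beta>")
      case False
      then show ?thesis unfolding seg cyl I by simp
    next
      case True
      have "{s. \<exists>t. \<bar>t\<bar> \<le> 1 \<and> s - t * l \<in> {\<alpha>..\<beta>}} = {\<alpha> - l..\<beta> + l}"
      proof (intro set_eqI iffI)
        fix s assume "s \<in> {s. \<exists>t. \<bar>t\<bar> \<le> 1 \<and> s - t * l \<in> {\<alpha>..\<beta>}}"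
        then obtain t where t: "\<bar>t\<bar> \<le> 1" "\<alpha> \<le> s - t * l" "s - t * l \<le> \<beta>" by auto
        have "\<bar>t * l\<bar> \<le> l" using t(1) l by (simp add: abs_mult mult_left_le_one_le)
        then show "s \<in> {\<alpha> - l..\<beta> + l}" using t by auto
      next
        fix s assume s: "s \<in> {\<alpha> - l..\<beta> + l}"
        \<comment> \<open>\<open>r\<close> is the displacement of \<open>s\<close> from its nearest
          point in the interval; for \<open>l = 0\<close> it is zero.\<close>
        define r where "r = (if s < \<alpha> then s - \<alpha> else if s > \<beta> then s - \<beta> else 0)"
        have r: "\<bar>r\<bar> \<le> l" "s - r \<in> {\<alpha>..\<beta>}" using s l True by (auto simp: r_def)
        have "\<bar>r / l\<bar> \<le> 1" "s - r / l * l \<in> {\<alpha>..\<beta>}"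
          using r l by (cases "l = 0"; auto simp: abs_le_iff field_simps)+
        then show "s \<in> {s. \<exists>t. \<bar>t\<bar> \<le> 1 \<and> s - t * l \<in> {\<alpha>..\<beta>}}" by blast
      qed
      moreover have "{s. 0 \<le> s \<and> s \<le> 1 \<and> (\<exists>k. s + k \<in> {\<alpha>..\<beta>})} = {0..1}"
        using True by (auto intro: exI[of _ "\<alpha> - _"])
      ultimately show ?thesis unfolding seg cyl I using True l
        by (simp add: ennreal_plus[symmetric] del: ennreal_plus)
    qed
  qed
  have "emeasure lborel (seg_sum C (l *\<^sub>R u)) = emeasure lborel C + ennreal (2 * l) * emeasure lborel (cyl {u} C)"
    unfolding vol[OF borel(1)] vol[OF borel(2)] vol[OF borel(3)] slice
    using meas[OF borel(1)] meas[OF borel(3)] by (subst nn_integral_add) (auto simp: nn_integral_cmult)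
  moreover have "emeasure lborel S = ennreal (measure lborel S)" if "compact S" for S :: "'a set"
    using that emeasure_compact_finite[OF that] by (intro emeasure_eq_ennreal_measure) auto
  ultimately have "ennreal (measure lborel (seg_sum C (l *\<^sub>R u))) = ennreal (measure lborel C + 2 * l * measure lborel (cyl {u} C))"
    using C(1) cpt l by (simp add: ennreal_mult)
  then show ?thesis
    using l by (subst (asm) ennreal_inj) auto
qed

lemma subspace_lborel_eq_distr:
  fixes L :: "'a::euclidean_space set"
  assumes L: "subspace L"
  obtains B where "orthonormal B" "span B = L"
    "subspace_lborel L = distr (\<Pi>\<^sub>M b\<in>B. lborel) borel (\<lambda>c. \<Sum>b\<in>B. c b *\<^sub>R b)"
proof -
  define B where "B = (SOME B. orthonormal_basis_of L B)"
  have "\<exists>B. orthonormal_basis_of L B"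
    using orthonormal_basis_subspace[OF L] unfolding orthonormal_basis_of_def by metis
  then have "orthonormal_basis_of L B" unfolding B_def by (rule someI_ex)
  then have "orthonormal B" "span B = L" by (simp_all add: orthonormal_basis_of_iff)
  then show thesis
    by (rule that) (simp only: subspace_lborel_def Let_def B_def)
qed

text \<open>In the coordinates of an orthonormal basis of \<open>L\<close> together with
  \<open>D\<close>, the indicator of the cylinder is the indicator of the projection times that of a
  unit cube, and the cube integrates to 1.\<close>

lemma measure_subspace_lborel_projection:
  fixes A :: "'a::euclidean_space set"
  assumes L: "subspace L" and D: "orthonormal D" and span_D: "span D = {y. \<forall>x\<in>L. orthogonal x y}"
    and p: "\<And>x. p x \<in> L" "\<And>x y. y \<in> L \<Longrightarrow> orthogonal (x - p x) y"
    and A: "compact A" and pA: "compact (p ` A)"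
  shows "measure (subspace_lborel L) (p ` A) = cyl_vol D A"
proof -
  obtain B where B: "orthonormal B" and span_B: "span B = L"
    and sub: "subspace_lborel L = distr (\<Pi>\<^sub>M b\<in>B. lborel) borel (\<lambda>c. \<Sum>b\<in>B. c b *\<^sub>R b)"
    by (rule subspace_lborel_eq_distr[OF L])
  note on = orthonormal_Un_complement[OF B D, unfolded span_B, OF span_D]
  have fin: "finite B" "finite D" using B D by (auto intro: orthonormal_finite)
  interpret product_sigma_finite "\<lambda>_::'a. lborel :: real measure" by standard
  let ?P = "\<lambda>B. \<Pi>\<^sub>M b\<in>B. (lborel :: real measure)"
  have [measurable]: "p ` A \<in> sets borel" "cyl D A \<in> sets borel"
    using compact_cyl[OF D A] pA by (auto intro: borel_compact)
  have perp: "x \<bullet> y = 0" if "x \<in> L" "y \<in> span D" for x y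
    using that span_D by (auto simp: orthogonal_def)
  have ind: "(indicator (cyl D A) (\<Sum>b\<in>B \<union> D. merge B D (x, y) b *\<^sub>R b) :: ennreal)
      = indicator (p ` A) (\<Sum>b\<in>B. x b *\<^sub>R b) * (\<Prod>d\<in>D. indicator {0..1} (y d))" for x y :: "'a \<Rightarrow> real"
  proof -
    define z where "z = (\<Sum>b\<in>B \<union> D. merge B D (x, y) b *\<^sub>R b)"
    define P where "P = (\<Sum>b\<in>B. x b *\<^sub>R b)"
    define R where "R = (\<Sum>d\<in>D. y d *\<^sub>R d)"
    have z: "z = P + R"
    proof -
      have "(\<Sum>b\<in>D. merge B D (x, y) b *\<^sub>R b) = R"
        unfolding R_def using on(3) by (intro sum.cong refl) (auto simp: merge_def)
      moreover have "(\<Sum>b\<in>B. merge B D (x, y) b *\<^sub>R b) = P"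
        unfolding P_def by (intro sum.cong refl) (auto simp: merge_def)
      ultimately show ?thesis
        unfolding z_def by (simp add: sum.union_disjoint[OF fin on(3)])
    qed
    have P: "P \<in> L" unfolding P_def span_B[symmetric] by (intro span_sum span_scale span_base)
    have R: "R \<in> span D" unfolding R_def by (intro span_sum span_scale span_base)
    have zd: "z \<bullet> d = y d" if "d \<in> D" for d
      using orthonormal_inner_sum[OF D fin(2) that, of y] perp[OF P span_base[OF that]]
      by (simp add: z R_def inner_add_left)
    have "(\<exists>q\<in>span D. z + q \<in> A) \<longleftrightarrow> P \<in> p ` A"
    proof
      assume "\<exists>q\<in>span D. z + q \<in> A"
      then obtain q where q: "q \<in> span D" "z + q \<in> A" by auto
      define a where "a = z + q"
      have "p a - P \<in> L" using P p L by (auto intro: subspace_diff)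
      \<comment> \<open>\<open>p a - P\<close> lies in \<open>L\<close> and is the difference of
        \<open>a - P\<close> and \<open>a - p a\<close>, both orthogonal to
        \<open>L\<close>.\<close>
      moreover have "(p a - P) \<bullet> (p a - P) = 0"
      proof -
        have "a - P \<in> span D" using q R by (auto simp: a_def z intro: span_add)
        then have "(p a - P) \<bullet> (a - P) = 0"
          using \<open>p a - P \<in> L\<close> perp by blast
        moreover have "(p a - P) \<bullet> (a - p a) = 0"
          using p(2)[OF \<open>p a - P \<in> L\<close>, of a] by (simp add: orthogonal_def inner_commute)
        moreover have "p a - P = (a - P) - (a - p a)" by simp
        ultimately show ?thesis by (metis diff_zero inner_diff_right)
      qed
      ultimately have "P = p a" by simp
      then show "P \<in> p ` A" using q by (auto simp: a_def)
    next
      assume "P \<in> p ` A"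
      then obtain a where a: "P = p a" "a \<in> A" by auto
      have "a - P \<in> span D"
        using p(2)[of _ a] by (auto simp: span_D a orthogonal_commute)
      then have "(a - P) - R \<in> span D" using R by (rule span_diff)
      moreover have "z + ((a - P) - R) = a" by (simp add: z)
      ultimately show "\<exists>q\<in>span D. z + q \<in> A" using a by metis
    qed
    then have z_iff: "z \<in> cyl D A \<longleftrightarrow> P \<in> p ` A \<and> (\<forall>d\<in>D. y d \<in> {0..1})"
      using zd by (auto simp: cyl_def)
    have "(indicator (cyl D A) z :: ennreal) = indicator (p ` A) P * (\<Prod>d\<in>D. indicator {0..1} (y d))"
    proof (cases "\<forall>d\<in>D. y d \<in> {0..1}")
      case True
      then have "(\<Prod>d\<in>D. indicator {0..1} (y d) :: ennreal) = 1" by (intro prod.neutral) auto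
      then show ?thesis using True z_iff by (simp add: indicator_def)
    next
      case False
      then have "(\<Prod>d\<in>D. indicator {0..1} (y d) :: ennreal) = 0"
        using fin by (intro prod_zero) (auto simp: indicator_def)
      then show ?thesis using False z_iff by (auto simp: indicator_def)
    qed
    then show ?thesis by (simp add: z_def P_def)
  qed
  have "emeasure lborel (cyl D A) = emeasure (distr (?P (B \<union> D)) borel (\<lambda>c. \<Sum>b\<in>B \<union> D. c b *\<^sub>R b)) (cyl D A)"
    by (subst distr_PiM_orthonormal_basis[OF on(1,2)]) simp
  also have "\<dots> = (\<integral>\<^sup>+c. indicator (cyl D A) (\<Sum>b\<in>B \<union> D. c b *\<^sub>R b) \<partial>?P (B \<union> D))"
    by (simp add: nn_integral_distr flip: nn_integral_indicator)
  also have "\<dots> = (\<integral>\<^sup>+x. (\<integral>\<^sup>+y. indicator (cyl D A) (\<Sum>b\<in>B \<union> D. merge B D (x, y) b *\<^sub>R b) \<partial>?P D) \<partial>?P B)"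
    using on(3) fin by (intro product_nn_integral_fold) measurable
  also have "\<dots> = (\<integral>\<^sup>+x. indicator (p ` A) (\<Sum>b\<in>B. x b *\<^sub>R b) * (\<integral>\<^sup>+y. (\<Prod>d\<in>D. indicator {0..1} (y d)) \<partial>?P D) \<partial>?P B)"
    unfolding ind by (intro nn_integral_cong nn_integral_cmult) measurable
  also have "(\<integral>\<^sup>+y. (\<Prod>d\<in>D. indicator {0..1} (y d)) \<partial>?P D) = 1"
    using fin by (subst product_nn_integral_prod) auto
  also have "(\<integral>\<^sup>+x. indicator (p ` A) (\<Sum>b\<in>B. x b *\<^sub>R b) * 1 \<partial>?P B) = emeasure (subspace_lborel L) (p ` A)"
    unfolding sub by (simp add: nn_integral_distr flip: nn_integral_indicator)
  finally show ?thesis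
    by (simp add: measure_def cyl_vol_def)
qed

section \<open>Orthogonal maps acting on cylinders, and rotations between orthonormal sets\<close>

lemma emeasure_lborel_orthogonal_image:
  fixes R :: "'a::euclidean_space \<Rightarrow> 'a"
  assumes R: "orthogonal_transformation R" and S: "compact S"
  shows "emeasure lborel (R ` S) = emeasure lborel S"
proof -
  have cont: "continuous_on X R" for X
    using R by (intro linear_continuous_on)
      (simp add: orthogonal_transformation_linear linear_conv_bounded_linear[symmetric])
  have [measurable]: "R \<in> borel_measurable borel"
    by (rule borel_measurable_continuous_onI[OF cont])
  have "compact (R ` S)" using S cont by (intro compact_continuous_image)
  then have [measurable]: "R ` S \<in> sets borel" by (rule borel_compact)
  have "emeasure lborel (R ` S) = emeasure (distr lborel borel R) (R ` S)"
    by (simp add: distr_lborel_orthogonal[OF R])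
  also have "\<dots> = emeasure lborel (R -` (R ` S))"
    by (subst emeasure_distr) auto
  also have "R -` (R ` S) = S"
    using orthogonal_transformation_inj[OF R] by (simp add: inj_vimage_image_eq)
  finally show ?thesis .
qed

lemma cyl_orthogonal_image:
  fixes R :: "'a::euclidean_space \<Rightarrow> 'a"
  assumes R: "orthogonal_transformation R"
  shows "cyl (R ` D) (R ` A) = R ` cyl D A"
proof -
  have lin: "linear R" and inner: "R v \<bullet> R w = v \<bullet> w" for v w
    using R by (auto simp: orthogonal_transformation_def)
  have "R z \<in> cyl (R ` D) (R ` A) \<longleftrightarrow> z \<in> cyl D A" for z
  proof -
    have "R z + R y \<in> R ` A \<longleftrightarrow> z + y \<in> A" for y
      by (simp add: linear_add[OF lin, symmetric] inj_image_mem_iff[OF orthogonal_transformation_inj[OF R]])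
    then show ?thesis
      by (auto simp: cyl_def inner linear_span_image[OF lin])
  qed
  moreover have "R z \<in> R ` cyl D A \<longleftrightarrow> z \<in> cyl D A" for z
    by (simp add: inj_image_mem_iff[OF orthogonal_transformation_inj[OF R]])
  moreover have "\<exists>z. x = R z" for x
    using orthogonal_transformation_surj[OF R] by (rule surjD)
  ultimately show ?thesis by (metis subsetI subset_antisym)
qed

lemma cyl_vol_orthogonal_image:
  fixes R :: "'a::euclidean_space \<Rightarrow> 'a"
  assumes "orthogonal_transformation R" "orthonormal D" "compact A"
  shows "cyl_vol (R ` D) (R ` A) = cyl_vol D A"
  using emeasure_lborel_orthogonal_image[OF assms(1) compact_cyl[OF assms(2,3)]]
  by (simp add: cyl_vol_def measure_def cyl_orthogonal_image[OF assms(1)])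

text \<open>This is projection to a point: the cylinder is a cube that no longer depends on
  \<open>A\<close>.\<close>

lemma cyl_spanning:
  assumes "span D = UNIV" "A \<noteq> {}"
  shows "cyl D A = {z. \<forall>d\<in>D. 0 \<le> z \<bullet> d \<and> z \<bullet> d \<le> 1}"
proof -
  obtain a where "a \<in> A" using assms by auto
  then have "\<exists>y. z + y \<in> A" for z by (auto intro!: exI[of _ "a - z"])
  then show ?thesis by (auto simp: cyl_def assms(1))
qed

lemma orthonormal_basis_transformation:
  fixes B :: "'a::euclidean_space set"
  assumes B: "orthonormal B" "span B = UNIV" and h: "orthonormal (h ` B)" "inj_on h B"
  defines "R \<equiv> \<lambda>x. \<Sum>b\<in>B. (x \<bullet> b) *\<^sub>R h b"
  shows "orthogonal_transformation R" "\<And>b. b \<in> B \<Longrightarrow> R b = h b"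
proof -
  have fin: "finite B" using B by (intro orthonormal_finite)
  have "R v \<bullet> R w = v \<bullet> w" for v w
  proof -
    have "R w \<bullet> h b = w \<bullet> b" if "b \<in> B" for b
    proof -
      have "R w = (\<Sum>c\<in>h ` B. (w \<bullet> the_inv_into B h c) *\<^sub>R c)"
        unfolding R_def by (simp add: sum.reindex[OF h(2)] the_inv_into_f_f[OF h(2)])
      then show ?thesis
        using orthonormal_inner_sum[OF h(1) finite_imageI[OF fin] imageI[OF that]] that
        by (simp add: the_inv_into_f_f[OF h(2)])
    qed
    then have "R v \<bullet> R w = (\<Sum>b\<in>B. (v \<bullet> b) * (w \<bullet> b))"
      by (simp add: fun_cong[OF R_def[THEN meta_eq_to_obj_eq], of v] inner_sum_left inner_commute[of "h _"])
    also have "\<dots> = (\<Sum>b\<in>B. (v \<bullet> b) *\<^sub>R b) \<bullet> w"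
      by (simp add: inner_sum_left inner_commute[of w])
    also have "\<dots> = v \<bullet> w" using orthonormal_expansion[OF B(1) fin, of v] B(2) by simp
    finally show ?thesis .
  qed
  moreover have "linear R"
    unfolding R_def by (intro linear_compose_sum ballI) (auto intro!: linearI simp: inner_add_left scaleR_add_left)
  ultimately show "orthogonal_transformation R" by (simp add: orthogonal_transformation_def)
  show "R b = h b" if "b \<in> B" for b
  proof -
    have "R b = (\<Sum>c\<in>B. if c = b then h c else 0)"
      unfolding R_def by (intro sum.cong refl) (use orthonormal_inner[OF B(1)] that in auto)
    then show ?thesis using that fin by simp
  qed
qed

text \<open>Conjugates the sign change of one coordinate by an orthogonal matrix that sends that
  axis to \<open>e\<close>. It serves to correct the determinant of an orthogonal matrix.\<close>

lemma reflection_matrix_exists: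
  fixes e :: "real^'n"
  assumes "norm e = 1"
  obtains F where "orthogonal_matrix F" "det F = -1" "\<And>x. x \<bullet> e = 0 \<Longrightarrow> F *v x = x"
proof -
  fix k :: 'n
  obtain A :: "real^'n^'n" where A: "orthogonal_matrix A" "A *v axis k 1 = e"
    using orthogonal_matrix_exists_basis[OF assms] by metis
  define J :: "real^'n^'n" where "J = (\<chi> i j. if i = j then (if i = k then -1 else 1) else 0)"
  have AA: "transpose A ** A = mat 1" "A ** transpose A = mat 1"
    using A(1) by (auto simp: orthogonal_matrix_def)
  have JJ: "transpose J ** J = mat 1"
    by (auto simp: J_def transpose_def matrix_matrix_mult_def mat_def vec_eq_iff if_distrib[where f="\<lambda>x. x * _"] cong: if_cong)
  have detJ: "det J = -1"
    by (subst det_diagonal) (auto simp: J_def)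
  have J: "J *v y = y" if "y $ k = 0" for y
    using that by (auto simp: J_def matrix_vector_mult_def vec_eq_iff if_distrib[where f="\<lambda>x. x * _"] cong: if_cong)
  show thesis
  proof
    show "orthogonal_matrix (A ** J ** transpose A)"
      using A(1) JJ by (intro orthogonal_matrix_mul) (auto simp: orthogonal_matrix[of J])
    have "det A * det (transpose A) = 1" using AA(2) det_mul[of A "transpose A"] by simp
    then show "det (A ** J ** transpose A) = -1"
      by (simp add: det_mul detJ)
    fix x assume x: "x \<bullet> e = 0"
    have "(transpose A *v x) $ k = (transpose A *v x) \<bullet> axis k 1" by (simp add: inner_axis)
    also have "\<dots> = x \<bullet> (A *v axis k 1)" by (metis dot_lmul_matrix transpose_matrix_vector)
    finally have "J *v (transpose A *v x) = transpose A *v x" using x A by (intro J) simp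
    moreover have "A *v (transpose A *v x) = x"
      by (simp only: matrix_vector_mul_assoc AA matrix_vector_mul_lid)
    ultimately show "(A ** J ** transpose A) *v x = x"
      by (metis matrix_vector_mul_assoc)
  qed
qed

lemma orthonormal_complement_exists:
  fixes S :: "'a::euclidean_space set"
  obtains E where "orthonormal E" "span E = {y. \<forall>x\<in>S. orthogonal x y}"
proof -
  show thesis
    by (rule orthonormal_basis_subspace[OF subspace_orthogonal_to_vectors[of S]], rule that)
      (simp_all add: orthonormal_def)
qed

text \<open>The orthogonal complements have bases of equal size, so a bijection from
  \<open>D\<close> to \<open>D'\<close> extends to one of orthonormal bases of the whole
  space.\<close>

lemma orthonormal_bij_extension:
  fixes D D' :: "'a::euclidean_space set"
  assumes D: "orthonormal D" "orthonormal D'" "card D = card D'"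
  obtains R where "orthogonal_transformation R" "R ` D = D'"
proof -
  obtain E where E: "orthonormal E" "span E = {y. \<forall>x\<in>span D. orthogonal x y}"
    by (rule orthonormal_complement_exists[of "span D"])
  obtain E' where E': "orthonormal E'" "span E' = {y. \<forall>x\<in>span D'. orthogonal x y}"
    by (rule orthonormal_complement_exists[of "span D'"])
  note on = orthonormal_Un_complement[OF D(1) E] and on' = orthonormal_Un_complement[OF D(2) E']
  have fin: "finite D" "finite D'" "finite E" "finite E'"
    using D E E' by (auto intro: orthonormal_finite)
  have "card (D \<union> E) = card (D' \<union> E')"
    unfolding card_orthonormal[OF on(1)] card_orthonormal[OF on'(1)] on(2) on'(2) ..
  then have "card E = card E'"
    using D(3) card_Un_disjoint[OF fin(1,3) on(3)] card_Un_disjoint[OF fin(2,4) on'(3)] by linarith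
  then obtain g where g: "bij_betw g E E'"
    using finite_same_card_bij[OF fin(3,4)] by blast
  obtain f where f: "bij_betw f D D'"
    using finite_same_card_bij[OF fin(1,2) D(3)] by blast
  define h where "h x = (if x \<in> D then f x else g x)" for x
  have hD: "bij_betw h D D'"
    using f by (rule bij_betw_cong[THEN iffD1, rotated]) (simp add: h_def)
  have hE: "bij_betw h E E'"
  proof (rule bij_betw_cong[THEN iffD1, OF _ g])
    fix x assume "x \<in> E"
    then have "x \<notin> D" using on(3) by blast
    then show "g x = h x" by (simp add: h_def)
  qed
  have h: "bij_betw h (D \<union> E) (D' \<union> E')"
    using hD hE on'(3) by (rule bij_betw_combine)
  have h_on: "orthonormal (h ` (D \<union> E))"
    unfolding bij_betw_imp_surj_on[OF h] by (rule on'(1))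
  define R where "R x = (\<Sum>b\<in>D \<union> E. (x \<bullet> b) *\<^sub>R h b)" for x
  have R: "orthogonal_transformation R" "\<And>b. b \<in> D \<union> E \<Longrightarrow> R b = h b"
    unfolding R_def
    by (rule orthonormal_basis_transformation[OF on(1,2) h_on bij_betw_imp_inj_on[OF h]], assumption?)+
  have "R ` D = h ` D" by (intro image_cong refl R(2)) simp
  then show thesis using that[OF R(1)] bij_betw_imp_surj_on[OF hD] by simp
qed

text \<open>If the orthogonal extension has determinant -1, it is preceded by a reflection that
  fixes \<open>D\<close>. The mirror's normal is a vector orthogonal to \<open>D\<close>, which
  exists because \<open>D\<close> does not span.\<close>

lemma orthonormal_rotation_exists:
  fixes D :: "(real^'n) set"
  assumes D: "orthonormal D" "orthonormal D'" "card D = card D'" and "span D \<noteq> UNIV"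
  obtains Q where "rotation_matrix Q" "(*v) Q ` D = D'"
proof -
  obtain R where R: "orthogonal_transformation R" "R ` D = D'"
    using orthonormal_bij_extension[OF D] .
  define Q where "Q = matrix R"
  have RQ: "Q *v x = R x" for x
    unfolding Q_def using matrix_vector_mul(2)[OF orthogonal_transformation_linear[OF R(1)]] by (rule fun_cong)
  have Q: "orthogonal_matrix Q" using R(1) by (simp add: Q_def orthogonal_transformation_matrix)
  show thesis
  proof (cases "det Q = 1")
    case True
    moreover have "(*v) Q ` D = D'" using R(2) by (simp add: RQ)
    ultimately show ?thesis using that[of Q] Q by (simp add: rotation_matrix_def)
  next
    case False
    then have det: "det Q = -1" using det_orthogonal_matrix[OF Q] by simp
    have "dim D < DIM(real^'n)"
      using \<open>span D \<noteq> UNIV\<close> by (meson dim_eq_full dim_subset_UNIV le_neq_implies_less)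
    then obtain x where x: "x \<noteq> 0" "\<And>y. y \<in> span D \<Longrightarrow> orthogonal x y"
      using orthogonal_to_subspace_exists by metis
    obtain F where F: "orthogonal_matrix F" "det F = -1" "\<And>y. y \<bullet> sgn x = 0 \<Longrightarrow> F *v y = y"
      using reflection_matrix_exists[of "sgn x"] x(1) by (auto simp: norm_sgn)
    have "rotation_matrix (Q ** F)"
      using Q F det by (auto simp: rotation_matrix_def det_mul orthogonal_matrix_mul)
    moreover have "(*v) (Q ** F) ` D = D'"
    proof -
      have "(Q ** F) *v d = R d" if "d \<in> D" for d
        using x(2)[OF span_base[OF that]] F(3)[of d]
        by (simp add: matrix_vector_mul_assoc[symmetric] RQ sgn_div_norm orthogonal_def inner_commute)
      then have "(*v) (Q ** F) ` D = R ` D" by (intro image_cong refl)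
      then show ?thesis using R(2) by simp
    qed
    ultimately show ?thesis by (rule that)
  qed
qed

section \<open>Averages over rotations\<close>

lemma compact_rotation_matrices: "compact {Q :: real^'n^'n. rotation_matrix Q}"
proof -
  have row: "row i Q = Q $ i" for i and Q :: "real^'n^'n" by (simp add: row_def)
  have "{Q :: real^'n^'n. rotation_matrix Q} =
      (\<Inter>i. {Q. norm (Q $ i) = 1}) \<inter> (\<Inter>i. \<Inter>j\<in>-{i}. {Q. Q $ i \<bullet> Q $ j = 0}) \<inter> {Q. det Q = 1}"
    by (auto simp: rotation_matrix_def orthogonal_matrix_orthonormal_rows row orthogonal_def)
  moreover have "closed \<dots>"
    unfolding det_def
    by (intro closed_Int closed_INT ballI closed_Collect_eq continuous_intros)
  moreover have "bounded {Q :: real^'n^'n. rotation_matrix Q}"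
  proof -
    have "norm Q \<le> sqrt (real CARD('n))" if "rotation_matrix Q" for Q :: "real^'n^'n"
      using that by (auto simp: norm_vec_def[of Q] L2_set_def rotation_matrix_def orthogonal_matrix_orthonormal_rows row)
    then show ?thesis unfolding bounded_iff by blast
  qed
  ultimately show ?thesis by (simp add: compact_eq_bounded_closed)
qed

lemma continuous_on_matrix_vector_mult [continuous_intros]:
  fixes f :: "'a::topological_space \<Rightarrow> real^'n^'m"
  assumes "continuous_on S f" "continuous_on S g"
  shows "continuous_on S (\<lambda>x. f x *v g x)"
  unfolding matrix_vector_mult_def
  by (intro continuous_on_vec_lambda continuous_intros assms)

lemma continuous_on_matrix_matrix_mult [continuous_intros]:
  fixes f :: "'a::topological_space \<Rightarrow> real^'n^'m"
  assumes "continuous_on S f" "continuous_on S g"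
  shows "continuous_on S (\<lambda>x. f x ** g x)"
  unfolding matrix_matrix_mult_def
  by (intro continuous_on_vec_lambda continuous_intros assms)

lemma rotation_matrix_orthogonal_transformation:
  "rotation_matrix Q \<Longrightarrow> orthogonal_transformation ((*v) Q)" for Q :: "real^'n^'n"
  by (simp add: rotation_matrix_def orthogonal_transformation_matrix)

lemma projector_family_range:
  fixes P :: "nat \<Rightarrow> real^'n^'n"
  assumes "projector_family P" "j \<le> CARD('n)"
  defines "L \<equiv> range ((*v) (P j))"
  shows "subspace L" "dim L = j" "\<And>x y. y \<in> L \<Longrightarrow> orthogonal (x - P j *v x) y"
    "\<And>y. y \<in> L \<Longrightarrow> P j *v y = y"
proof -
  obtain S where S: "dim S = j" "subspace S" "\<And>x. P j *v x \<in> S"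
    and perp: "\<And>x y. y \<in> S \<Longrightarrow> orthogonal (x - P j *v x) y"
    using assms(1,2) unfolding projector_family_def orthogonal_projector_onto_def by metis
  have fix_S: "P j *v y = y" if "y \<in> S" for y
  proof -
    have "y - P j *v y \<in> S" using S that by (intro subspace_diff)
    then have "orthogonal (y - P j *v y) (y - P j *v y)" by (rule perp)
    then show ?thesis by (simp add: orthogonal_def)
  qed
  have "L = S"
    unfolding L_def
  proof (intro set_eqI iffI)
    fix y assume "y \<in> S"
    then have "y = P j *v y" by (simp add: fix_S)
    then show "y \<in> range ((*v) (P j))" by (rule range_eqI)
  qed (use S in auto)
  then show "subspace L" "dim L = j" "\<And>x y. y \<in> L \<Longrightarrow> orthogonal (x - P j *v x) y"
    "\<And>y. y \<in> L \<Longrightarrow> P j *v y = y"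
    using S perp fix_S by simp_all
qed

locale haar =
  fixes H :: "(real^'n^'n) measure"
  assumes haar: "haar_prob_SO H"
begin

sublocale prob_space H
  using haar by (simp add: haar_prob_SO_def)

lemma space_H: "space H = {Q. rotation_matrix Q}"
  and sets_H [measurable_cong]: "sets H = sets (restrict_space borel {Q. rotation_matrix Q})"
  using haar by (simp_all add: haar_prob_SO_def)

lemma borel_measurable_H: "f \<in> borel_measurable borel \<Longrightarrow> f \<in> borel_measurable H"
  using measurable_cong_sets[OF sets_H refl] measurable_restrict_space1 by blast

lemma left_mult_measurable:
  assumes "rotation_matrix R"
  shows "(\<lambda>Q. R ** Q) \<in> H \<rightarrow>\<^sub>M H"
proof -
  have "(\<lambda>Q. R ** Q) \<in> borel \<rightarrow>\<^sub>M borel"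
    by (intro borel_measurable_continuous_onI continuous_intros)
  then have "(\<lambda>Q. R ** Q) \<in> H \<rightarrow>\<^sub>M borel" by (rule borel_measurable_H)
  moreover have "R ** Q \<in> {Q. rotation_matrix Q}" if "Q \<in> space H" for Q
    using that assms by (auto simp: space_H rotation_matrix_def orthogonal_matrix_mul det_mul)
  ultimately have "(\<lambda>Q. R ** Q) \<in> H \<rightarrow>\<^sub>M restrict_space borel {Q. rotation_matrix Q}"
    by (intro measurable_restrict_space2) auto
  then show ?thesis using measurable_cong_sets[OF refl sets_H] by blast
qed

lemma integral_left_mult:
  fixes f :: "real^'n^'n \<Rightarrow> real"
  assumes "rotation_matrix R" "f \<in> borel_measurable H"
  shows "(\<integral>Q. f (R ** Q) \<partial>H) = (\<integral>Q. f Q \<partial>H)"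
proof -
  have "distr H H (\<lambda>Q. R ** Q) = H" using haar assms(1) by (simp add: haar_prob_SO_def)
  then show ?thesis
    using integral_distr[OF left_mult_measurable[OF assms(1)] assms(2)] by simp
qed

text \<open>All cylinders are slices, over the rotation \<open>Q\<close>, of one compact set of
  pairs. Slice volumes are measurable, and they are bounded by the volume of the set's projection to
  the space.\<close>

lemma integrable_cyl_vol:
  assumes D: "orthonormal D" and K: "compact K"
  shows "integrable H (\<lambda>Q. cyl_vol D ((*v) Q ` K))"
proof -
  let ?f = "\<lambda>p. (fst p, fst p *v fst (snd p) - (\<Sum>d\<in>D. ((fst p *v fst (snd p)) \<bullet> d) *\<^sub>R d) + snd (snd p))"
  define S where "S = ?f ` ({Q :: real^'n^'n. rotation_matrix Q} \<times> K \<times> unit_cube D)"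
  have "compact S"
    unfolding S_def
    by (intro compact_continuous_image compact_Times compact_rotation_matrices K compact_unit_cube[OF D]
        continuous_intros)
  have slice: "Pair Q -` S = cyl D ((*v) Q ` K)" if "rotation_matrix Q" for Q
  proof -
    have "z \<in> Pair Q -` S \<longleftrightarrow> z \<in> cyl D ((*v) Q ` K)" for z
      using that unfolding cyl_eq_image[OF D] S_def by force
    then show ?thesis by blast
  qed
  have "S \<in> sets (borel \<Otimes>\<^sub>M lborel)"
    using borel_compact[OF \<open>compact S\<close>]
    by (simp add: borel_prod[symmetric] sets_pair_measure_cong[OF refl sets_lborel])
  then have "(\<lambda>Q. emeasure lborel (Pair Q -` S)) \<in> borel_measurable borel"
    by (rule sigma_finite_measure.measurable_emeasure_Pair[OF sigma_finite_lborel])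
  then have "(\<lambda>Q. measure lborel (Pair Q -` S)) \<in> borel_measurable borel"
    unfolding measure_def by measurable
  then have "(\<lambda>Q. measure lborel (Pair Q -` S)) \<in> borel_measurable H"
    by (rule borel_measurable_H)
  then have meas: "(\<lambda>Q. cyl_vol D ((*v) Q ` K)) \<in> borel_measurable H"
    by (rule measurable_cong[THEN iffD1, rotated]) (simp add: space_H slice cyl_vol_def)
  have "compact (snd ` S)"
    using \<open>compact S\<close> by (intro compact_continuous_image continuous_intros)
  then have fm: "snd ` S \<in> fmeasurable lborel"
    using emeasure_compact_finite[OF \<open>compact (snd ` S)\<close>]
    by (auto simp: fmeasurable_def intro: borel_compact)
  have "norm (cyl_vol D ((*v) Q ` K)) \<le> measure lborel (snd ` S)" if "rotation_matrix Q" for Q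
  proof -
    have "cyl D ((*v) Q ` K) \<subseteq> snd ` S" using slice[OF that] by force
    moreover have "compact (cyl D ((*v) Q ` K))"
      using K by (intro compact_cyl D compact_continuous_image continuous_intros)
    ultimately show ?thesis
      unfolding cyl_vol_def using fm by (auto intro!: measure_mono_fmeasurable borel_compact)
  qed
  then show ?thesis
    using meas by (intro integrable_const_bound[of _ "measure lborel (snd ` S)"]) (auto simp: space_H)
qed

text \<open>A rotation taking \<open>D\<close> to \<open>D'\<close> is absorbed by left invariance.
  When \<open>D\<close> spans there may be no such rotation, but then the cylinders are cubes
  independent of \<open>Q\<close>, and any orthogonal map compares them.\<close>

lemma integral_cyl_vol_cong:
  assumes D: "orthonormal D" "orthonormal D'" "card D = card D'" and K: "compact K" "K \<noteq> {}"
  shows "(\<integral>Q. cyl_vol D ((*v) Q ` K) \<partial>H) = (\<integral>Q. cyl_vol D' ((*v) Q ` K) \<partial>H)"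
proof -
  have cpt: "compact ((*v) Q ` K)" for Q :: "real^'n^'n"
    using K by (intro compact_continuous_image continuous_intros)
  show ?thesis
  proof (cases "span D = UNIV")
    case True
    have "dim D' = DIM(real^'n)"
      using card_orthonormal[OF D(1)] card_orthonormal[OF D(2)] D(3) True by simp
    then have span': "span D' = UNIV" by (simp only: dim_eq_full)
    obtain R where R: "orthogonal_transformation R" "R ` D = D'"
      by (rule orthonormal_bij_extension[OF D])
    have "cyl_vol D ((*v) Q ` K) = cyl_vol D' ((*v) Q ` K)" for Q
    proof -
      have "cyl_vol D ((*v) Q ` K) = cyl_vol D' (R ` (*v) Q ` K)"
        using cyl_vol_orthogonal_image[OF R(1) D(1) cpt[of Q]] R(2) by simp
      also have "\<dots> = cyl_vol D' ((*v) Q ` K)"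
        using K(2) by (simp add: cyl_vol_def cyl_spanning[OF span'])
      finally show ?thesis .
    qed
    then show ?thesis by simp
  next
    case False
    obtain R where R: "rotation_matrix R" "(*v) R ` D = D'"
      by (rule orthonormal_rotation_exists[OF D False])
    have "(\<integral>Q. cyl_vol D' ((*v) Q ` K) \<partial>H) = (\<integral>Q. cyl_vol D' ((*v) (R ** Q) ` K) \<partial>H)"
      using integral_left_mult[OF R(1) borel_measurable_integrable[OF integrable_cyl_vol[OF D(2) K(1)]]] by simp
    also have "\<dots> = (\<integral>Q. cyl_vol D ((*v) Q ` K) \<partial>H)"
    proof (intro Bochner_Integration.integral_cong refl)
      fix Q
      have "(*v) (R ** Q) ` K = (*v) R ` (*v) Q ` K"
        by (simp add: image_image matrix_vector_mul_assoc)
      then show "cyl_vol D' ((*v) (R ** Q) ` K) = cyl_vol D ((*v) Q ` K)"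
        using cyl_vol_orthogonal_image[OF rotation_matrix_orthogonal_transformation[OF R(1)] D(1) cpt[of Q]] R(2)
        by simp
    qed
    finally show ?thesis ..
  qed
qed

definition mean_proj :: "(nat \<Rightarrow> real^'n^'n) \<Rightarrow> nat \<Rightarrow> (real^'n) set \<Rightarrow> real" where
  "mean_proj P j K =
    (\<integral>Q. measure (subspace_lborel (range ((*v) (P j)))) ((\<lambda>x. P j *v (Q *v x)) ` K) \<partial>H)"

text \<open>\<open>D\<close> may be replaced by an orthonormal basis of the complement of the range
  of \<open>P j\<close>, which has the same size; the two integrands then agree pointwise.\<close>

lemma integral_cyl_vol:
  assumes P: "projector_family P" and D: "orthonormal D" "card D + j = CARD('n)"
    and K: "compact K" "K \<noteq> {}"
  shows "(\<integral>Q. cyl_vol D ((*v) Q ` K) \<partial>H) = mean_proj P j K"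
proof -
  have j: "j \<le> CARD('n)" using D(2) by simp
  define L where "L = range ((*v) (P j))"
  note sub = projector_family_range(1)[OF P j, folded L_def]
    and L = projector_family_range(2)[OF P j, folded L_def]
    and perp = projector_family_range(3)[OF P j, folded L_def]
  have Px: "P j *v x \<in> L" for x by (simp add: L_def)
  obtain B where B: "orthonormal B" "span B = L"
  proof -
    obtain B where "pairwise orthogonal B" "\<And>x. x \<in> B \<Longrightarrow> norm x = 1" "span B = L"
      using orthonormal_basis_subspace[OF sub] by metis
    then show thesis using that[of B] by (simp add: orthonormal_def)
  qed
  obtain D' where D': "orthonormal D'" "span D' = {y. \<forall>x\<in>span B. orthogonal x y}"
    by (rule orthonormal_complement_exists[of "span B"])
  note on = orthonormal_Un_complement[OF B(1) D']
  have "card D' + j = CARD('n)"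
  proof -
    have "card (B \<union> D') = CARD('n)"
      using card_orthonormal[OF on(1)] unfolding on(2) by simp
    moreover have "card B = j" using card_orthonormal[OF B(1)] L B(2) by simp
    ultimately show ?thesis
      using card_Un_disjoint[OF orthonormal_finite[OF B(1)] orthonormal_finite[OF D'(1)] on(3)] by simp
  qed
  then have "(\<integral>Q. cyl_vol D ((*v) Q ` K) \<partial>H) = (\<integral>Q. cyl_vol D' ((*v) Q ` K) \<partial>H)"
    using D(2) by (intro integral_cyl_vol_cong D D' K) simp
  also have "\<dots> = mean_proj P j K"
    unfolding mean_proj_def L_def[symmetric]
  proof (intro Bochner_Integration.integral_cong refl)
    fix Q :: "real^'n^'n"
    have cpt: "compact ((*v) Q ` K)"
      using K by (intro compact_continuous_image continuous_intros)
    have cpt': "compact ((*v) (P j) ` (*v) Q ` K)"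
      by (intro compact_continuous_image[OF _ cpt] continuous_intros)
    show "cyl_vol D' ((*v) Q ` K) = measure (subspace_lborel L) ((\<lambda>x. P j *v (Q *v x)) ` K)"
      using measure_subspace_lborel_projection[OF sub D'(1) D'(2)[unfolded B(2)] Px perp cpt cpt']
      by (simp add: image_image)
  qed
  finally show ?thesis .
qed

end

text \<open>The Minkowski sum of \<open>A\<close> with the zonotope generated by \<open>ws\<close>;
  the zonotope itself is \<open>zsum {0} ws\<close>. The fold lets volumes be followed segment by
  segment.\<close>

definition zsum :: "'a::real_vector set \<Rightarrow> 'a list \<Rightarrow> 'a set" where
  "zsum A ws = foldr (\<lambda>w B. seg_sum B w) ws A"

lemma zsum_simps [simp]: "zsum A [] = A" "zsum A (w # ws) = seg_sum (zsum A ws) w"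
  by (simp_all add: zsum_def)

lemma compact_zsum: "compact A \<Longrightarrow> compact (zsum A ws)" for A :: "'a::real_normed_vector set"
  by (induction ws) (auto intro: compact_seg_sum)

lemma convex_zsum: "convex A \<Longrightarrow> convex (zsum A ws)"
  by (induction ws) (auto intro: convex_seg_sum)

lemma seg_sum_zero [simp]: "seg_sum A 0 = A"
  by (auto simp: seg_sum_def intro: exI[of _ 0])

text \<open>\<open>v\<close> is the part of \<open>w\<close> orthogonal to \<open>D\<close>. Only
  this part survives the projection, so the segment formula applies to the cylinder with length
  factor \<open>r * norm v\<close>.\<close>

lemma cyl_vol_seg_sum:
  fixes A :: "'a::euclidean_space set"
  assumes D: "orthonormal D" and A: "compact A" "convex A" and r: "r \<ge> 0"
    and v: "v = w - (\<Sum>d\<in>D. (w \<bullet> d) *\<^sub>R d)" "v \<noteq> 0"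
  shows "orthonormal (insert (sgn v) D)" "sgn v \<notin> D"
    "cyl_vol D (seg_sum A (r *\<^sub>R w)) = cyl_vol D A + 2 * (r * norm v) * cyl_vol (insert (sgn v) D) A"
proof -
  have fin: "finite D" using D by (rule orthonormal_finite)
  have vd: "v \<bullet> d = 0" if "d \<in> D" for d
    using orthonormal_inner_sum[OF D fin that] by (simp add: v(1) inner_diff_left)
  then have ud: "sgn v \<bullet> d = 0" if "d \<in> D" for d using that by (simp add: sgn_div_norm)
  show on: "orthonormal (insert (sgn v) D)"
    using v ud by (intro orthonormal_insert D) (auto simp: norm_sgn)
  show "sgn v \<notin> D"
    using ud[of "sgn v"] v(2) by (auto simp: sgn_zero_iff)
  have "r *\<^sub>R w - r *\<^sub>R v = r *\<^sub>R (\<Sum>d\<in>D. (w \<bullet> d) *\<^sub>R d)"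
    by (simp add: v(1) scaleR_diff_right)
  also have "\<dots> \<in> span D" by (intro span_scale span_sum span_base)
  finally have "cyl D (seg_sum A (r *\<^sub>R w)) = seg_sum (cyl D A) (r *\<^sub>R v)"
    by (intro cyl_seg_sum) (auto simp: vd)
  also have "r *\<^sub>R v = (r * norm v) *\<^sub>R sgn v"
    using v(2) by (simp add: sgn_div_norm)
  finally have eq: "cyl D (seg_sum A (r *\<^sub>R w)) = seg_sum (cyl D A) ((r * norm v) *\<^sub>R sgn v)" .
  show "cyl_vol D (seg_sum A (r *\<^sub>R w)) = cyl_vol D A + 2 * (r * norm v) * cyl_vol (insert (sgn v) D) A"
    unfolding cyl_vol_def eq
    using v(2) r measure_seg_sum[OF compact_cyl[OF D A(1)] convex_cyl[OF A(2)], of "sgn v" "r * norm v"]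
    by (simp add: norm_sgn cyl_insert[OF ud])
qed

lemma cyl_seg_sum_span:
  assumes "w \<in> span D"
  shows "cyl D (seg_sum A w) = cyl D A"
  using cyl_seg_sum[of D 0 w A] assms by simp

context haar
begin

text \<open>
  The scaled segments \<open>r w\<close> are added one at a time; each splits off a term in which \<open>D\<close> gains the
  direction of the part of \<open>w\<close> orthogonal to \<open>D\<close>. The factor \<open>r ^ card D\<close> makes the degree in \<open>r\<close>
  agree with the codimension of the projection, so that the induction needs no index shift.
\<close>

lemma zonotope_polynomial:
  assumes P: "projector_family P" and D: "orthonormal D"
  shows "\<exists>b. (\<forall>j. 0 \<le> b j) \<and> (\<forall>r K. 0 \<le> r \<longrightarrow> compact K \<longrightarrow> convex K \<longrightarrow> K \<noteq> {} \<longrightarrow>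
      integrable H (\<lambda>Q. cyl_vol D (zsum ((*v) Q ` K) (map ((*\<^sub>R) r) ws))) \<and>
      r ^ card D * (\<integral>Q. cyl_vol D (zsum ((*v) Q ` K) (map ((*\<^sub>R) r) ws)) \<partial>H)
        = (\<Sum>j\<le>CARD('n). b j * r ^ j * mean_proj P (CARD('n) - j) K))"
  using D
proof (induction ws arbitrary: D)
  case Nil
  have "card D \<le> CARD('n)"
    using card_orthonormal[OF Nil] dim_subset_UNIV[of D] by simp
  \<comment> \<open>Without segments only the degree \<open>card D\<close>, the codimension of the
    projection, occurs.\<close>
  then show ?case
    using Nil integrable_cyl_vol integral_cyl_vol[OF P Nil, of "CARD('n) - card D"]
    by (intro exI[of _ "\<lambda>j. if j = card D then 1 else 0"])
      (simp add: if_distrib[where f="\<lambda>x. x * _"] cong: if_cong)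
next
  case (Cons w ws)
  let ?Z = "\<lambda>r K Q. zsum ((*v) Q ` K) (map ((*\<^sub>R) r) ws)"
  let ?S = "\<lambda>b r K. \<Sum>j\<le>CARD('n). b j * r ^ j * mean_proj P (CARD('n) - j) K"
  define v where "v = w - (\<Sum>d\<in>D. (w \<bullet> d) *\<^sub>R d)"
  from Cons.IH[OF Cons.prems] obtain b where b: "\<And>j. 0 \<le> b j" and
    b_int: "\<And>r K. 0 \<le> r \<Longrightarrow> compact K \<Longrightarrow> convex K \<Longrightarrow> K \<noteq> {} \<Longrightarrow>
      integrable H (\<lambda>Q. cyl_vol D (?Z r K Q))" and
    b_eq: "\<And>r K. 0 \<le> r \<Longrightarrow> compact K \<Longrightarrow> convex K \<Longrightarrow> K \<noteq> {} \<Longrightarrow>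
      r ^ card D * (\<integral>Q. cyl_vol D (?Z r K Q) \<partial>H)
        = ?S b r K"
    by blast
  have image: "compact ((*v) Q ` K)" "convex ((*v) Q ` K)" if "compact K" "convex K"
    for K and Q :: "real^'n^'n"
    using that by (auto intro!: compact_continuous_image continuous_intros convex_linear_image)
  show ?case
  proof (cases "v = 0")
    case True
    \<comment> \<open>The segment lies in the span of \<open>D\<close>, so its projection is a point
      and adds nothing.\<close>
    then have "w = (\<Sum>d\<in>D. (w \<bullet> d) *\<^sub>R d)" by (simp add: v_def)
    also have "\<dots> \<in> span D" by (intro span_sum span_scale span_base)
    finally have "cyl_vol D (zsum A (map ((*\<^sub>R) r) (w # ws))) = cyl_vol D (zsum A (map ((*\<^sub>R) r) ws))" for A r
      by (simp add: cyl_vol_def cyl_seg_sum_span span_scale)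
    then show ?thesis using b b_int b_eq by (intro exI[of _ b]) auto
  next
    case False
    have fin: "finite D" using Cons.prems by (rule orthonormal_finite)
    note step = cyl_vol_seg_sum[OF Cons.prems _ _ _ v_def False]
    define D' where "D' = insert (sgn v) D"
    have D': "orthonormal D'" "card D' = Suc (card D)"
      using step(1,2)[of "{}" 0] fin by (auto simp: D'_def)
    from Cons.IH[OF D'(1)] obtain c where c: "\<And>j. 0 \<le> c j" and
      c_int: "\<And>r K. 0 \<le> r \<Longrightarrow> compact K \<Longrightarrow> convex K \<Longrightarrow> K \<noteq> {} \<Longrightarrow>
        integrable H (\<lambda>Q. cyl_vol D' (?Z r K Q))" and
      c_eq: "\<And>r K. 0 \<le> r \<Longrightarrow> compact K \<Longrightarrow> convex K \<Longrightarrow> K \<noteq> {} \<Longrightarrow>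
        r ^ card D' * (\<integral>Q. cyl_vol D' (?Z r K Q) \<partial>H)
          = ?S c r K"
      by blast
    have eq: "cyl_vol D (zsum A (map ((*\<^sub>R) r) (w # ws))) = cyl_vol D (zsum A (map ((*\<^sub>R) r) ws))
        + 2 * (r * norm v) * cyl_vol D' (zsum A (map ((*\<^sub>R) r) ws))"
      if "compact A" "convex A" "0 \<le> r" for A r
      using step(3)[OF compact_zsum convex_zsum] that by (simp add: D'_def)
    \<comment> \<open>The new segment contributes a factor \<open>2 * r * norm v\<close>. Its
      \<open>r\<close> turns \<open>r ^ card D\<close> into \<open>r ^ card D'\<close>, so the two
      lists of coefficients add degree by degree.\<close>
    show ?thesis
    proof (intro exI[of _ "\<lambda>j. b j + 2 * norm v * c j"] conjI allI impI)
      show "0 \<le> b j + 2 * norm v * c j" for j using b c by simp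
      fix r :: real and K :: "(real^'n) set"
      assume r: "0 \<le> r" and K: "compact K" "convex K" "K \<noteq> {}"
      note eq' = eq[OF image(1)[OF K(1,2)] image(2)[OF K(1,2)] r]
      show "integrable H (\<lambda>Q. cyl_vol D (zsum ((*v) Q ` K) (map ((*\<^sub>R) r) (w # ws))))"
        unfolding eq' by (intro Bochner_Integration.integrable_add integrable_mult_right b_int c_int r K)
      have "(\<integral>Q. cyl_vol D (zsum ((*v) Q ` K) (map ((*\<^sub>R) r) (w # ws))) \<partial>H)
          = (\<integral>Q. cyl_vol D (?Z r K Q) \<partial>H)
            + 2 * (r * norm v) * (\<integral>Q. cyl_vol D' (?Z r K Q) \<partial>H)"
        unfolding eq' using b_int[OF r K] c_int[OF r K] by simp
      then have "r ^ card D * (\<integral>Q. cyl_vol D (zsum ((*v) Q ` K) (map ((*\<^sub>R) r) (w # ws))) \<partial>H)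
          = r ^ card D * (\<integral>Q. cyl_vol D (?Z r K Q) \<partial>H)
          + 2 * norm v * (r ^ card D' * (\<integral>Q. cyl_vol D' (?Z r K Q) \<partial>H))"
        by (simp add: D'(2) algebra_simps)
      also have "\<dots> = (\<Sum>j\<le>CARD('n). (b j + 2 * norm v * c j) * r ^ j * mean_proj P (CARD('n) - j) K)"
        unfolding b_eq[OF r K] c_eq[OF r K]
        by (simp add: sum_distrib_left sum.distrib[symmetric] algebra_simps)
      finally show "r ^ card D * (\<integral>Q. cyl_vol D (zsum ((*v) Q ` K) (map ((*\<^sub>R) r) (w # ws))) \<partial>H)
          = (\<Sum>j\<le>CARD('n). (b j + 2 * norm v * c j) * r ^ j * mean_proj P (CARD('n) - j) K)" .
    qed
  qed
qed

end

section \<open>Zonotopes approximating the ball\<close>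

lemma seg_sum_iff: "z \<in> seg_sum A w \<longleftrightarrow> (\<exists>t. \<bar>t\<bar> \<le> 1 \<and> z - t *\<^sub>R w \<in> A)"
proof
  assume "\<exists>t. \<bar>t\<bar> \<le> 1 \<and> z - t *\<^sub>R w \<in> A"
  then obtain t where "\<bar>t\<bar> \<le> 1" "z - t *\<^sub>R w \<in> A" by auto
  then show "z \<in> seg_sum A w"
    unfolding seg_sum_def by (auto intro!: exI[of _ "z - t *\<^sub>R w"] exI[of _ t])
qed (auto simp: seg_sum_def)

lemma zsum_iff: "z \<in> zsum A ws \<longleftrightarrow> (\<exists>a\<in>A. z - a \<in> zsum {0} ws)"
proof (induction ws arbitrary: z)
  case (Cons w ws)
  have eq: "z - t *\<^sub>R w - a = z - a - t *\<^sub>R w" for t a by simp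
  show ?case
    unfolding zsum_simps seg_sum_iff Cons.IH eq by blast
qed auto

text \<open>Together with \<open>zsum_inner_attained\<close> this identifies
  \<open>\<Sum>w\<leftarrow>ws. \<bar>w \<bullet> x\<bar>\<close> as the support function of the
  zonotope.\<close>

lemma zsum_inner_le: "y \<in> zsum {0} ws \<Longrightarrow> y \<bullet> x \<le> (\<Sum>w\<leftarrow>ws. \<bar>w \<bullet> x\<bar>)"
proof (induction ws arbitrary: y)
  case (Cons w ws)
  then obtain z t where z: "y = z + t *\<^sub>R w" "z \<in> zsum {0} ws" "\<bar>t\<bar> \<le> 1"
    by (auto simp: seg_sum_def)
  have "t * (w \<bullet> x) \<le> \<bar>t\<bar> * \<bar>w \<bullet> x\<bar>" by (metis abs_ge_self abs_mult)
  also have "\<dots> \<le> \<bar>w \<bullet> x\<bar>" using z by (simp add: mult_left_le_one_le)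
  finally show ?case using Cons.IH[OF z(2)] z(1) by (simp add: inner_add_left)
qed auto

lemma zsum_inner_attained: "\<exists>y\<in>zsum {0} ws. y \<bullet> x = (\<Sum>w\<leftarrow>ws. \<bar>w \<bullet> x\<bar>)"
proof (induction ws)
  case (Cons w ws)
  then obtain y where y: "y \<in> zsum {0} ws" "y \<bullet> x = (\<Sum>w\<leftarrow>ws. \<bar>w \<bullet> x\<bar>)" by auto
  have "y + sgn (w \<bullet> x) *\<^sub>R w \<in> zsum {0} (w # ws)"
    using y(1) by (auto simp: seg_sum_def abs_sgn_eq intro!: exI[of _ y] exI[of _ "sgn (w \<bullet> x)"])
  moreover have "(y + sgn (w \<bullet> x) *\<^sub>R w) \<bullet> x = (\<Sum>w\<leftarrow>w # ws. \<bar>w \<bullet> x\<bar>)"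
    using y(2) by (simp add: inner_add_left abs_sgn mult.commute)
  ultimately show ?case by blast
qed auto

text \<open>A point outside the compact convex zonotope is strictly separated from it, and the
  separating normal violates the bound by the support function.\<close>

lemma mem_zsum_if_inner_le:
  fixes p :: "'a::euclidean_space"
  assumes "\<And>x. p \<bullet> x \<le> (\<Sum>w\<leftarrow>ws. \<bar>w \<bullet> x\<bar>)"
  shows "p \<in> zsum {0} ws"
proof (rule ccontr)
  assume "p \<notin> zsum {0} ws"
  then obtain a b where ab: "a \<bullet> p < b" "\<forall>x\<in>zsum {0} ws. b < a \<bullet> x"
    using separating_hyperplane_closed_point[of "zsum {0} ws" p]
    by (metis compact_sing compact_zsum compact_imp_closed convex_singleton convex_zsum)
  obtain y where "y \<in> zsum {0} ws" "y \<bullet> (-a) = (\<Sum>w\<leftarrow>ws. \<bar>w \<bullet> (-a)\<bar>)"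
    using zsum_inner_attained by blast
  then show False using ab assms[of "-a"] by (auto simp: inner_commute)
qed

text \<open>Formulated by distance instead of as a sum with a ball, so that the sublevel sets in the
  Gaussian integral are literally parallel bodies.\<close>

definition parallel_body :: "'a::metric_space set \<Rightarrow> real \<Rightarrow> 'a set" where
  "parallel_body K r = {x. infdist x K \<le> r}"

lemma compact_parallel_body:
  fixes K :: "'a::euclidean_space set"
  assumes "compact K" "K \<noteq> {}"
  shows "compact (parallel_body K r)"
proof -
  \<comment> \<open>\<open>compact_infdist_le\<close> is stated for positive radii, whereas
    \<open>r\<close> is arbitrary.\<close>
  have "parallel_body K r = {x. infdist x K \<le> max 1 r} \<inter> {x. infdist x K \<le> r}"
    by (auto simp: parallel_body_def)
  moreover have "compact {x. infdist x K \<le> max 1 r}"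
    using assms by (intro compact_infdist_le) auto
  moreover have "closed {x. infdist x K \<le> r}"
    by (intro closed_Collect_le continuous_intros)
  ultimately show ?thesis by (simp add: compact_Int_closed)
qed

lemma parallel_bodyE:
  fixes K :: "'a::euclidean_space set"
  assumes "x \<in> parallel_body K r" "compact K" "K \<noteq> {}"
  obtains a where "a \<in> K" "norm (x - a) \<le> r"
proof -
  obtain a where "a \<in> K" "infdist x K = dist x a"
    by (rule infdist_attains_inf[OF compact_imp_closed[OF assms(2)] assms(3)])
  then show thesis using that[of a] assms(1) by (simp add: parallel_body_def dist_norm)
qed

lemma parallel_bodyI:
  fixes K :: "'a::euclidean_space set"
  shows "a \<in> K \<Longrightarrow> norm (x - a) \<le> r \<Longrightarrow> x \<in> parallel_body K r"
  unfolding parallel_body_def using infdist_le[of a K x] by (auto simp: dist_norm)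

text \<open>The support function of the zonotope is within a factor
  \<open>1 \<plusminus> \<epsilon>\<close> of that of the unit ball. The outer inclusion tests it in
  the direction \<open>z - a\<close> itself; the inner one is Cauchy-Schwarz followed by
  separation.\<close>

lemma zsum_parallel_body:
  fixes K :: "'a::euclidean_space set"
  assumes h: "\<And>x. \<bar>(\<Sum>w\<leftarrow>ws. \<bar>w \<bullet> x\<bar>) - norm x\<bar> \<le> \<epsilon> * norm x"
    and r: "0 \<le> r" and K: "compact K" "K \<noteq> {}"
  shows "zsum K (map ((*\<^sub>R) r) ws) \<subseteq> parallel_body K (r * (1 + \<epsilon>))"
    and "parallel_body K (r * (1 - \<epsilon>)) \<subseteq> zsum K (map ((*\<^sub>R) r) ws)"
proof -
  have scale: "(\<Sum>w\<leftarrow>map ((*\<^sub>R) r) ws. \<bar>w \<bullet> x\<bar>) = r * (\<Sum>w\<leftarrow>ws. \<bar>w \<bullet> x\<bar>)" for x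
    using r by (induction ws) (auto simp: abs_mult algebra_simps)
  show "zsum K (map ((*\<^sub>R) r) ws) \<subseteq> parallel_body K (r * (1 + \<epsilon>))"
  proof
    fix z assume "z \<in> zsum K (map ((*\<^sub>R) r) ws)"
    then obtain a where a: "a \<in> K" "z - a \<in> zsum {0} (map ((*\<^sub>R) r) ws)"
      by (subst (asm) zsum_iff) auto
    have "norm (z - a) * norm (z - a) = (z - a) \<bullet> (z - a)"
      by (simp add: dot_square_norm power2_eq_square)
    also have "\<dots> \<le> r * (\<Sum>w\<leftarrow>ws. \<bar>w \<bullet> (z - a)\<bar>)"
      using zsum_inner_le[OF a(2), of "z - a"] by (simp only: scale)
    also have "\<dots> \<le> r * ((1 + \<epsilon>) * norm (z - a))"
      using h[of "z - a"] r by (intro mult_left_mono) (auto simp: algebra_simps)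
    finally have le: "norm (z - a) * norm (z - a) \<le> (r * (1 + \<epsilon>)) * norm (z - a)"
      by (simp add: mult_ac)
    \<comment> \<open>Needed when \<open>z = a\<close>, where the factor \<open>norm (z - a)\<close>
      cannot be cancelled.\<close>
    have "0 \<le> \<epsilon>" using order_trans[OF abs_ge_zero h[of "SOME b. b \<in> Basis"]] by simp
    then have "norm (z - a) \<le> r * (1 + \<epsilon>)"
      using mult_right_le_imp_le[OF le] r by (cases "z = a") simp_all
    then show "z \<in> parallel_body K (r * (1 + \<epsilon>))" using a by (intro parallel_bodyI)
  qed
  show "parallel_body K (r * (1 - \<epsilon>)) \<subseteq> zsum K (map ((*\<^sub>R) r) ws)"
  proof
    fix z assume "z \<in> parallel_body K (r * (1 - \<epsilon>))"
    then obtain a where a: "a \<in> K" "norm (z - a) \<le> r * (1 - \<epsilon>)"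
      using K by (rule parallel_bodyE)
    have "z - a \<in> zsum {0} (map ((*\<^sub>R) r) ws)"
    proof (rule mem_zsum_if_inner_le)
      fix x
      have "(z - a) \<bullet> x \<le> norm (z - a) * norm x" by (rule norm_cauchy_schwarz)
      also have "\<dots> \<le> r * (1 - \<epsilon>) * norm x" using a by (intro mult_right_mono) auto
      also have "\<dots> = r * ((1 - \<epsilon>) * norm x)" by simp
      also have "\<dots> \<le> r * (\<Sum>w\<leftarrow>ws. \<bar>w \<bullet> x\<bar>)"
        using h[of x] r by (intro mult_left_mono) (auto simp: algebra_simps)
      finally show "(z - a) \<bullet> x \<le> (\<Sum>w\<leftarrow>map ((*\<^sub>R) r) ws. \<bar>w \<bullet> x\<bar>)" by (simp only: scale)
    qed
    then show "z \<in> zsum K (map ((*\<^sub>R) r) ws)" using a by (subst zsum_iff) auto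
  qed
qed

context haar
begin

lemma apply_measurable [measurable]: "(\<lambda>Q. Q *v e) \<in> borel_measurable H"
  by (intro borel_measurable_H borel_measurable_continuous_onI continuous_intros)

lemma norm_rotation: "Q \<in> space H \<Longrightarrow> norm (Q *v e) = norm e"
  by (intro orthogonal_transformation_norm rotation_matrix_orthogonal_transformation) (simp add: space_H)

lemma integrable_abs_inner: "integrable H (\<lambda>Q. \<bar>(Q *v e) \<bullet> x\<bar>)"
proof (rule integrable_const_bound[of _ "norm e * norm x"])
  show "AE Q in H. norm \<bar>(Q *v e) \<bullet> x\<bar> \<le> norm e * norm x"
  proof (rule AE_I2)
    fix Q assume "Q \<in> space H"
    then show "norm \<bar>(Q *v e) \<bullet> x\<bar> \<le> norm e * norm x"
      using Cauchy_Schwarz_ineq2[of "Q *v e" x] by (simp add: norm_rotation)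
  qed
qed measurable

text \<open>The average is homogeneous in \<open>x\<close> and invariant under rotations of
  \<open>x\<close>, hence proportional to the norm. This is the sense in which the ball is a limit
  of zonotopes.\<close>

lemma mean_abs_inner:
  fixes e :: "real^'n"
  assumes e: "norm e = 1"
  obtains c where "c > 0" "\<And>x. (\<integral>Q. \<bar>(Q *v e) \<bullet> x\<bar> \<partial>H) = c * norm x"
proof -
  define F where "F x = (\<integral>Q. \<bar>(Q *v e) \<bullet> x\<bar> \<partial>H)" for x
  have F_scale: "F (r *\<^sub>R x) = \<bar>r\<bar> * F x" for r x
    by (simp add: F_def abs_mult)
  have F_eq: "F x = F y" if xy: "norm x = norm y" for x y
  proof (cases "2 \<le> CARD('n)")
    case True
    obtain f where f: "orthogonal_transformation f" "det (matrix f) = 1" "f x = y"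
      by (rule rotation_exists[OF True xy])
    define R where "R = matrix f"
    have R: "rotation_matrix R" "R *v x = y"
      using f fun_cong[OF matrix_vector_mul(2)[OF orthogonal_transformation_linear[OF f(1)]], of x]
      by (auto simp: R_def rotation_matrix_def orthogonal_transformation_matrix)
    then have R': "rotation_matrix (transpose R)"
      by (auto simp: rotation_matrix_def)
    \<comment> \<open>The inner product moves the rotation from \<open>x\<close> to the left of
      \<open>Q\<close>, where left invariance of \<open>H\<close> absorbs it.\<close>
    have "((transpose R ** Q) *v e) \<bullet> x = (Q *v e) \<bullet> y" for Q
    proof -
      have "((transpose R ** Q) *v e) \<bullet> x = ((Q *v e) v* R) \<bullet> x"
        by (simp only: matrix_vector_mul_assoc[symmetric] transpose_matrix_vector)
      also have "\<dots> = (Q *v e) \<bullet> (R *v x)" by (rule dot_lmul_matrix)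
      finally show ?thesis by (simp only: R(2))
    qed
    then have "F y = (\<integral>Q. \<bar>((transpose R ** Q) *v e) \<bullet> x\<bar> \<partial>H)"
      by (simp add: F_def)
    also have "\<dots> = F x"
      unfolding F_def by (rule integral_left_mult[OF R']) measurable
    finally show ?thesis ..
  next
    case False
    \<comment> \<open>On the line the only rotation is the identity; vectors of equal norm differ by
      a sign, which the absolute value ignores.\<close>
    then have "CARD('n) = 1" using zero_less_card_finite[where 'a='n] by linarith
    then obtain a :: 'n where "UNIV = {a}" by (auto simp: card_1_singleton_iff)
    then have all: "i = a" for i by blast
    have "norm z = \<bar>z $ a\<bar>" for z :: "real^'n"
      by (simp add: norm_vec_def L2_set_def \<open>UNIV = {a}\<close>)
    then have "x $ a = y $ a \<or> x $ a = - y $ a" using xy by auto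
    moreover have "z = z'" if "z $ a = z' $ a" for z z' :: "real^'n"
      unfolding vec_eq_iff
    proof
      show "z $ i = z' $ i" for i using that unfolding all[of i] .
    qed
    ultimately have "x = y \<or> x = - y" by (metis vector_uminus_component)
    then show ?thesis using F_scale[of "-1" y] by auto
  qed
  have F: "F x = F e * norm x" for x
  proof (cases "x = 0")
    case False
    have "F x = norm x * F (sgn x)"
      using F_scale[of "norm x" "sgn x"] False by (simp add: sgn_div_norm)
    also have "F (sgn x) = F e" using False e by (intro F_eq) (simp add: norm_sgn)
    finally show ?thesis by simp
  qed (simp add: F_def)
  \<comment> \<open>Positivity of the constant: the coordinates of a unit vector have absolute
    values summing to at least 1.\<close>
  have "1 \<le> (\<integral>Q. (\<Sum>i\<in>UNIV. \<bar>(Q *v e) \<bullet> axis i 1\<bar>) \<partial>H)"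
  proof -
    have "(\<integral>Q. 1 \<partial>H) \<le> (\<integral>Q. (\<Sum>i\<in>UNIV. \<bar>(Q *v e) \<bullet> axis i 1\<bar>) \<partial>H)"
    proof (rule integral_mono)
      show "1 \<le> (\<Sum>i\<in>UNIV. \<bar>(Q *v e) \<bullet> axis i 1\<bar>)" if "Q \<in> space H" for Q
        using norm_le_l1_cart[of "Q *v e"] norm_rotation[OF that, of e] e by (simp add: inner_axis)
    qed (auto intro: integrable_abs_inner)
    then show ?thesis by (simp add: prob_space)
  qed
  also have "\<dots> = (\<Sum>i\<in>(UNIV::'n set). F (axis i 1))"
    unfolding F_def by (intro Bochner_Integration.integral_sum integrable_abs_inner)
  also have "\<dots> = real CARD('n) * F e"
    using F_eq[of "axis _ 1" e] e by (simp add: norm_axis_1)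
  finally have "0 < real CARD('n) * F e" by linarith
  then have "F e > 0" by (simp add: zero_less_mult_iff)
  moreover have "(\<integral>Q. \<bar>(Q *v e) \<bullet> x\<bar> \<partial>H) = F e * norm x" for x
    using F[of x] by (simp only: F_def)
  ultimately show thesis by (rule that)
qed

text \<open>A simple function close to \<open>Q *v e\<close> in mean turns the average over
  rotations into a finite sum. The error is at most the mean distance times \<open>norm x\<close>,
  hence uniform in the direction of \<open>x\<close>.\<close>

lemma ball_zonotope_approximation:
  assumes "0 < \<epsilon>"
  obtains ws :: "(real^'n) list" where
    "\<And>x. \<bar>(\<Sum>w\<leftarrow>ws. \<bar>w \<bullet> x\<bar>) - norm x\<bar> \<le> \<epsilon> * norm x"
proof -
  fix k :: 'n
  let ?e = "axis k 1 :: real^'n"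
  obtain c where c: "c > 0" "\<And>x. (\<integral>Q. \<bar>(Q *v ?e) \<bullet> x\<bar> \<partial>H) = c * norm x"
    using mean_abs_inner[of ?e] by (auto simp: norm_axis_1)
  obtain G where "(\<forall>i. simple_function H (G i)) \<and> (\<forall>Q\<in>space H. (\<lambda>i. G i Q) \<longlonglongrightarrow> Q *v ?e) \<and>
      (\<forall>i. \<forall>Q\<in>space H. dist (G i Q) 0 \<le> 2 * dist (Q *v ?e) 0)"
    by (rule exE[OF borel_measurable_implies_sequence_metric[OF apply_measurable[of ?e], of 0]])
  then have G: "\<And>i. simple_function H (G i)"
      "\<And>Q. Q \<in> space H \<Longrightarrow> (\<lambda>i. G i Q) \<longlonglongrightarrow> Q *v ?e"
      "\<And>i Q. Q \<in> space H \<Longrightarrow> norm (G i Q) \<le> 2 * norm (Q *v ?e)"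
    by (simp_all only: dist_norm diff_zero)
  have G_meas [measurable]: "G i \<in> borel_measurable H" for i
    by (rule borel_measurable_simple_function[OF G(1)])
  have "(\<lambda>i. \<integral>Q. norm (G i Q - Q *v ?e) \<partial>H) \<longlonglongrightarrow> (\<integral>Q. 0 \<partial>H)"
  \<comment> \<open>The bound 3 is 2 for the simple function plus 1 for the rotated unit
    vector.\<close>
  proof (rule integral_dominated_convergence[where w = "\<lambda>_. 3"])
    show "AE Q in H. (\<lambda>i. norm (G i Q - Q *v ?e)) \<longlonglongrightarrow> 0"
      using G(2) by (auto intro!: AE_I2 simp: tendsto_norm_zero_iff LIM_zero_iff)
    show "AE Q in H. norm (norm (G i Q - Q *v ?e)) \<le> 3" for i
    proof (rule AE_I2)
      fix Q assume "Q \<in> space H"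
      then show "norm (norm (G i Q - Q *v ?e)) \<le> 3"
        using norm_triangle_ineq4[of "G i Q" "Q *v ?e"] G(3)[of Q i] norm_rotation[of Q ?e] by (simp add: norm_axis_1)
    qed
  qed auto
  then have "(\<lambda>i. \<integral>Q. norm (G i Q - Q *v ?e) \<partial>H) \<longlonglongrightarrow> 0" by simp
  then have "eventually (\<lambda>i. (\<integral>Q. norm (G i Q - Q *v ?e) \<partial>H) < \<epsilon> * c) sequentially"
    using c(1) assms by (intro order_tendstoD) auto
  then obtain i where i: "(\<integral>Q. norm (G i Q - Q *v ?e) \<partial>H) < \<epsilon> * c"
    by (auto simp: eventually_sequentially)
  define s where "s = G i"
  have s: "simple_function H s" "s \<in> borel_measurable H" and
    s_le: "\<And>Q. Q \<in> space H \<Longrightarrow> norm (s Q) \<le> 2"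
    using G(1) G(3)[of _ i] by (auto simp: s_def norm_rotation norm_axis_1)
  note s(2) [measurable]
  define p where "p v = prob (s -` {v} \<inter> space H)" for v
  have fin: "finite (s ` space H)" using s(1) by (simp add: simple_function_def)
  then obtain vs where vs: "set vs = s ` space H" "distinct vs"
    using finite_distinct_list by blast
  \<comment> \<open>Each value is weighted by its probability; dividing by \<open>c\<close> makes
    the limit \<open>norm x\<close> itself, which is why the approximation error was taken below
    \<open>\<epsilon> * c\<close>.\<close>
  define ws where "ws = map (\<lambda>v. (p v / c) *\<^sub>R v) vs"
  have h: "(\<Sum>w\<leftarrow>ws. \<bar>w \<bullet> x\<bar>) = (\<integral>Q. \<bar>s Q \<bullet> x\<bar> \<partial>H) / c" for x
  proof -
    have "(\<integral>Q. \<bar>s Q \<bullet> x\<bar> \<partial>H) = (\<integral>Q. (\<Sum>v\<in>s ` space H. \<bar>v \<bullet> x\<bar> * indicator (s -` {v} \<inter> space H) Q) \<partial>H)"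
    proof (intro Bochner_Integration.integral_cong refl)
      fix Q assume Q: "Q \<in> space H"
      have "(\<Sum>v\<in>s ` space H. \<bar>v \<bullet> x\<bar> * indicator (s -` {v} \<inter> space H) Q)
          = (\<Sum>v\<in>s ` space H. if v = s Q then \<bar>s Q \<bullet> x\<bar> else 0)"
        using Q by (intro sum.cong refl) (auto simp: indicator_def)
      also have "\<dots> = \<bar>s Q \<bullet> x\<bar>" using Q fin by simp
      finally show "\<bar>s Q \<bullet> x\<bar> = (\<Sum>v\<in>s ` space H. \<bar>v \<bullet> x\<bar> * indicator (s -` {v} \<inter> space H) Q)" ..
    qed
    also have "\<dots> = (\<Sum>v\<in>s ` space H. \<bar>v \<bullet> x\<bar> * p v)"
      by (subst Bochner_Integration.integral_sum) (auto simp: p_def emeasure_eq_measure)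
    also have "\<dots> / c = (\<Sum>v\<in>set vs. \<bar>((p v / c) *\<^sub>R v) \<bullet> x\<bar>)"
      unfolding vs(1) sum_divide_distrib
    proof (intro sum.cong refl)
      fix v
      show "\<bar>v \<bullet> x\<bar> * p v / c = \<bar>((p v / c) *\<^sub>R v) \<bullet> x\<bar>"
        using c(1) by (simp add: abs_mult p_def)
    qed
    also have "\<dots> = (\<Sum>w\<leftarrow>ws. \<bar>w \<bullet> x\<bar>)"
      using vs(2) by (simp add: ws_def o_def sum_list_distinct_conv_sum_set)
    finally show ?thesis ..
  qed
  show thesis
  proof (rule that)
    fix x
    have int_s: "integrable H (\<lambda>Q. \<bar>s Q \<bullet> x\<bar>)"
    proof (rule integrable_const_bound[of _ "2 * norm x"])
      show "AE Q in H. norm \<bar>s Q \<bullet> x\<bar> \<le> 2 * norm x"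
      proof (rule AE_I2)
        fix Q assume "Q \<in> space H"
        then show "norm \<bar>s Q \<bullet> x\<bar> \<le> 2 * norm x"
          using Cauchy_Schwarz_ineq2[of "s Q" x] mult_right_mono[OF s_le[of Q] norm_ge_zero[of x]] by simp
      qed
    qed measurable
    have int_d: "integrable H (\<lambda>Q. norm (s Q - Q *v ?e))"
    proof (rule integrable_const_bound[of _ 3])
      show "AE Q in H. norm (norm (s Q - Q *v ?e)) \<le> 3"
      proof (rule AE_I2)
        fix Q assume "Q \<in> space H"
        then show "norm (norm (s Q - Q *v ?e)) \<le> 3"
          using norm_triangle_ineq4[of "s Q" "Q *v ?e"] s_le[of Q] norm_rotation[of Q ?e] by (simp add: norm_axis_1)
      qed
    qed measurable
    have "\<bar>(\<integral>Q. \<bar>s Q \<bullet> x\<bar> \<partial>H) - c * norm x\<bar> = \<bar>\<integral>Q. \<bar>s Q \<bullet> x\<bar> - \<bar>(Q *v ?e) \<bullet> x\<bar> \<partial>H\<bar>"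
      using int_s integrable_abs_inner[of ?e x] by (simp add: c(2))
    also have "\<dots> \<le> (\<integral>Q. \<bar>\<bar>s Q \<bullet> x\<bar> - \<bar>(Q *v ?e) \<bullet> x\<bar>\<bar> \<partial>H)" by (rule integral_abs_bound)
    also have "\<dots> \<le> (\<integral>Q. norm (s Q - Q *v ?e) * norm x \<partial>H)"
    proof (rule integral_mono)
      fix Q
      have "\<bar>\<bar>s Q \<bullet> x\<bar> - \<bar>(Q *v ?e) \<bullet> x\<bar>\<bar> \<le> \<bar>(s Q - Q *v ?e) \<bullet> x\<bar>"
        unfolding inner_diff_left by (rule abs_triangle_ineq3)
      also have "\<dots> \<le> norm (s Q - Q *v ?e) * norm x" by (rule Cauchy_Schwarz_ineq2)
      finally show "\<bar>\<bar>s Q \<bullet> x\<bar> - \<bar>(Q *v ?e) \<bullet> x\<bar>\<bar> \<le> norm (s Q - Q *v ?e) * norm x" .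
    qed (use int_s int_d integrable_abs_inner[of ?e x] in auto)
    also have "\<dots> = (\<integral>Q. norm (s Q - Q *v ?e) \<partial>H) * norm x" using int_d by simp
    also have "\<dots> \<le> (\<epsilon> * c) * norm x" using i by (intro mult_right_mono) (auto simp: s_def)
    finally have "\<bar>(\<integral>Q. \<bar>s Q \<bullet> x\<bar> \<partial>H) - c * norm x\<bar> / c \<le> \<epsilon> * norm x"
      using c(1) by (simp add: field_simps)
    moreover have "\<bar>(\<integral>Q. \<bar>s Q \<bullet> x\<bar> \<partial>H) - c * norm x\<bar> / c = \<bar>((\<integral>Q. \<bar>s Q \<bullet> x\<bar> \<partial>H) - c * norm x) / c\<bar>"
      using c(1) by (simp add: abs_divide)
    moreover have "((\<integral>Q. \<bar>s Q \<bullet> x\<bar> \<partial>H) - c * norm x) / c = (\<Sum>w\<leftarrow>ws. \<bar>w \<bullet> x\<bar>) - norm x"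
      using c(1) by (simp add: h diff_divide_distrib)
    ultimately show "\<bar>(\<Sum>w\<leftarrow>ws. \<bar>w \<bullet> x\<bar>) - norm x\<bar> \<le> \<epsilon> * norm x" by simp
  qed
qed

end

section \<open>The Steiner formula\<close>

lemma measure_subspace_lborel_cball:
  fixes L :: "'a::euclidean_space set"
  assumes L: "subspace L"
  shows "measure (subspace_lborel L) (L \<inter> cball 0 1) = unit_ball_vol (real (dim L))"
proof -
  obtain B where B: "orthonormal B" and span_B: "span B = L"
    and sub: "subspace_lborel L = distr (\<Pi>\<^sub>M b\<in>B. lborel) borel (\<lambda>c. \<Sum>b\<in>B. c b *\<^sub>R b)"
    by (rule subspace_lborel_eq_distr[OF L])
  have fin: "finite B" using B by (rule orthonormal_finite)
  have card: "card B = dim L" using card_orthonormal[OF B] span_B by simp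
  let ?P = "\<Pi>\<^sub>M b\<in>B. (lborel :: real measure)"
  let ?f = "\<lambda>c::'a \<Rightarrow> real. \<Sum>b\<in>B. c b *\<^sub>R b"
  have f_in: "?f c \<in> L" for c
    unfolding span_B[symmetric] by (intro span_sum span_scale span_base)
  have [measurable]: "L \<inter> cball 0 1 \<in> sets borel"
    using L by (intro borel_closed closed_Int closed_subspace closed_cball)
  have "emeasure (subspace_lborel L) (L \<inter> cball 0 1) = emeasure (distr ?P borel ?f) (L \<inter> cball 0 1)"
    by (simp only: sub)
  also have "\<dots> = emeasure ?P (?f -` (L \<inter> cball 0 1) \<inter> space ?P)"
    by (rule emeasure_distr) measurable
  also have "?f -` (L \<inter> cball 0 1) \<inter> space ?P = {c. sqrt (\<Sum>b\<in>B. (c b)\<^sup>2) \<le> 1} \<inter> space ?P"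
    using f_in by (auto simp: orthonormal_norm_sum[OF B fin])
  also have "emeasure ?P \<dots> = ennreal (unit_ball_vol (real (dim L)))"
    using emeasure_cball_aux[OF fin, of 1] card by simp
  finally show ?thesis by (simp add: measure_def)
qed

text \<open>It passes from values to coefficients, so that testing on the unit ball determines the
  limits of the zonotope coefficients.\<close>

lemma polynomial_coeffs_tendsto_zero:
  fixes d :: "nat \<Rightarrow> nat \<Rightarrow> real"
  assumes "\<And>r. 0 < r \<Longrightarrow> (\<lambda>m. \<Sum>j\<le>n. d m j * r ^ j) \<longlonglongrightarrow> 0" and "j \<le> n"
  shows "(\<lambda>m. d m j) \<longlonglongrightarrow> 0"
  using assms
proof (induction n arbitrary: d j)
  case 0
  then show ?case using 0(1)[of 1] by simp
next
  case (Suc n)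
  \<comment> \<open>\<open>p (2 r) - 2 ^ Suc n * p r\<close> has no term of degree \<open>Suc n\<close>.\<close>
  have "(\<lambda>m. \<Sum>j\<le>n. (d m j * (2 ^ j - 2 ^ Suc n)) * r ^ j) \<longlonglongrightarrow> 0" if "0 < r" for r :: real
  proof -
    have "(\<lambda>m. (\<Sum>j\<le>Suc n. d m j * (2 * r) ^ j) - 2 ^ Suc n * (\<Sum>j\<le>Suc n. d m j * r ^ j)) \<longlonglongrightarrow> 0 - 2 ^ Suc n * 0"
      using that by (intro tendsto_diff tendsto_mult tendsto_const Suc.prems(1)) auto
    moreover have "(\<Sum>j\<le>Suc n. d m j * (2 * r) ^ j) - 2 ^ Suc n * (\<Sum>j\<le>Suc n. d m j * r ^ j)
        = (\<Sum>j\<le>n. (d m j * (2 ^ j - 2 ^ Suc n)) * r ^ j)" for m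
      by (simp add: sum_distrib_left sum_subtractf[symmetric] power_mult_distrib algebra_simps)
    ultimately show ?thesis by simp
  qed
  note IH = Suc.IH[OF this]
  have low: "(\<lambda>m. d m j) \<longlonglongrightarrow> 0" if "j \<le> n" for j
  proof -
    have "(2::real) ^ j < 2 ^ Suc n" using that by (intro power_strict_increasing) auto
    then have "(\<lambda>m. d m j * (2 ^ j - 2 ^ Suc n) / (2 ^ j - 2 ^ Suc n)) \<longlonglongrightarrow> 0 / (2 ^ j - 2 ^ Suc n)"
      by (intro tendsto_divide IH that tendsto_const) auto
    then show ?thesis using \<open>(2::real) ^ j < 2 ^ Suc n\<close> by simp
  qed
  show ?case
  proof (cases "j = Suc n")
    case True
    have "(\<lambda>m. (\<Sum>j\<le>Suc n. d m j * 1 ^ j) - (\<Sum>j\<le>n. d m j)) \<longlonglongrightarrow> 0 - (\<Sum>j\<le>n. 0)"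
      by (intro tendsto_diff Suc.prems(1) tendsto_sum low) auto
    then show ?thesis by (simp add: True)
  qed (use Suc.prems(2) low in auto)
qed

context haar
begin

section \<open>From zonotopes to the Steiner polynomial\<close>

lemma rotation_inverse:
  fixes Q :: "real^'n^'n"
  assumes "rotation_matrix Q"
  shows "rotation_matrix (transpose Q)" "transpose Q *v (Q *v x) = x" "Q *v (transpose Q *v x) = x"
  using assms by (auto simp: rotation_matrix_def orthogonal_matrix_def matrix_vector_mul_assoc simp del: transpose_matrix_vector)

lemma measure_parallel_body_rotation:
  fixes Q :: "real^'n^'n"
  assumes Q: "rotation_matrix Q" and K: "compact K" "K \<noteq> {}"
  shows "measure lborel (parallel_body ((*v) Q ` K) r) = measure lborel (parallel_body K r)"
proof -
  have ot: "orthogonal_transformation ((*v) Q)" using Q by (rule rotation_matrix_orthogonal_transformation)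
  have norm: "norm (Q *v x) = norm x" for x by (rule orthogonal_transformation_norm[OF ot])
  have QK: "compact ((*v) Q ` K)" "(*v) Q ` K \<noteq> {}"
    using K by (auto intro!: compact_continuous_image continuous_intros)
  have "parallel_body ((*v) Q ` K) r = (*v) Q ` parallel_body K r"
  proof (intro set_eqI iffI)
    fix z assume "z \<in> parallel_body ((*v) Q ` K) r"
    then obtain a where a: "a \<in> K" "norm (z - Q *v a) \<le> r"
      by (rule parallel_bodyE[OF _ QK]) auto
    have "norm (transpose Q *v z - a) = norm (Q *v (transpose Q *v z - a))" by (simp only: norm)
    also have "\<dots> = norm (z - Q *v a)" by (simp only: matrix_vector_mult_diff_distrib rotation_inverse[OF Q])
    finally have "transpose Q *v z \<in> parallel_body K r" using a by (intro parallel_bodyI[of a]) auto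
    then show "z \<in> (*v) Q ` parallel_body K r" by (rule image_eqI[rotated]) (simp only: rotation_inverse[OF Q])
  next
    fix z assume "z \<in> (*v) Q ` parallel_body K r"
    then obtain y where y: "z = Q *v y" "y \<in> parallel_body K r" by blast
    obtain a where a: "a \<in> K" "norm (y - a) \<le> r" by (rule parallel_bodyE[OF y(2) K])
    have "norm (z - Q *v a) = norm (y - a)" unfolding y(1) by (simp only: matrix_vector_mult_diff_distrib[symmetric] norm)
    then show "z \<in> parallel_body ((*v) Q ` K) r" using a by (intro parallel_bodyI[of "Q *v a"]) auto
  qed
  then show ?thesis
    using emeasure_lborel_orthogonal_image[OF ot compact_parallel_body[OF K, of r]] by (simp add: measure_def)
qed

lemma measure_compact_mono:
  fixes S T :: "'a::euclidean_space set"
  assumes "S \<subseteq> T" "compact S" "compact T"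
  shows "measure lborel S \<le> measure lborel T"
  using assms emeasure_compact_finite[OF assms(3)]
  by (intro measure_mono_fmeasurable) (auto simp: fmeasurable_def intro: borel_compact)

text \<open>For every rotation the zonotope sum lies between two parallel bodies of the rotated
  body, whose volumes do not depend on the rotation; averaging gives the polynomial in the middle.
  The coefficients are fixed before \<open>r\<close> and \<open>K\<close>, which makes it legitimate
  to determine them on one particular body.\<close>

lemma approximate_steiner:
  assumes P: "projector_family P" and \<epsilon>: "0 < \<epsilon>"
  shows "\<exists>b. \<forall>r K. 0 \<le> r \<longrightarrow> compact K \<longrightarrow> convex K \<longrightarrow> K \<noteq> {} \<longrightarrow>
      measure lborel (parallel_body K (r * (1 - \<epsilon>))) \<le> (\<Sum>j\<le>CARD('n). b j * r ^ j * mean_proj P (CARD('n) - j) K) \<and>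
      (\<Sum>j\<le>CARD('n). b j * r ^ j * mean_proj P (CARD('n) - j) K) \<le> measure lborel (parallel_body K (r * (1 + \<epsilon>)))"
proof -
  obtain ws :: "(real^'n) list" where ws: "\<And>x. \<bar>(\<Sum>w\<leftarrow>ws. \<bar>w \<bullet> x\<bar>) - norm x\<bar> \<le> \<epsilon> * norm x"
    using ball_zonotope_approximation[OF \<epsilon>] by blast
  have on: "orthonormal ({} :: (real^'n) set)" by (simp add: orthonormal_def)
  obtain b where b: "\<And>r K. 0 \<le> r \<Longrightarrow> compact K \<Longrightarrow> convex K \<Longrightarrow> K \<noteq> {} \<Longrightarrow>
      integrable H (\<lambda>Q. cyl_vol {} (zsum ((*v) Q ` K) (map ((*\<^sub>R) r) ws))) \<and>
      r ^ card ({} :: (real^'n) set) * (\<integral>Q. cyl_vol {} (zsum ((*v) Q ` K) (map ((*\<^sub>R) r) ws)) \<partial>H)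
        = (\<Sum>j\<le>CARD('n). b j * r ^ j * mean_proj P (CARD('n) - j) K)"
    using zonotope_polynomial[OF P on, of ws] by blast
  show ?thesis
  proof (intro exI[of _ b] allI impI)
    fix r :: real and K :: "(real^'n) set"
    assume r: "0 \<le> r" and K: "compact K" "convex K" "K \<noteq> {}"
    let ?Z = "\<lambda>Q. zsum ((*v) Q ` K) (map ((*\<^sub>R) r) ws)"
    have int: "integrable H (\<lambda>Q. measure lborel (?Z Q))"
      and eq: "(\<integral>Q. measure lborel (?Z Q) \<partial>H) = (\<Sum>j\<le>CARD('n). b j * r ^ j * mean_proj P (CARD('n) - j) K)"
      using b[OF r K] by (simp_all add: cyl_vol_def)
    have QK: "compact ((*v) Q ` K)" "(*v) Q ` K \<noteq> {}" for Q :: "real^'n^'n"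
      using K by (auto intro!: compact_continuous_image continuous_intros)
    have bounds: "measure lborel (parallel_body K (r * (1 - \<epsilon>))) \<le> measure lborel (?Z Q)"
        "measure lborel (?Z Q) \<le> measure lborel (parallel_body K (r * (1 + \<epsilon>)))"
      if "Q \<in> space H" for Q
    proof -
      have Q: "rotation_matrix Q" using that by (simp add: space_H)
      note sub = zsum_parallel_body[OF ws r QK[of Q]]
      show "measure lborel (parallel_body K (r * (1 - \<epsilon>))) \<le> measure lborel (?Z Q)"
        unfolding measure_parallel_body_rotation[OF Q K(1,3), symmetric]
        by (intro measure_compact_mono sub compact_parallel_body compact_zsum QK)
      show "measure lborel (?Z Q) \<le> measure lborel (parallel_body K (r * (1 + \<epsilon>)))"
        unfolding measure_parallel_body_rotation[OF Q K(1,3), symmetric]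
        by (intro measure_compact_mono sub compact_parallel_body compact_zsum QK)
    qed
    have "(\<integral>Q. measure lborel (parallel_body K (r * (1 - \<epsilon>))) \<partial>H) \<le> (\<integral>Q. measure lborel (?Z Q) \<partial>H)"
      using int bounds by (intro integral_mono) auto
    moreover have "(\<integral>Q. measure lborel (?Z Q) \<partial>H) \<le> (\<integral>Q. measure lborel (parallel_body K (r * (1 + \<epsilon>))) \<partial>H)"
      using int bounds by (intro integral_mono) auto
    ultimately show "measure lborel (parallel_body K (r * (1 - \<epsilon>))) \<le> (\<Sum>j\<le>CARD('n). b j * r ^ j * mean_proj P (CARD('n) - j) K) \<and>
      (\<Sum>j\<le>CARD('n). b j * r ^ j * mean_proj P (CARD('n) - j) K) \<le> measure lborel (parallel_body K (r * (1 + \<epsilon>)))"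
      by (simp add: eq prob_space)
  qed
qed

text \<open>Every rotated projection of the unit ball is the unit ball of the subspace, so the
  average is over a constant.\<close>

lemma mean_proj_cball:
  assumes P: "projector_family P" and j: "j \<le> CARD('n)"
  shows "mean_proj P j (cball 0 1) = unit_ball_vol (real j)"
proof -
  define L where "L = range ((*v) (P j))"
  note sub = projector_family_range(1)[OF P j, folded L_def]
    and L = projector_family_range(2)[OF P j, folded L_def]
    and perp = projector_family_range(3)[OF P j, folded L_def]
    and fix_L = projector_family_range(4)[OF P j, folded L_def]
  have Px: "P j *v x \<in> L" for x by (simp add: L_def)
  have norm_le: "norm (P j *v x) \<le> norm x" for x
  proof -
    have "norm ((x - P j *v x) + P j *v x) ^ 2 = norm (x - P j *v x) ^ 2 + norm (P j *v x) ^ 2"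
      by (intro norm_add_Pythagorean perp Px)
    then have "norm (P j *v x) ^ 2 \<le> norm x ^ 2" by simp
    then show ?thesis by (rule power2_le_imp_le) simp
  qed
  have image: "(\<lambda>x. P j *v (Q *v x)) ` cball 0 1 = L \<inter> cball 0 1" if "Q \<in> space H" for Q
  proof -
    have Q: "rotation_matrix Q" using that by (simp add: space_H)
    show ?thesis
    proof (intro set_eqI iffI)
      fix y assume "y \<in> (\<lambda>x. P j *v (Q *v x)) ` cball 0 1"
      then obtain x where x: "y = P j *v (Q *v x)" "norm x \<le> 1" by auto
      have "norm y \<le> norm (Q *v x)" unfolding x(1) by (rule norm_le)
      also have "\<dots> \<le> 1" using norm_rotation[OF that] x(2) by simp
      finally show "y \<in> L \<inter> cball 0 1" using Px x(1) by simp
    next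
      fix y assume y: "y \<in> L \<inter> cball 0 1"
      have Q': "transpose Q \<in> space H" using rotation_inverse(1)[OF Q] by (simp add: space_H)
      have "y = P j *v (Q *v (transpose Q *v y))"
        using y by (simp only: rotation_inverse(3)[OF Q] fix_L IntD1)
      moreover have "transpose Q *v y \<in> cball 0 1"
        using norm_rotation[OF Q', of y] y by (simp del: transpose_matrix_vector)
      ultimately show "y \<in> (\<lambda>x. P j *v (Q *v x)) ` cball 0 1" by (rule image_eqI)
    qed
  qed
  have "mean_proj P j (cball 0 1) = (\<integral>Q. unit_ball_vol (real j) \<partial>H)"
    unfolding mean_proj_def L_def[symmetric]
    by (intro Bochner_Integration.integral_cong refl) (simp add: image measure_subspace_lborel_cball[OF sub] L)
  then show ?thesis by (simp add: prob_space)
qed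

text \<open>The value forced by the unit ball: comparing
  \<open>unit_ball_vol n * (1 + r) ^ n\<close> with the polynomial whose mean projections are
  \<open>unit_ball_vol (n - j)\<close> gives this coefficient at \<open>r ^ j\<close>.\<close>

definition steiner_coeff :: "nat \<Rightarrow> real" where
  "steiner_coeff j = real (CARD('n) choose j) * unit_ball_vol (real CARD('n)) / unit_ball_vol (real (CARD('n) - j))"

lemma parallel_body_cball: "0 \<le> r \<Longrightarrow> parallel_body (cball 0 1) r = cball (0 :: real^'n) (1 + r)"
proof (intro set_eqI iffI)
  fix x :: "real^'n" assume r: "0 \<le> r" and "x \<in> parallel_body (cball 0 1) r"
  then obtain a where "norm a \<le> 1" "norm (x - a) \<le> r"
    by (elim parallel_bodyE) auto
  then show "x \<in> cball 0 (1 + r)" using norm_triangle_ineq2[of x a] by simp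
next
  fix x :: "real^'n" assume r: "0 \<le> r" and x: "x \<in> cball 0 (1 + r)"
  show "x \<in> parallel_body (cball 0 1) r"
  proof (cases "norm x \<le> 1")
    case True
    then show ?thesis using r by (intro parallel_bodyI[of x]) auto
  next
    case False
    have "norm x *\<^sub>R sgn x = x" by (cases "x = 0") (simp_all add: sgn_div_norm)
    then have "x - sgn x = (norm x - 1) *\<^sub>R sgn x" by (simp add: scaleR_diff_left)
    then have "norm (x - sgn x) = norm x - 1" using False by (auto simp: norm_sgn)
    then show ?thesis using x by (intro parallel_bodyI[of "sgn x"]) (auto simp: norm_sgn)
  qed
qed

text \<open>As the zonotopes approach the ball, the coefficients converge, since on the unit ball
  the sandwich determines all values of the polynomial in the limit. For a general \<open>K\<close>
  the sandwich then passes to the limit.\<close>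

lemma steiner_kubota:
  assumes P: "projector_family P" and K: "compact K" "convex K" "K \<noteq> {}" and r: "0 < r"
  shows "measure lborel (parallel_body K r) = (\<Sum>j\<le>CARD('n). steiner_coeff j * mean_proj P (CARD('n) - j) K * r ^ j)"
proof -
  let ?n = "CARD('n)"
  \<comment> \<open>\<open>Suc (Suc m)\<close> keeps \<open>\<epsilon> m\<close> below 1, so that
    the radius can be divided by \<open>1 - \<epsilon> m\<close>.\<close>
  define \<epsilon> where "\<epsilon> m = inverse (real (Suc (Suc m)))" for m
  have \<epsilon>: "0 < \<epsilon> m" "\<epsilon> m < 1" for m by (auto simp: \<epsilon>_def inverse_less_1_iff)
  have \<epsilon>_lim: "\<epsilon> \<longlonglongrightarrow> 0"
    unfolding \<epsilon>_def using LIMSEQ_inverse_real_of_nat by (rule filterlim_compose) (rule filterlim_Suc)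
  define p where "p b r K = (\<Sum>j\<le>?n. b j * r ^ j * mean_proj P (?n - j) K)" for b :: "nat \<Rightarrow> real" and r K
  have "\<exists>b. \<forall>r K. 0 \<le> r \<longrightarrow> compact K \<longrightarrow> convex K \<longrightarrow> K \<noteq> {} \<longrightarrow>
      measure lborel (parallel_body K (r * (1 - \<epsilon> m))) \<le> p b r K \<and>
      p b r K \<le> measure lborel (parallel_body K (r * (1 + \<epsilon> m)))" for m
    unfolding p_def by (rule approximate_steiner[OF P \<epsilon>(1)])
  then have "\<exists>b. \<forall>m. \<forall>r K. 0 \<le> r \<longrightarrow> compact K \<longrightarrow> convex K \<longrightarrow> K \<noteq> {} \<longrightarrow>
      measure lborel (parallel_body K (r * (1 - \<epsilon> m))) \<le> p (b m) r K \<and>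
      p (b m) r K \<le> measure lborel (parallel_body K (r * (1 + \<epsilon> m)))"
    by (intro choice allI)
  then obtain b where b: "\<And>m r K. 0 \<le> r \<Longrightarrow> compact K \<Longrightarrow> convex K \<Longrightarrow> K \<noteq> {} \<Longrightarrow>
      measure lborel (parallel_body K (r * (1 - \<epsilon> m))) \<le> p (b m) r K \<and>
      p (b m) r K \<le> measure lborel (parallel_body K (r * (1 + \<epsilon> m)))"
    by blast
  let ?\<kappa> = "\<lambda>j. unit_ball_vol (real j)"
  have vol: "measure lborel (parallel_body (cball (0 :: real^'n) 1) r) = ?\<kappa> ?n * (1 + r) ^ ?n" if "0 \<le> r" for r
    using that emeasure_cball[of "1 + r" "0 :: real^'n"] by (simp add: parallel_body_cball measure_def)
  have lim: "(\<lambda>m. p (b m) r (cball 0 1)) \<longlonglongrightarrow> ?\<kappa> ?n * (1 + r) ^ ?n" if "0 < r" for r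
  proof (rule tendsto_sandwich)
    show "eventually (\<lambda>m. ?\<kappa> ?n * (1 + r * (1 - \<epsilon> m)) ^ ?n \<le> p (b m) r (cball 0 1)) sequentially"
      using b[of r "cball 0 1"] that \<epsilon> vol by (intro always_eventually allI) (simp add: less_imp_le)
    show "eventually (\<lambda>m. p (b m) r (cball 0 1) \<le> ?\<kappa> ?n * (1 + r * (1 + \<epsilon> m)) ^ ?n) sequentially"
      using b[of r "cball 0 1"] that \<epsilon> vol by (intro always_eventually allI) (simp add: less_imp_le add_nonneg_nonneg)
    have "(\<lambda>m. ?\<kappa> ?n * (1 + r * (1 - \<epsilon> m)) ^ ?n) \<longlonglongrightarrow> ?\<kappa> ?n * (1 + r * (1 - 0)) ^ ?n"
      by (intro tendsto_intros \<epsilon>_lim)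
    then show "(\<lambda>m. ?\<kappa> ?n * (1 + r * (1 - \<epsilon> m)) ^ ?n) \<longlonglongrightarrow> ?\<kappa> ?n * (1 + r) ^ ?n" by simp
    have "(\<lambda>m. ?\<kappa> ?n * (1 + r * (1 + \<epsilon> m)) ^ ?n) \<longlonglongrightarrow> ?\<kappa> ?n * (1 + r * (1 + 0)) ^ ?n"
      by (intro tendsto_intros \<epsilon>_lim)
    then show "(\<lambda>m. ?\<kappa> ?n * (1 + r * (1 + \<epsilon> m)) ^ ?n) \<longlonglongrightarrow> ?\<kappa> ?n * (1 + r) ^ ?n" by simp
  qed
  have \<kappa>_ne: "?\<kappa> j \<noteq> 0" for j
    using unit_ball_vol_pos[of "real j"] by linarith
  have coeff: "(\<lambda>m. b m j) \<longlonglongrightarrow> steiner_coeff j" if "j \<le> ?n" for j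
  proof -
    have "(\<lambda>m. b m j * ?\<kappa> (?n - j) - real (?n choose j) * ?\<kappa> ?n) \<longlonglongrightarrow> 0"
    proof (rule polynomial_coeffs_tendsto_zero[OF _ that])
      fix r :: real assume "0 < r"
      have "(\<Sum>j\<le>?n. (b m j * ?\<kappa> (?n - j) - real (?n choose j) * ?\<kappa> ?n) * r ^ j)
          = p (b m) r (cball 0 1) - ?\<kappa> ?n * (1 + r) ^ ?n" for m
      proof -
        have "?\<kappa> ?n * (1 + r) ^ ?n = (\<Sum>j\<le>?n. real (?n choose j) * ?\<kappa> ?n * r ^ j)"
          by (subst add.commute, subst binomial_ring) (simp add: sum_distrib_left algebra_simps)
        moreover have "p (b m) r (cball 0 1) = (\<Sum>j\<le>?n. b m j * ?\<kappa> (?n - j) * r ^ j)"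
          unfolding p_def by (intro sum.cong refl) (simp add: mean_proj_cball[OF P])
        ultimately show ?thesis by (simp add: sum_subtractf left_diff_distrib)
      qed
      then show "(\<lambda>m. \<Sum>j\<le>?n. (b m j * ?\<kappa> (?n - j) - real (?n choose j) * ?\<kappa> ?n) * r ^ j) \<longlonglongrightarrow> 0"
        using lim[OF \<open>0 < r\<close>] by (simp add: LIM_zero)
    qed
    then have "(\<lambda>m. b m j * ?\<kappa> (?n - j)) \<longlonglongrightarrow> real (?n choose j) * ?\<kappa> ?n"
      by (rule LIM_zero_cancel)
    then have "(\<lambda>m. b m j * ?\<kappa> (?n - j) / ?\<kappa> (?n - j)) \<longlonglongrightarrow> real (?n choose j) * ?\<kappa> ?n / ?\<kappa> (?n - j)"
      by (intro tendsto_divide tendsto_const \<kappa>_ne)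
    then show ?thesis by (simp add: steiner_coeff_def \<kappa>_ne)
  qed
  have lim_p: "(\<lambda>m. p (b m) (x m) K) \<longlonglongrightarrow> (\<Sum>j\<le>?n. steiner_coeff j * mean_proj P (?n - j) K * r ^ j)"
    if "x \<longlonglongrightarrow> r" for x
  proof -
    have "(\<lambda>m. p (b m) (x m) K) \<longlonglongrightarrow> (\<Sum>j\<le>?n. steiner_coeff j * r ^ j * mean_proj P (?n - j) K)"
      unfolding p_def by (intro tendsto_sum tendsto_mult tendsto_const tendsto_power that coeff) simp
    then show ?thesis by (simp add: mult_ac)
  qed
  show ?thesis
  proof (rule antisym)
    \<comment> \<open>At the radius \<open>r / (1 - \<epsilon> m)\<close> the inner body is exactly
      \<open>parallel_body K r\<close>; further down, \<open>r / (1 + \<epsilon> m)\<close> does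
      this for the outer body.\<close>
    have "(\<lambda>m. r / (1 - \<epsilon> m)) \<longlonglongrightarrow> r / (1 - 0)" by (intro tendsto_intros \<epsilon>_lim) simp
    moreover have "measure lborel (parallel_body K r) \<le> p (b m) (r / (1 - \<epsilon> m)) K" for m
      using b[of "r / (1 - \<epsilon> m)" K m] K r \<epsilon>[of m] by simp
    ultimately show "measure lborel (parallel_body K r) \<le> (\<Sum>j\<le>?n. steiner_coeff j * mean_proj P (?n - j) K * r ^ j)"
      by (intro tendsto_lowerbound[OF lim_p[of "\<lambda>m. r / (1 - \<epsilon> m)"]]) auto
    have "(\<lambda>m. r / (1 + \<epsilon> m)) \<longlonglongrightarrow> r / (1 + 0)" by (intro tendsto_intros \<epsilon>_lim) simp
    moreover have "p (b m) (r / (1 + \<epsilon> m)) K \<le> measure lborel (parallel_body K r)" for m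
    proof -
      have "1 + \<epsilon> m > 0" using \<epsilon>[of m] by simp
      then show ?thesis using b[of "r / (1 + \<epsilon> m)" K m] K r by simp
    qed
    ultimately show "(\<Sum>j\<le>?n. steiner_coeff j * mean_proj P (?n - j) K * r ^ j) \<le> measure lborel (parallel_body K r)"
      by (intro tendsto_upperbound[OF lim_p[of "\<lambda>m. r / (1 + \<epsilon> m)"]]) auto
  qed
qed

end

section \<open>The midpoint Prekopa-Leindler inequality\<close>

lemma emeasure_lborel_midpoint_translate:
  fixes A :: "real set"
  assumes [measurable]: "A \<in> sets borel"
  shows "{z. 2 * z - c \<in> A} \<in> sets borel" "2 * emeasure lborel {z. 2 * z - c \<in> A} = emeasure lborel A"
proof -
  show [measurable]: "{z. 2 * z - c \<in> A} \<in> sets borel" by measurable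
  have "emeasure lborel A = emeasure (density (distr lborel borel (\<lambda>x. - c + 2 * x)) (\<lambda>_. ennreal \<bar>2\<bar>)) A"
    by (rule arg_cong[OF lborel_real_affine[of 2 "-c"], of "\<lambda>M. emeasure M A"]) simp
  also have "\<dots> = 2 * emeasure (distr lborel borel (\<lambda>x. - c + 2 * x)) A"
    by (subst emeasure_density) (auto simp: nn_integral_cmult)
  also have "emeasure (distr lborel borel (\<lambda>x. - c + 2 * x)) A = emeasure lborel {z. 2 * z - c \<in> A}"
    by (subst emeasure_distr) (auto simp: vimage_def)
  finally show "2 * emeasure lborel {z. 2 * z - c \<in> A} = emeasure lborel A" ..
qed

text \<open>With \<open>a = Max A\<close> and \<open>b = Min B\<close>, the sets of midpoints of
  \<open>A\<close> with \<open>b\<close> and of \<open>a\<close> with \<open>B\<close> lie in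
  \<open>C\<close> and meet at most in \<open>(a + b) / 2\<close>. Each has half the measure of its
  source. A superset \<open>C\<close> replaces the midpoint set so that measurability can be
  assumed.\<close>

lemma brunn_minkowski_real_compact:
  fixes A B C :: "real set"
  assumes A: "compact A" "A \<noteq> {}" and B: "compact B" "B \<noteq> {}"
    and C: "C \<in> sets borel" "\<And>x y. x \<in> A \<Longrightarrow> y \<in> B \<Longrightarrow> (x + y) / 2 \<in> C"
  shows "emeasure lborel A + emeasure lborel B \<le> 2 * emeasure lborel C"
proof -
  obtain a where a: "a \<in> A" "\<And>x. x \<in> A \<Longrightarrow> x \<le> a"
    using compact_attains_sup[OF A] by blast
  obtain b where b: "b \<in> B" "\<And>y. y \<in> B \<Longrightarrow> b \<le> y"
    using compact_attains_inf[OF B] by blast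
  have AB: "A \<in> sets borel" "B \<in> sets borel" using A B by (auto intro: borel_compact)
  let ?S = "{z. 2 * z - b \<in> A}" and ?T = "{z. 2 * z - a \<in> B}" and ?p = "{(a + b) / 2}"
  note S = emeasure_lborel_midpoint_translate[OF AB(1), of b]
  note T = emeasure_lborel_midpoint_translate[OF AB(2), of a]
  have "z \<in> C" if "z \<in> ?S" for z using C(2)[of "2 * z - b" b] that b(1) by simp
  moreover have "z \<in> C" if "z \<in> ?T" for z using C(2)[of a "2 * z - a"] that a(1) by simp
  ultimately have sub: "(?S - ?p) \<union> ?T \<subseteq> C" by blast
  have "z = (a + b) / 2" if "z \<in> ?S" "z \<in> ?T" for z
    using a(2)[of "2 * z - b"] b(2)[of "2 * z - a"] that by simp
  then have disj: "(?S - ?p) \<inter> ?T = {}" by blast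
  have null: "?p \<in> null_sets lborel" by (auto simp: null_sets_def)
  have "emeasure lborel ?S + emeasure lborel ?T = emeasure lborel (?S - ?p) + emeasure lborel ?T"
    using emeasure_Diff_null_set[OF null] S(1) by simp
  also have "\<dots> = emeasure lborel ((?S - ?p) \<union> ?T)"
    using S(1) T(1) disj by (intro plus_emeasure) auto
  also have "\<dots> \<le> emeasure lborel C" using sub C(1) by (intro emeasure_mono) auto
  finally have "2 * (emeasure lborel ?S + emeasure lborel ?T) \<le> 2 * emeasure lborel C"
    by (rule mult_left_mono) simp
  then show ?thesis by (simp only: distrib_left S(2) T(2))
qed

lemma brunn_minkowski_real_bounded:
  fixes A B C :: "real set"
  assumes A: "A \<in> sets borel" "bounded A" "A \<noteq> {}" and B: "B \<in> sets borel" "bounded B" "B \<noteq> {}"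
    and C: "C \<in> sets borel" "\<And>x y. x \<in> A \<Longrightarrow> y \<in> B \<Longrightarrow> (x + y) / 2 \<in> C"
  shows "emeasure lborel A + emeasure lborel B \<le> 2 * emeasure lborel C"
proof (rule ennreal_le_epsilon)
  fix e :: real assume e: "0 < e"
  have approx: "\<exists>K. compact K \<and> K \<noteq> {} \<and> K \<subseteq> X \<and> emeasure lborel X \<le> emeasure lborel K + ennreal (e / 2)"
    if X: "X \<in> sets borel" "bounded X" "X \<noteq> {}" for X :: "real set"
  proof -
    obtain x where x: "x \<in> X" using X by auto
    have "X \<in> sets lebesgue" using X(1) by (simp add: sets_completionI_sets)
    moreover have "0 < e / 2" using e by simp
    ultimately obtain T where T: "closed T" "T \<subseteq> X" "emeasure lebesgue (X - T) < ennreal (e / 2)"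
      by (rule sets_lebesgue_inner_closed)
    have "compact T" using T X(2) bounded_subset[of X T] by (simp add: compact_eq_bounded_closed)
    \<comment> \<open>The approximating set \<open>T\<close> may be empty; the extra point keeps the
      compact case applicable.\<close>
    then have K: "compact (insert x T)" by (rule compact_insert)
    have TB: "T \<in> sets borel" "insert x T \<in> sets borel" using T(1) K by (auto intro: borel_compact)
    have "emeasure lborel X = emeasure lborel (T \<union> (X - T))" using T(2) by (simp add: Un_absorb1)
    also have "\<dots> \<le> emeasure lborel T + emeasure lborel (X - T)"
      using TB X(1) by (intro emeasure_subadditive) auto
    also have "\<dots> \<le> emeasure lborel (insert x T) + ennreal (e / 2)"
    proof (rule add_mono)
      show "emeasure lborel T \<le> emeasure lborel (insert x T)" using TB by (intro emeasure_mono) auto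
      have "X - T \<in> sets borel" using TB X(1) by blast
      then show "emeasure lborel (X - T) \<le> ennreal (e / 2)"
        using T(3) by (simp add: less_imp_le)
    qed
    finally show ?thesis using K x T(2) by (intro exI[of _ "insert x T"]) auto
  qed
  obtain K where K: "compact K" "K \<noteq> {}" "K \<subseteq> A" "emeasure lborel A \<le> emeasure lborel K + ennreal (e / 2)"
    using approx[OF A] by blast
  obtain L where L: "compact L" "L \<noteq> {}" "L \<subseteq> B" "emeasure lborel B \<le> emeasure lborel L + ennreal (e / 2)"
    using approx[OF B] by blast
  have "emeasure lborel A + emeasure lborel B
      \<le> (emeasure lborel K + ennreal (e / 2)) + (emeasure lborel L + ennreal (e / 2))"
    using K(4) L(4) by (rule add_mono)
  also have "\<dots> = (emeasure lborel K + emeasure lborel L) + (ennreal (e / 2) + ennreal (e / 2))"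
    by (simp only: add_ac)
  also have "ennreal (e / 2) + ennreal (e / 2) = ennreal e" using e by (subst ennreal_plus[symmetric]) auto
  also have "(emeasure lborel K + emeasure lborel L) + ennreal e \<le> 2 * emeasure lborel C + ennreal e"
    using K L C by (intro add_right_mono brunn_minkowski_real_compact) auto
  finally show "emeasure lborel A + emeasure lborel B \<le> 2 * emeasure lborel C + ennreal e" .
qed

lemma brunn_minkowski_real:
  fixes A B C :: "real set"
  assumes A: "A \<in> sets borel" "A \<noteq> {}" and B: "B \<in> sets borel" "B \<noteq> {}"
    and C: "C \<in> sets borel" "\<And>x y. x \<in> A \<Longrightarrow> y \<in> B \<Longrightarrow> (x + y) / 2 \<in> C"
  shows "emeasure lborel A + emeasure lborel B \<le> 2 * emeasure lborel C"
proof -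
  obtain a b where ab: "a \<in> A" "b \<in> B" using A B by auto
  \<comment> \<open>The intervals contain \<open>a\<close> and \<open>b\<close>, so that both
    truncated sets stay nonempty.\<close>
  define I where "I k = {- (\<bar>a\<bar> + \<bar>b\<bar> + real k)..\<bar>a\<bar> + \<bar>b\<bar> + real k}" for k
  have lim: "(\<lambda>k. emeasure lborel (X \<inter> I k)) \<longlonglongrightarrow> emeasure lborel X" if X: "X \<in> sets borel" for X
  proof -
    have "(\<Union>k. X \<inter> I k) = X"
    proof -
      have "\<exists>k. x \<in> I k" for x
      proof -
        obtain k where "\<bar>x\<bar> \<le> real k" using real_arch_simple by blast
        then show ?thesis by (intro exI[of _ k]) (auto simp: I_def)
      qed
      then show ?thesis by blast
    qed
    moreover have "incseq (\<lambda>k. X \<inter> I k)" by (auto simp: incseq_def I_def)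
    moreover have "range (\<lambda>k. X \<inter> I k) \<subseteq> sets lborel" using X by (auto simp: I_def)
    ultimately show ?thesis
      using Lim_emeasure_incseq[of "\<lambda>k. X \<inter> I k" lborel] by (simp only:)
  qed
  have "emeasure lborel (A \<inter> I k) + emeasure lborel (B \<inter> I k) \<le> 2 * emeasure lborel C" for k
  proof (rule brunn_minkowski_real_bounded)
    have "bounded (I k)" by (simp add: I_def)
    then show "bounded (A \<inter> I k)" "bounded (B \<inter> I k)" by (simp_all add: bounded_Int)
    have "a \<in> A \<inter> I k" "b \<in> B \<inter> I k" using ab by (auto simp: I_def)
    then show "A \<inter> I k \<noteq> {}" "B \<inter> I k \<noteq> {}" by blast+
    show "A \<inter> I k \<in> sets borel" "B \<inter> I k \<in> sets borel" using A B by (simp_all add: I_def)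
    show "(x + y) / 2 \<in> C" if "x \<in> A \<inter> I k" "y \<in> B \<inter> I k" for x y using C(2) that by blast
  qed (rule C(1))
  then show ?thesis
    by (intro tendsto_upperbound[OF tendsto_add[OF lim[OF A(1)] lim[OF B(1)]]]) auto
qed

text \<open>Tonelli, with levels measured in units of \<open>c\<close>. The scale allows the levels
  of functions with different suprema to be matched.\<close>

lemma nn_integral_layer_cake:
  fixes u :: "'a \<Rightarrow> real"
  assumes "sigma_finite_measure M" and [measurable]: "u \<in> borel_measurable M" and u: "\<And>x. 0 \<le> u x" and c: "0 < c"
  shows "(\<integral>\<^sup>+x. ennreal (u x) \<partial>M) = ennreal c * (\<integral>\<^sup>+l. indicator {0<..} l * emeasure M {x\<in>space M. c * l < u x} \<partial>lborel)"
proof -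
  let ?A = "\<lambda>l. {x\<in>space M. c * l < u x}"
  interpret sigma_finite_measure M by fact
  interpret pair_sigma_finite M "lborel :: real measure"
    by (simp add: pair_sigma_finite_def sigma_finite_lborel assms(1))
  have "(\<integral>\<^sup>+x. ennreal (u x) \<partial>M) = (\<integral>\<^sup>+x. (\<integral>\<^sup>+l. ennreal c * (indicator {0<..} l * indicator (?A l) x) \<partial>lborel) \<partial>M)"
  proof (intro nn_integral_cong)
    fix x assume x: "x \<in> space M"
    have "(\<integral>\<^sup>+l. ennreal c * (indicator {0<..} l * indicator (?A l) x) \<partial>lborel)
        = (\<integral>\<^sup>+l. ennreal c * indicator {0<..<u x / c} l \<partial>lborel)"
      using c x by (intro nn_integral_cong) (auto simp: indicator_def field_simps)
    also have "\<dots> = ennreal c * ennreal (u x / c)"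
      using u[of x] c by (simp add: nn_integral_cmult)
    also have "\<dots> = ennreal (u x)" using c by (subst ennreal_mult'[symmetric]) auto
    finally show "ennreal (u x) = (\<integral>\<^sup>+l. ennreal c * (indicator {0<..} l * indicator (?A l) x) \<partial>lborel)" ..
  qed
  also have "\<dots> = (\<integral>\<^sup>+l. (\<integral>\<^sup>+x. ennreal c * (indicator {0<..} l * indicator (?A l) x) \<partial>M) \<partial>lborel)"
  proof (rule Fubini'[symmetric])
    have "(\<lambda>(x, l). ennreal c * (indicator {0<..} l * indicator {p \<in> space (M \<Otimes>\<^sub>M lborel). c * snd p < u (fst p)} (x, l)))
        \<in> borel_measurable (M \<Otimes>\<^sub>M lborel)"
      by measurable
    then show "(\<lambda>(x, l). ennreal c * (indicator {0<..} l * indicator (?A l) x)) \<in> borel_measurable (M \<Otimes>\<^sub>M lborel)"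
      by (rule measurable_cong[THEN iffD1, rotated]) (auto simp: space_pair_measure indicator_def)
  qed
  also have "\<dots> = (\<integral>\<^sup>+l. ennreal c * (indicator {0<..} l * emeasure M (?A l)) \<partial>lborel)"
    by (intro nn_integral_cong) (simp add: nn_integral_cmult mult.assoc)
  also have "\<dots> = ennreal c * (\<integral>\<^sup>+l. indicator {0<..} l * emeasure M (?A l) \<partial>lborel)"
  proof (rule nn_integral_cmult)
    have "{p \<in> space (lborel \<Otimes>\<^sub>M M). c * fst p < u (snd p)} \<in> sets (lborel \<Otimes>\<^sub>M M)" by measurable
    from sigma_finite_measure.measurable_emeasure_Pair[OF assms(1) this]
    have "(\<lambda>l. emeasure M (?A l)) \<in> borel_measurable lborel"
      by (simp add: space_pair_measure vimage_def)
    then show "(\<lambda>l. indicator {0<..} l * emeasure M (?A l)) \<in> borel_measurable lborel"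
      by measurable
  qed
  finally show ?thesis .
qed

lemma ennreal_am_gm: "4 * (a * b) \<le> (a + b)\<^sup>2" for a b :: ennreal
proof (cases a; cases b)
  fix x y :: real
  assume xy: "a = ennreal x" "0 \<le> x" "b = ennreal y" "0 \<le> y"
  have "0 \<le> (x - y)\<^sup>2" by simp
  then have le: "4 * (x * y) \<le> (x + y)\<^sup>2" by (simp add: power2_eq_square algebra_simps)
  have "4 * (a * b) = ennreal (4 * (x * y))"
    using xy by (simp add: ennreal_mult)
  also have "\<dots> \<le> ennreal ((x + y)\<^sup>2)" using le by (rule ennreal_leI)
  also have "\<dots> = (a + b)\<^sup>2"
    unfolding xy(1,3) ennreal_plus[OF xy(2,4), symmetric]
    by (rule ennreal_power[symmetric]) (use xy in simp)
  finally show ?thesis .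
qed (auto simp: power2_eq_square ennreal_mult_eq_top_iff)

text \<open>Levels are taken relative to the suprema \<open>F\<close>, \<open>G\<close> and to
  \<open>c = sqrt (F * G)\<close>. For \<open>0 < l < 1\<close> the level sets of \<open>f\<close>
  and \<open>g\<close> are both nonempty and their midpoints lie in that of \<open>h\<close>; for
  \<open>l \<ge> 1\<close> those of \<open>f\<close> and \<open>g\<close> are both empty. So
  Brunn-Minkowski on the line integrates to \<open>X + Y \<le> 2 * Z\<close>, and the
  arithmetic-geometric mean inequality gives the product form.\<close>

lemma prekopa_leindler_real_bounded:
  fixes f g h :: "real \<Rightarrow> real"
  assumes [measurable]: "f \<in> borel_measurable borel" "g \<in> borel_measurable borel" "h \<in> borel_measurable borel"
    and f: "\<And>x. 0 \<le> f x" "\<And>x. f x \<le> N" and g: "\<And>x. 0 \<le> g x" "\<And>x. g x \<le> N" and h: "\<And>x. 0 \<le> h x"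
    and le: "\<And>x y. f x * g y \<le> (h ((x + y) / 2))\<^sup>2"
  shows "(\<integral>\<^sup>+x. ennreal (f x) \<partial>lborel) * (\<integral>\<^sup>+x. ennreal (g x) \<partial>lborel) \<le> (\<integral>\<^sup>+x. ennreal (h x) \<partial>lborel)\<^sup>2"
proof -
  define F where "F = (SUP x. f x)"
  define G where "G = (SUP x. g x)"
  have bdd: "bdd_above (range f)" "bdd_above (range g)" by (rule bdd_aboveI2, rule f g)+
  have fF: "f x \<le> F" and gG: "g x \<le> G" for x
    unfolding F_def G_def using bdd by (auto intro: cSUP_upper)
  show ?thesis
  proof (cases "0 < F \<and> 0 < G")
    case False
    then have "(\<forall>x. f x = 0) \<or> (\<forall>x. g x = 0)"
      using fF gG f g by (meson order.antisym order.trans not_less)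
    then show ?thesis by auto
  next
    case True
    then have F: "0 < F" and G: "0 < G" by auto
    define c where "c = sqrt (F * G)"
    have c: "0 < c" "c\<^sup>2 = F * G" using F G by (auto simp: c_def)
    note layer = nn_integral_layer_cake[OF sigma_finite_lborel]
    define X where "X = (\<integral>\<^sup>+l. indicator {0<..} l * emeasure lborel {x. F * l < f x} \<partial>lborel)"
    define Y where "Y = (\<integral>\<^sup>+l. indicator {0<..} l * emeasure lborel {x. G * l < g x} \<partial>lborel)"
    define Z where "Z = (\<integral>\<^sup>+l. indicator {0<..} l * emeasure lborel {x. c * l < h x} \<partial>lborel)"
    have int_f: "(\<integral>\<^sup>+x. ennreal (f x) \<partial>lborel) = ennreal F * X"
      unfolding X_def using layer[of f F] f F by simp
    have int_g: "(\<integral>\<^sup>+x. ennreal (g x) \<partial>lborel) = ennreal G * Y"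
      unfolding Y_def using layer[of g G] g G by simp
    have int_h: "(\<integral>\<^sup>+x. ennreal (h x) \<partial>lborel) = ennreal c * Z"
      unfolding Z_def using layer[of h c] h c by simp
    have meas: "(\<lambda>l. emeasure lborel {x. r * l < u x}) \<in> borel_measurable lborel"
      if [measurable]: "u \<in> borel_measurable borel" for u :: "real \<Rightarrow> real" and r :: real
    proof -
      have "{p \<in> space (lborel \<Otimes>\<^sub>M lborel). r * fst p < u (snd p)} \<in> sets (lborel \<Otimes>\<^sub>M lborel)" by measurable
      from sigma_finite_measure.measurable_emeasure_Pair[OF sigma_finite_lborel this] show ?thesis
        by (simp add: space_pair_measure vimage_def)
    qed
    have "X + Y = (\<integral>\<^sup>+l. indicator {0<..} l * emeasure lborel {x. F * l < f x}
        + indicator {0<..} l * emeasure lborel {x. G * l < g x} \<partial>lborel)"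
      unfolding X_def Y_def using meas[of f F] meas[of g G] by (subst nn_integral_add) auto
    also have "\<dots> \<le> (\<integral>\<^sup>+l. 2 * (indicator {0<..} l * emeasure lborel {x. c * l < h x}) \<partial>lborel)"
    proof (intro nn_integral_mono)
      fix l :: real
      consider "l \<le> 0" | "0 < l" "l < 1" | "1 \<le> l" by linarith
      then show "indicator {0<..} l * emeasure lborel {x. F * l < f x} + indicator {0<..} l * emeasure lborel {x. G * l < g x}
          \<le> 2 * (indicator {0<..} l * emeasure lborel {x. c * l < h x})"
      proof cases
        case 2
        have "emeasure lborel {x. F * l < f x} + emeasure lborel {x. G * l < g x} \<le> 2 * emeasure lborel {x. c * l < h x}"
        proof (rule brunn_minkowski_real)
          have "F * l < F" "G * l < G" using 2 F G by auto
          then show "{x. F * l < f x} \<noteq> {}" "{x. G * l < g x} \<noteq> {}"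
            using less_cSUP_iff[OF _ bdd(1)] less_cSUP_iff[OF _ bdd(2)] unfolding F_def[symmetric] G_def[symmetric] by auto
          fix x y assume "x \<in> {x. F * l < f x}" "y \<in> {x. G * l < g x}"
          moreover have "0 < F * l" "0 < G * l" using 2 F G by auto
          ultimately have "(F * l) * (G * l) < f x * g y"
            using less_trans[of 0 "F * l" "f x"] by (intro mult_strict_mono) auto
          also have "\<dots> \<le> (h ((x + y) / 2))\<^sup>2" by (rule le)
          finally have "(c * l)\<^sup>2 < (h ((x + y) / 2))\<^sup>2"
            by (simp add: power_mult_distrib c(2) power2_eq_square[of l] mult_ac)
          then show "(x + y) / 2 \<in> {x. c * l < h x}"
            using h power_less_imp_less_base by blast
        qed measurable
        then show ?thesis using 2 by simp
      next
        case 3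
        then have "F \<le> F * l" "G \<le> G * l" using F G by auto
        then have "{x. F * l < f x} = {}" "{x. G * l < g x} = {}"
          using fF gG by (force simp: not_less intro: order_trans)+
        then show ?thesis by simp
      qed simp
    qed
    also have "\<dots> = 2 * Z"
      unfolding Z_def using meas[of h c] by (intro nn_integral_cmult) auto
    finally have XYZ: "X + Y \<le> 2 * Z" .
    have "4 * (X * Y) \<le> (X + Y)\<^sup>2" by (rule ennreal_am_gm)
    also have "\<dots> \<le> (2 * Z)\<^sup>2" using XYZ by (intro power_mono) auto
    also have "\<dots> = 4 * Z\<^sup>2" by (simp add: power_mult_distrib)
    finally have "X * Y \<le> Z\<^sup>2"
      by (subst (asm) ennreal_mult_le_mult_iff) auto
    have "(ennreal F * X) * (ennreal G * Y) = (ennreal F * ennreal G) * (X * Y)" by (simp add: mult_ac)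
    also have "\<dots> \<le> (ennreal F * ennreal G) * Z\<^sup>2" using \<open>X * Y \<le> Z\<^sup>2\<close> by (rule mult_left_mono) simp
    also have "ennreal F * ennreal G = (ennreal c)\<^sup>2"
      using F G c by (simp add: ennreal_power ennreal_mult'[symmetric])
    finally show ?thesis
      by (simp add: int_f int_g int_h power_mult_distrib)
  qed
qed

lemma nn_integral_eq_SUP_truncation:
  assumes [measurable]: "f \<in> borel_measurable M"
  shows "(SUP k. \<integral>\<^sup>+x. min (f x) (of_nat k) \<partial>M) = (\<integral>\<^sup>+x. f x \<partial>M)"
proof -
  have "(\<integral>\<^sup>+x. (SUP k. min (f x) (of_nat k)) \<partial>M) = (SUP k. \<integral>\<^sup>+x. min (f x) (of_nat k) \<partial>M)"
    by (intro nn_integral_monotone_convergence_SUP)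
      (auto simp: incseq_def le_fun_def intro: min.coboundedI2)
  moreover have "(SUP k. min y (of_nat k)) = y" for y :: ennreal
  proof -
    have "(SUP k. min y (of_nat k)) = min y (SUP k. of_nat k)"
      by (simp add: inf_SUP flip: inf_min)
    then show ?thesis by (simp add: ennreal_SUP_of_nat_eq_top)
  qed
  ultimately show ?thesis by simp
qed

text \<open>Cutting all three functions off at the same level preserves the hypothesis, and monotone
  convergence removes the cut-off.\<close>

lemma prekopa_leindler_real:
  fixes f g h :: "real \<Rightarrow> ennreal"
  assumes [measurable]: "f \<in> borel_measurable borel" "g \<in> borel_measurable borel" "h \<in> borel_measurable borel"
    and le: "\<And>x y. f x * g y \<le> (h ((x + y) / 2))\<^sup>2"
  shows "(\<integral>\<^sup>+x. f x \<partial>lborel) * (\<integral>\<^sup>+x. g x \<partial>lborel) \<le> (\<integral>\<^sup>+x. h x \<partial>lborel)\<^sup>2"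
proof -
  define I where "I u k = (\<integral>\<^sup>+x. min (u x) (of_nat k) \<partial>lborel)" for u :: "real \<Rightarrow> ennreal" and k :: nat
  have I_mono: "I u k \<le> I u m" if "k \<le> m" for u k m
    unfolding I_def using that by (intro nn_integral_mono min.mono) auto
  have I_SUP: "(SUP k. I u k) = (\<integral>\<^sup>+x. u x \<partial>lborel)" if "u \<in> borel_measurable borel" for u
    unfolding I_def using that by (intro nn_integral_eq_SUP_truncation) simp
  have diag: "I f k * I g k \<le> (\<integral>\<^sup>+x. h x \<partial>lborel)\<^sup>2" for k
  proof -
    define t where "t u x = enn2real (min (u x) (of_nat k))" for u :: "real \<Rightarrow> ennreal" and x
    have fin: "min (u x) (of_nat k) < \<top>" for u :: "real \<Rightarrow> ennreal" and x
      by (rule le_less_trans[OF min.cobounded2]) (simp add: of_nat_less_top)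
    have t: "ennreal (t u x) = min (u x) (of_nat k)" "0 \<le> t u x" for u x
      using fin by (auto simp: t_def)
    have t_le: "t u x \<le> real k" for u x
    proof -
      have "ennreal (t u x) \<le> ennreal (real k)" by (simp add: t ennreal_of_nat_eq_real_of_nat)
      then show ?thesis by (subst (asm) ennreal_le_iff) auto
    qed
    have "(\<integral>\<^sup>+x. ennreal (t f x) \<partial>lborel) * (\<integral>\<^sup>+x. ennreal (t g x) \<partial>lborel) \<le> (\<integral>\<^sup>+x. ennreal (t h x) \<partial>lborel)\<^sup>2"
    proof (rule prekopa_leindler_real_bounded[where N = "real k"])
      fix x y
      let ?k = "of_nat k :: ennreal"
      have "min (f x) ?k * min (g y) ?k \<le> (min (h ((x + y) / 2)) ?k)\<^sup>2"
      proof (cases "h ((x + y) / 2) \<le> ?k")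
        case True
        have "min (f x) ?k * min (g y) ?k \<le> f x * g y" by (intro mult_mono) auto
        then show ?thesis using True le[of x y] by (simp add: min_absorb1)
      next
        case False
        have "min (f x) ?k * min (g y) ?k \<le> ?k * ?k" by (intro mult_mono) auto
        then show ?thesis using False by (simp add: min_absorb2 power2_eq_square)
      qed
      then have "ennreal (t f x * t g y) \<le> ennreal ((t h ((x + y) / 2))\<^sup>2)"
        using t(2) by (simp add: ennreal_mult t(1) ennreal_power[symmetric])
      then show "t f x * t g y \<le> (t h ((x + y) / 2))\<^sup>2"
        by (subst (asm) ennreal_le_iff) auto
    qed (use t(2) t_le in \<open>auto simp: t_def\<close>)
    then have "I f k * I g k \<le> (I h k)\<^sup>2" by (simp add: t(1) I_def)
    also have "I h k \<le> (\<integral>\<^sup>+x. h x \<partial>lborel)" unfolding I_def by (intro nn_integral_mono) auto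
    then have "(I h k)\<^sup>2 \<le> (\<integral>\<^sup>+x. h x \<partial>lborel)\<^sup>2" by (intro power_mono) auto
    finally show ?thesis .
  qed
  \<comment> \<open>Monotonicity extends the diagonal bound to all pairs, so the two suprema can be
    taken one after the other.\<close>
  have "I f k * I g m \<le> (\<integral>\<^sup>+x. h x \<partial>lborel)\<^sup>2" for k m
  proof -
    have "I f k * I g m \<le> I f (max k m) * I g (max k m)" by (intro mult_mono I_mono) auto
    then show ?thesis using diag[of "max k m"] by (rule order_trans)
  qed
  then have SUP_g: "(SUP m. I f k * I g m) \<le> (\<integral>\<^sup>+x. h x \<partial>lborel)\<^sup>2" for k by (intro SUP_least)
  have "I f k * (\<integral>\<^sup>+x. g x \<partial>lborel) \<le> (\<integral>\<^sup>+x. h x \<partial>lborel)\<^sup>2" for k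
    unfolding I_SUP[OF assms(2), symmetric] SUP_mult_left_ennreal by (rule SUP_g)
  then have "(SUP k. I f k * (\<integral>\<^sup>+x. g x \<partial>lborel)) \<le> (\<integral>\<^sup>+x. h x \<partial>lborel)\<^sup>2" by (intro SUP_least)
  then show ?thesis
    unfolding I_SUP[OF assms(1), symmetric] SUP_mult_right_ennreal .
qed

text \<open>Integrating out one coordinate preserves the hypothesis, by the inequality on the line;
  the remaining coordinates follow by induction. Arguments are extensional because those are the
  points of the product space, on which sections are measurable.\<close>

lemma prekopa_leindler_PiM:
  fixes f g h :: "('i \<Rightarrow> real) \<Rightarrow> ennreal"
  assumes "finite I"
    and "f \<in> borel_measurable (\<Pi>\<^sub>M i\<in>I. lborel)" "g \<in> borel_measurable (\<Pi>\<^sub>M i\<in>I. lborel)"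
      "h \<in> borel_measurable (\<Pi>\<^sub>M i\<in>I. lborel)"
    and "\<And>x y. x \<in> extensional I \<Longrightarrow> y \<in> extensional I \<Longrightarrow> f x * g y \<le> (h (\<lambda>i\<in>I. (x i + y i) / 2))\<^sup>2"
  shows "(\<integral>\<^sup>+x. f x \<partial>(\<Pi>\<^sub>M i\<in>I. lborel)) * (\<integral>\<^sup>+x. g x \<partial>(\<Pi>\<^sub>M i\<in>I. lborel)) \<le> (\<integral>\<^sup>+x. h x \<partial>(\<Pi>\<^sub>M i\<in>I. lborel))\<^sup>2"
  using assms
proof (induction I arbitrary: f g h rule: finite_induct)
  case empty
  interpret product_sigma_finite "\<lambda>_::'i. lborel :: real measure" by standard
  show ?case
    using empty(4)[of "\<lambda>_. undefined" "\<lambda>_. undefined"] by (simp add: nn_integral_empty restrict_def)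
next
  case (insert i I)
  interpret product_sigma_finite "\<lambda>_::'i. lborel :: real measure" by standard
  let ?P = "\<lambda>I. \<Pi>\<^sub>M i\<in>I. (lborel :: real measure)"
  note [measurable] = insert.prems(1-3)
  define S where "S u x = (\<integral>\<^sup>+s. u (x(i := s)) \<partial>lborel)" for u :: "('i \<Rightarrow> real) \<Rightarrow> ennreal" and x
  have S_int: "(\<integral>\<^sup>+x. u x \<partial>?P (insert i I)) = (\<integral>\<^sup>+x. S u x \<partial>?P I)"
    if "u \<in> borel_measurable (?P (insert i I))" for u
    unfolding S_def by (rule product_nn_integral_insert[OF insert.hyps that])
  have S_meas: "S u \<in> borel_measurable (?P I)" if [measurable]: "u \<in> borel_measurable (?P (insert i I))" for u
  proof -
    have "(\<lambda>(x, s). u (x(i := s))) \<in> borel_measurable (?P I \<Otimes>\<^sub>M lborel)"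
      unfolding split_beta'
      by (rule measurable_compose[OF _ that]) (use measurable_add_dim[of i I "\<lambda>_. lborel"] in \<open>simp add: split_beta'\<close>)
    then show ?thesis
      unfolding S_def by (rule sigma_finite_measure.borel_measurable_nn_integral[OF sigma_finite_lborel])
  qed
  have comp: "(\<lambda>s. u (x(i := s))) \<in> borel_measurable borel"
    if "u \<in> borel_measurable (?P (insert i I))" "x \<in> extensional I" for u x
  proof -
    have "x \<in> space (?P I)" using that(2) by (auto simp: space_PiM PiE_def)
    from measurable_compose[OF measurable_component_update[OF this insert.hyps(2)] that(1)] show ?thesis by simp
  qed
  have "S f x * S g y \<le> (S h (\<lambda>j\<in>I. (x j + y j) / 2))\<^sup>2" if xy: "x \<in> extensional I" "y \<in> extensional I" for x y
    unfolding S_def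
  proof (rule prekopa_leindler_real)
    fix s t
    have "(\<lambda>j\<in>insert i I. ((x(i := s)) j + (y(i := t)) j) / 2) = (\<lambda>j\<in>I. (x j + y j) / 2)(i := (s + t) / 2)"
      using insert.hyps(2) by (auto simp: fun_eq_iff)
    moreover have ext: "x(i := s) \<in> extensional (insert i I)" "y(i := t) \<in> extensional (insert i I)"
      using xy by (auto simp: extensional_def)
    ultimately show "f (x(i := s)) * g (y(i := t)) \<le> (h ((\<lambda>j\<in>I. (x j + y j) / 2)(i := (s + t) / 2)))\<^sup>2"
      using insert.prems(4)[OF ext] by (simp only:)
  qed (use insert.prems xy in \<open>auto intro: comp\<close>)
  then show ?case
    unfolding S_int[OF insert.prems(1)] S_int[OF insert.prems(2)] S_int[OF insert.prems(3)]
    by (intro insert.IH S_meas insert.prems)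
qed

text \<open>Coordinates in \<open>Basis\<close> preserve midpoints. The midpoint case is what the
  dyadic iteration in \<open>power_moment_le_exp\<close> consumes.\<close>

lemma prekopa_leindler_midpoint:
  fixes f g h :: "'a::euclidean_space \<Rightarrow> ennreal"
  assumes [measurable]: "f \<in> borel_measurable borel" "g \<in> borel_measurable borel" "h \<in> borel_measurable borel"
    and le: "\<And>x y. f x * g y \<le> (h ((x + y) /\<^sub>R 2))\<^sup>2"
  shows "(\<integral>\<^sup>+x. f x \<partial>lborel) * (\<integral>\<^sup>+x. g x \<partial>lborel) \<le> (\<integral>\<^sup>+x. h x \<partial>lborel)\<^sup>2"
proof -
  let ?T = "\<lambda>c::'a \<Rightarrow> real. \<Sum>b\<in>Basis. c b *\<^sub>R b"
  have int: "(\<integral>\<^sup>+x. u x \<partial>lborel) = (\<integral>\<^sup>+c. u (?T c) \<partial>(\<Pi>\<^sub>M b\<in>Basis. lborel))"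
    if [measurable]: "u \<in> borel_measurable borel" for u :: "'a \<Rightarrow> ennreal"
    by (subst lborel_eq, subst nn_integral_distr) auto
  show ?thesis
    unfolding int[OF assms(1)] int[OF assms(2)] int[OF assms(3)]
  proof (rule prekopa_leindler_PiM)
    fix x y :: "'a \<Rightarrow> real"
    have "?T (\<lambda>i\<in>Basis. (x i + y i) / 2) = (?T x + ?T y) /\<^sub>R 2"
      by (simp add: scaleR_sum_right sum.distrib[symmetric] scaleR_add_left add_divide_distrib algebra_simps)
    then show "f (?T x) * g (?T y) \<le> (h (?T (\<lambda>i\<in>Basis. (x i + y i) / 2)))\<^sup>2"
      using le by simp
  qed auto
qed

section \<open>Concentration from log-concave power moments\<close>

text \<open>The tangent of \<open>ln M\<close> at 1 lies above \<open>ln M\<close>, since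
  \<open>M 1 = 1\<close> and the derivative of \<open>M\<close> there is the mean. Midpoint
  log-concavity is enough because the dyadic points \<open>1 + u / 2 ^ k\<close> reach the tangent
  in the limit.\<close>

lemma power_moment_le_exp:
  fixes p a :: "nat \<Rightarrow> real" and n :: nat
  defines "M \<equiv> \<lambda>s. \<Sum>i\<le>n. p i * s powr a i"
  assumes p: "\<And>i. 0 \<le> p i" "(\<Sum>i\<le>n. p i) = 1"
    and mid: "\<And>s t. 0 < s \<Longrightarrow> 0 < t \<Longrightarrow> M s * M t \<le> (M ((s + t) / 2))\<^sup>2"
    and s: "0 < s"
  shows "M s \<le> exp ((s - 1) * (\<Sum>i\<le>n. p i * a i))"
proof -
  define u where "u = s - 1"
  define m where "m = (\<Sum>i\<le>n. p i * a i)"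
  have M1: "M 1 = 1" using p(2) by (simp add: M_def)
  have M_nonneg: "0 \<le> M x" for x unfolding M_def using p(1) by (intro sum_nonneg mult_nonneg_nonneg) auto
  have pos: "0 < 1 + u / 2 ^ k" for k
  proof -
    have "u / 2 ^ k > -1"
    proof (cases "0 \<le> u")
      case True
      then have "0 \<le> u / 2 ^ k" by simp
      then show ?thesis by linarith
    next
      case False
      then have "(- u) / 2 ^ k \<le> (- u) / 1" by (intro divide_left_mono) auto
      then have "u \<le> u / 2 ^ k" by (simp only: minus_divide_left[symmetric] div_by_1 neg_le_iff_le)
      moreover have "-1 < u" using s by (simp add: u_def)
      ultimately show ?thesis by linarith
    qed
    then show ?thesis by linarith
  qed
  \<comment> \<open>Taking the midpoint with 1 halves the distance to 1 and squares the value in the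
    bound, since \<open>M 1 = 1\<close>.\<close>
  have iter: "M s \<le> M (1 + u / 2 ^ k) ^ 2 ^ k" for k
  proof (induction k)
    case (Suc k)
    have "M (1 + u / 2 ^ k) * M 1 \<le> (M (((1 + u / 2 ^ k) + 1) / 2))\<^sup>2"
      by (rule mid[OF pos]) simp
    also have "((1 + u / 2 ^ k) + 1) / 2 = 1 + u / 2 ^ Suc k" by (simp add: field_simps)
    finally have "M (1 + u / 2 ^ k) ^ 2 ^ k \<le> ((M (1 + u / 2 ^ Suc k))\<^sup>2) ^ 2 ^ k"
      by (intro power_mono M_nonneg) (simp add: M1)
    then show ?case using Suc.IH by (simp add: power_mult[symmetric])
  qed (simp add: u_def)
  \<comment> \<open>By \<open>x \<le> exp (x - 1)\<close>. The new exponent is \<open>u\<close>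
    times a difference quotient of \<open>M\<close> at 1.\<close>
  have bound: "M s \<le> exp (2 ^ k * (M (1 + u / 2 ^ k) - 1))" for k
  proof -
    have "M (1 + u / 2 ^ k) ^ 2 ^ k \<le> exp (M (1 + u / 2 ^ k) - 1) ^ 2 ^ k"
      using exp_ge_add_one_self[of "M (1 + u / 2 ^ k) - 1"] by (intro power_mono M_nonneg) simp
    also have "\<dots> = exp (2 ^ k * (M (1 + u / 2 ^ k) - 1))"
      by (simp add: exp_of_nat_mult[symmetric])
    finally show ?thesis using iter[of k] by (rule order_trans[rotated])
  qed
  show ?thesis
  proof (cases "u = 0")
    case True
    then show ?thesis using M1 by (simp add: u_def)
  next
    case False
    have "(M has_real_derivative m) (at 1)"
      unfolding M_def m_def by (auto intro!: derivative_eq_intros sum.cong simp: mult_ac)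
    then have "(\<lambda>h. (M (1 + h) - M 1) / h) \<midarrow>0\<rightarrow> m" by (simp add: DERIV_def)
    moreover have "filterlim (\<lambda>k. u / 2 ^ k) (at 0) sequentially"
    proof (rule filterlim_atI)
      show "(\<lambda>k. u / 2 ^ k) \<longlonglongrightarrow> 0" by (rule LIMSEQ_divide_realpow_zero) simp
    qed (use False in auto)
    ultimately have "(\<lambda>k. (M (1 + u / 2 ^ k) - M 1) / (u / 2 ^ k)) \<longlonglongrightarrow> m"
      by (rule filterlim_compose)
    then have "(\<lambda>k. exp (u * ((M (1 + u / 2 ^ k) - M 1) / (u / 2 ^ k)))) \<longlonglongrightarrow> exp (u * m)"
      by (intro tendsto_intros)
    moreover have "u * ((M (1 + u / 2 ^ k) - M 1) / (u / 2 ^ k)) = 2 ^ k * (M (1 + u / 2 ^ k) - 1)" for k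
      using False by (simp add: M1)
    ultimately have "(\<lambda>k. exp (2 ^ k * (M (1 + u / 2 ^ k) - 1))) \<longlonglongrightarrow> exp (u * m)" by simp
    then have "M s \<le> exp (u * m)"
      using bound by (intro tendsto_lowerbound[OF _ always_eventually]) auto
    then show ?thesis by (simp add: u_def m_def)
  qed
qed

text \<open>The Taylor remainder of order four is nonnegative for either sign of \<open>x\<close>;
  stopping at the quadratic term would fail for negative \<open>x\<close>.\<close>

lemma exp_ge_cubic: "1 + x + x\<^sup>2 / 2 + x ^ 3 / 6 \<le> exp x" for x :: real
proof -
  obtain t where "exp x = (\<Sum>m<4. x ^ m / fact m) + exp t / fact 4 * x ^ 4"
    using Maclaurin_exp_le[of x 4] by blast
  moreover have "0 \<le> exp t / fact 4 * x ^ 4" by simp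
  moreover have "(\<Sum>m<4. x ^ m / fact m) = 1 + x + x\<^sup>2 / 2 + x ^ 3 / 6"
    by (simp add: eval_nat_numeral)
  ultimately show ?thesis by linarith
qed

lemma exp_minus_le_quadratic:
  fixes y :: real
  assumes "0 \<le> y" shows "exp (- y) \<le> 1 - y + y\<^sup>2 / 2"
proof -
  have "(\<lambda>y. 1 - y + y\<^sup>2 / 2 - exp (- y)) 0 \<le> (\<lambda>y. 1 - y + y\<^sup>2 / 2 - exp (- y)) y"
  proof (rule DERIV_nonneg_imp_nondecreasing[OF assms])
    fix x :: real assume "0 \<le> x" "x \<le> y"
    show "\<exists>d. ((\<lambda>y. 1 - y + y\<^sup>2 / 2 - exp (- y)) has_real_derivative d) (at x) \<and> 0 \<le> d"
      using exp_ge_add_one_self[of "- x"]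
      by (intro exI[of _ "x - 1 + exp (- x)"]) (auto intro!: derivative_eq_intros)
  qed
  then show ?thesis by simp
qed

text \<open>Weakens Bennett's rate function to Bernstein's. The left side is
  \<open>3 / 2 * (u - 3 + 9 / (3 + u))\<close> by partial fractions, a form that is easy to
  differentiate twice.\<close>

lemma bennett_ge:
  fixes u :: real
  assumes "0 \<le> u" shows "3 * u\<^sup>2 / (2 * (3 + u)) \<le> (1 + u) * ln (1 + u) - u"
proof -
  \<comment> \<open>the difference of the two sides has second derivative \<open>1 / (1 + x) - 27 / (3 + x) ^ 3\<close>\<close>
  define \<phi> where "\<phi> x = (1 + x) * ln (1 + x) - x - 3 / 2 * (x - 3 + 9 * inverse (3 + x))" for x :: real
  define \<psi> where "\<psi> x = ln (1 + x) - 3 / 2 * (1 - 9 * (inverse (3 + x))\<^sup>2)" for x :: real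
  have d_inv: "((\<lambda>x. inverse (3 + x)) has_real_derivative - ((inverse (3 + z))\<^sup>2)) (at z)" if "0 \<le> z" for z :: real
  proof -
    have "((\<lambda>x. 3 + x) has_real_derivative 1) (at z)" by (auto intro!: derivative_eq_intros)
    from DERIV_inverse'[OF this] show ?thesis using that by (simp add: power2_eq_square)
  qed
  have \<psi>: "0 \<le> \<psi> x" if "0 \<le> x" for x
  proof -
    have "\<psi> 0 \<le> \<psi> x"
    proof (rule DERIV_nonneg_imp_nondecreasing[OF that])
      fix z :: real assume z: "0 \<le> z" "z \<le> x"
      let ?w = "inverse (3 + z)"
      have d_ln: "((\<lambda>x. ln (1 + x)) has_real_derivative 1 / (1 + z)) (at z)"
        using z by (auto intro!: derivative_eq_intros)
      have d_sq: "((\<lambda>x. (inverse (3 + x))\<^sup>2) has_real_derivative 2 * (- (?w\<^sup>2) * ?w)) (at z)"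
        using DERIV_power[OF d_inv[OF z(1)], of 2] by simp
      have "(\<psi> has_real_derivative 1 / (1 + z) - 3 / 2 * (0 - 9 * (2 * (- (?w\<^sup>2) * ?w)))) (at z)"
        unfolding \<psi>_def by (intro DERIV_diff DERIV_cmult DERIV_const d_ln d_sq)
      moreover have "1 / (1 + z) - 3 / 2 * (0 - 9 * (2 * (- (?w\<^sup>2) * ?w))) = 1 / (1 + z) - 27 * ?w ^ 3"
        by (simp add: power2_eq_square power3_eq_cube)
      \<comment> \<open>The cube expands to \<open>27 + 27 * z\<close> plus nonnegative
        terms.\<close>
      moreover have "27 * (1 + z) \<le> (3 + z) ^ 3"
        using z by (simp add: power3_eq_cube algebra_simps)
      then have "27 / (3 + z) ^ 3 \<le> 1 / (1 + z)" using z by (simp add: divide_simps)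
      then have "27 * ?w ^ 3 \<le> 1 / (1 + z)" by (simp add: divide_inverse power_inverse)
      ultimately show "\<exists>d. (\<psi> has_real_derivative d) (at z) \<and> 0 \<le> d" by (intro exI conjI) auto
    qed
    then show ?thesis by (simp add: \<psi>_def power2_eq_square)
  qed
  have "\<phi> 0 \<le> \<phi> u"
  proof (rule DERIV_nonneg_imp_nondecreasing[OF assms])
    fix z :: real assume z: "0 \<le> z" "z \<le> u"
    have d_prod: "((\<lambda>x. (1 + x) * ln (1 + x)) has_real_derivative ln (1 + z) + 1) (at z)"
      using z by (auto intro!: derivative_eq_intros)
    have "(\<phi> has_real_derivative ln (1 + z) + 1 - 1 - 3 / 2 * (1 - 0 + 9 * - ((inverse (3 + z))\<^sup>2))) (at z)"
      unfolding \<phi>_def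
      by (intro DERIV_diff DERIV_add DERIV_cmult DERIV_const DERIV_ident d_prod d_inv z)
    then have "(\<phi> has_real_derivative \<psi> z) (at z)" by (simp add: \<psi>_def)
    then show "\<exists>d. (\<phi> has_real_derivative d) (at z) \<and> 0 \<le> d" using \<psi> z by blast
  qed
  moreover have "3 / 2 * (u - 3 + 9 * inverse (3 + u)) = 3 * u\<^sup>2 / (2 * (3 + u))"
    using assms by (simp add: field_simps power2_eq_square)
  ultimately show ?thesis by (simp add: \<phi>_def)
qed

text \<open>With \<open>s = exp y\<close> the hypothesis bounds the centred moment generating
  function by that of a Poisson variable of mean \<open>m\<close>. Its second-order behaviour at 0
  bounds the variance, and Chernoff's method gives both tails.\<close>

lemma concentration_of_power_moments:
  fixes p a :: "nat \<Rightarrow> real" and m :: real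
  assumes p: "\<And>i. 0 \<le> p i" "(\<Sum>i\<le>n. p i) = 1" and m: "m = (\<Sum>i\<le>n. p i * a i)" "0 \<le> m" "m \<le> N" "0 < N"
    and le: "\<And>s. 0 < s \<Longrightarrow> (\<Sum>i\<le>n. p i * s powr a i) \<le> exp ((s - 1) * m)"
  shows variance_le_mean: "(\<Sum>i\<le>n. p i * (a i - m)\<^sup>2) \<le> m"
    and upper_tail: "0 \<le> u \<Longrightarrow> u \<le> 1 / 2 \<Longrightarrow> (\<Sum>i\<in>{i. i \<le> n \<and> N * u \<le> a i - m}. p i) \<le> exp (- 3 / 7 * N * u\<^sup>2)"
    and lower_tail: "0 \<le> u \<Longrightarrow> (\<Sum>i\<in>{i. i \<le> n \<and> N * u \<le> m - a i}. p i) \<le> exp (- 3 / 7 * N * u\<^sup>2)"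
proof -
  have mgf: "(\<Sum>i\<le>n. p i * exp (y * (a i - m))) \<le> exp (m * (exp y - 1 - y))" for y
  proof -
    have "(\<Sum>i\<le>n. p i * exp (y * (a i - m))) = (\<Sum>i\<le>n. p i * exp y powr a i) * exp (- (y * m))"
    proof -
      have "exp (y * (a i - m)) = exp y powr a i * exp (- (y * m))" for i
        by (simp add: powr_def right_diff_distrib exp_diff exp_minus divide_inverse mult.commute)
      then show ?thesis by (simp only: sum_distrib_right mult.assoc)
    qed
    also have "\<dots> \<le> exp ((exp y - 1) * m) * exp (- (y * m))"
      using le[of "exp y"] by (intro mult_right_mono) auto
    also have "\<dots> = exp (m * (exp y - 1 - y))" by (simp add: exp_add[symmetric] algebra_simps)
    finally show ?thesis .
  qed
  have centered: "(\<Sum>i\<le>n. p i * (a i - m)) = 0"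
    using p(2) by (simp add: right_diff_distrib sum_subtractf sum_distrib_right[symmetric] m(1)[symmetric])
  show "(\<Sum>i\<le>n. p i * (a i - m)\<^sup>2) \<le> m"
  proof -
    define v where "v = (\<Sum>i\<le>n. p i * (a i - m)\<^sup>2)"
    define c where "c = (\<Sum>i\<le>n. p i * (a i - m) ^ 3)"
    \<comment> \<open>Constant and linear terms cancel by centring. Dividing by
      \<open>y\<^sup>2\<close> compares second-order coefficients, and the cubic term disappears as
      \<open>y\<close> tends to 0 from the right.\<close>
    have "v / 2 + y * c / 6 \<le> (exp (m * (exp y - 1 - y)) - 1) / y\<^sup>2" if "0 < y" for y
    proof -
      have "1 + y\<^sup>2 * v / 2 + y ^ 3 * c / 6 = (\<Sum>i\<le>n. p i) + y * (\<Sum>i\<le>n. p i * (a i - m)) + y\<^sup>2 * v / 2 + y ^ 3 * c / 6"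
        by (simp add: p(2) centered)
      also have "\<dots> = (\<Sum>i\<le>n. p i * (1 + y * (a i - m) + (y * (a i - m))\<^sup>2 / 2 + (y * (a i - m)) ^ 3 / 6))"
        unfolding v_def c_def
        by (simp add: sum_distrib_left sum_divide_distrib sum.distrib[symmetric] power_mult_distrib distrib_left mult_ac)
      also have "\<dots> \<le> (\<Sum>i\<le>n. p i * exp (y * (a i - m)))"
        by (intro sum_mono mult_left_mono exp_ge_cubic p)
      also have "\<dots> \<le> exp (m * (exp y - 1 - y))" by (rule mgf)
      finally have "y\<^sup>2 * (v / 2 + y * c / 6) \<le> exp (m * (exp y - 1 - y)) - 1"
        by (simp add: algebra_simps power2_eq_square power3_eq_cube)
      then show ?thesis using that by (simp add: pos_le_divide_eq mult.commute)
    qed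
    then have ev: "eventually (\<lambda>y. v / 2 + y * c / 6 \<le> (exp (m * (exp y - 1 - y)) - 1) / y\<^sup>2) (at_right 0)"
      by (intro eventually_at_right_less[THEN eventually_mono]) auto
    have "((\<lambda>y. v / 2 + y * c / 6) \<longlongrightarrow> v / 2 + 0 * c / 6) (at_right 0)"
      by (intro tendsto_intros) simp_all
    moreover have "((\<lambda>y. (exp (m * (exp y - 1 - y)) - 1) / y\<^sup>2) \<longlongrightarrow> m / 2) (at_right 0)"
      by real_asymp
    ultimately have "v / 2 + 0 * c / 6 \<le> m / 2"
      using ev by (intro tendsto_le[of "at_right 0"]) auto
    then show ?thesis by (simp add: v_def)
  qed
  \<comment> \<open>\<open>\<sigma>\<close> is 1 for the upper tail and -1 for the lower one. The
    mean is replaced by its bound \<open>N\<close> because \<open>exp x - 1 - x\<close> is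
    nonnegative.\<close>
  have chernoff: "(\<Sum>i\<in>{i. i \<le> n \<and> r \<le> \<sigma> * (a i - m)}. p i) \<le> exp (N * (exp (\<sigma> * y) - 1 - \<sigma> * y) - y * r)"
    if y: "0 \<le> y" for y r \<sigma>
  proof -
    have "(\<Sum>i\<in>{i. i \<le> n \<and> r \<le> \<sigma> * (a i - m)}. p i)
        \<le> (\<Sum>i\<in>{i. i \<le> n \<and> r \<le> \<sigma> * (a i - m)}. p i * exp (y * (\<sigma> * (a i - m) - r)))"
    proof (rule sum_mono)
      fix i assume "i \<in> {i. i \<le> n \<and> r \<le> \<sigma> * (a i - m)}"
      then have "1 \<le> exp (y * (\<sigma> * (a i - m) - r))" using y by simp
      then show "p i \<le> p i * exp (y * (\<sigma> * (a i - m) - r))"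
        using mult_left_mono[of 1 _ "p i"] p(1)[of i] by simp
    qed
    also have "\<dots> \<le> (\<Sum>i\<le>n. p i * exp (y * (\<sigma> * (a i - m) - r)))"
      by (rule sum_mono2) (auto simp: p(1))
    also have "\<dots> = (\<Sum>i\<le>n. p i * exp ((\<sigma> * y) * (a i - m))) * exp (- (y * r))"
    proof -
      have "exp (y * (\<sigma> * (a i - m) - r)) = exp ((\<sigma> * y) * (a i - m)) * exp (- (y * r))" for i
        by (simp add: mult_exp_exp algebra_simps)
      then show ?thesis by (simp only: sum_distrib_right mult.assoc)
    qed
    also have "\<dots> \<le> exp (m * (exp (\<sigma> * y) - 1 - \<sigma> * y)) * exp (- (y * r))"
      by (intro mult_right_mono mgf) simp
    also have "\<dots> \<le> exp (N * (exp (\<sigma> * y) - 1 - \<sigma> * y)) * exp (- (y * r))"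
    proof -
      have "0 \<le> exp (\<sigma> * y) - 1 - \<sigma> * y" using exp_ge_add_one_self[of "\<sigma> * y"] by linarith
      then have "m * (exp (\<sigma> * y) - 1 - \<sigma> * y) \<le> N * (exp (\<sigma> * y) - 1 - \<sigma> * y)"
        using m(3) by (rule mult_right_mono[rotated])
      then show ?thesis by (intro mult_right_mono) auto
    qed
    also have "\<dots> = exp (N * (exp (\<sigma> * y) - 1 - \<sigma> * y) - y * r)" by (simp add: exp_add[symmetric])
    finally show ?thesis .
  qed
  show "(\<Sum>i\<in>{i. i \<le> n \<and> N * u \<le> a i - m}. p i) \<le> exp (- 3 / 7 * N * u\<^sup>2)" if u: "0 \<le> u" "u \<le> 1 / 2"
  proof -
    \<comment> \<open>\<open>ln (1 + u)\<close> minimizes the Chernoff exponent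
      \<open>N * (exp y - 1 - y) - y * (N * u)\<close>.\<close>
    have "(\<Sum>i\<in>{i. i \<le> n \<and> N * u \<le> a i - m}. p i) \<le> exp (N * (u - ln (1 + u)) - ln (1 + u) * (N * u))"
      using chernoff[of "ln (1 + u)" "N * u" 1] u by simp
    also have "N * (u - ln (1 + u)) - ln (1 + u) * (N * u) = - (N * ((1 + u) * ln (1 + u) - u))"
      by (simp add: algebra_simps)
    also have "exp \<dots> \<le> exp (- (N * (3 / 7 * u\<^sup>2)))"
    proof -
      have "3 / 7 * u\<^sup>2 = 3 * u\<^sup>2 / 7" by simp
      \<comment> \<open>For \<open>u \<le> 1 / 2\<close> the denominator is at most 7, which is the
        origin of the constant 3/7.\<close>
      also have "\<dots> \<le> 3 * u\<^sup>2 / (2 * (3 + u))" using u by (intro divide_left_mono) auto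
      also have "\<dots> \<le> (1 + u) * ln (1 + u) - u" by (rule bennett_ge[OF u(1)])
      finally have "N * (3 / 7 * u\<^sup>2) \<le> N * ((1 + u) * ln (1 + u) - u)" using m(4) by (intro mult_left_mono) auto
      then show ?thesis by simp
    qed
    finally show ?thesis by (simp add: mult_ac)
  qed
  show "(\<Sum>i\<in>{i. i \<le> n \<and> N * u \<le> m - a i}. p i) \<le> exp (- 3 / 7 * N * u\<^sup>2)" if u: "0 \<le> u"
  proof -
    \<comment> \<open>Here the simpler choice \<open>y = u\<close> already gives the rate
      \<open>u\<^sup>2 / 2\<close>, at least \<open>3 / 7 * u\<^sup>2\<close>.\<close>
    have "(\<Sum>i\<in>{i. i \<le> n \<and> N * u \<le> m - a i}. p i) \<le> exp (N * (exp (- u) - 1 + u) - u * (N * u))"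
      using chernoff[of u "N * u" "-1"] u by simp
    also have "\<dots> \<le> exp (- (N * (3 / 7 * u\<^sup>2)))"
    proof -
      have "N * (exp (- u) - 1 + u) \<le> N * (u\<^sup>2 / 2)"
        using exp_minus_le_quadratic[OF u] m(4) by (intro mult_left_mono) auto
      then have "N * (exp (- u) - 1 + u) - u * (N * u) \<le> - (N * u\<^sup>2) / 2"
        by (simp add: power2_eq_square algebra_simps)
      also have "\<dots> \<le> - (N * (3 / 7 * u\<^sup>2))" using m(4) mult_nonneg_nonneg[of N "u\<^sup>2"] by simp
      finally show ?thesis by simp
    qed
    finally show ?thesis by (simp add: mult_ac)
  qed
qed

section \<open>Intrinsic volumes\<close>

context haar
begin

lemma intrinsic_volume_eq:
  "intrinsic_volume H P j K = real (CARD('n) choose j) * unit_ball_vol (real CARD('n))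
     / (unit_ball_vol (real j) * unit_ball_vol (real (CARD('n) - j))) * mean_proj P j K"
  by (simp add: intrinsic_volume_def mean_proj_def)

lemma intrinsic_volume_nonneg: "0 \<le> intrinsic_volume H P j K"
  unfolding intrinsic_volume_def by (intro mult_nonneg_nonneg divide_nonneg_nonneg integral_nonneg) auto

text \<open>The normalization of \<open>V\<^sub>j\<close> is \<open>steiner_coeff (n - j)\<close>
  divided by \<open>unit_ball_vol (n - j)\<close>; what remains is to reverse the order of
  summation.\<close>

lemma steiner_formula:
  assumes P: "projector_family P" and K: "compact K" "convex K" "K \<noteq> {}" and r: "0 < r"
  shows "measure lborel (parallel_body K r)
    = (\<Sum>j\<le>CARD('n). unit_ball_vol (real (CARD('n) - j)) * intrinsic_volume H P j K * r ^ (CARD('n) - j))"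
  unfolding steiner_kubota[OF assms]
proof (rule sum.reindex_bij_witness[where i = "\<lambda>j. CARD('n) - j" and j = "\<lambda>j. CARD('n) - j"])
  fix j assume "j \<in> {..CARD('n)}"
  then have j: "j \<le> CARD('n)" by simp
  have "unit_ball_vol (real j) \<noteq> 0" using unit_ball_vol_pos[of "real j"] by linarith
  then show "unit_ball_vol (real (CARD('n) - (CARD('n) - j))) * intrinsic_volume H P (CARD('n) - j) K * r ^ (CARD('n) - (CARD('n) - j))
      = steiner_coeff j * mean_proj P (CARD('n) - j) K * r ^ j"
    using j by (simp add: intrinsic_volume_eq steiner_coeff_def binomial_symmetric[OF j, symmetric])
qed auto

text \<open>Writing \<open>exp (- b)\<close> as the integral of \<open>exp (- t)\<close> over
  \<open>t \<ge> b\<close> and exchanging integrals leaves the volume of the parallel body of radius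
  \<open>sqrt (t / (pi * s))\<close>. The Steiner formula makes it a sum of powers of
  \<open>t\<close>, each integrating to a Gamma value.\<close>

lemma gaussian_integral_infdist:
  assumes P: "projector_family P" and K: "compact K" "convex K" "K \<noteq> {}" and s: "0 < s"
  shows "(\<integral>\<^sup>+x. ennreal (exp (- (pi * s * (infdist x K)\<^sup>2))) \<partial>lborel)
    = ennreal (\<Sum>j\<le>CARD('n). intrinsic_volume H P j K * s powr - (real (CARD('n) - j) / 2))"
proof -
  let ?n = "CARD('n)"
  let ?V = "\<lambda>j. intrinsic_volume H P j K"
  define b where "b x = pi * s * (infdist x K)\<^sup>2" for x
  have [measurable]: "b \<in> borel_measurable borel"
    unfolding b_def by (intro borel_measurable_continuous_onI continuous_intros)
  have exp_b: "ennreal (exp (- c)) = (\<integral>\<^sup>+t. ennreal (exp (- t)) * indicator {c..} t \<partial>lborel)" for c :: real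
  proof -
    have "(\<integral>\<^sup>+t. ennreal (exp (- t)) * indicator {c..} t \<partial>lborel) = ennreal (0 - (- exp (- c)))"
    proof (rule nn_integral_FTC_atLeast)
      have "((\<lambda>t::real. exp (- t)) \<longlongrightarrow> 0) at_top"
        by (rule filterlim_compose[OF exp_at_bot filterlim_uminus_at_bot_at_top])
      then show "((\<lambda>t::real. - exp (- t)) \<longlongrightarrow> 0) at_top"
        using tendsto_minus by fastforce
      show "((\<lambda>t. - exp (- t)) has_real_derivative exp (- t)) (at t)" for t :: real
        by (auto intro!: derivative_eq_intros)
    qed simp_all
    then show ?thesis by simp
  qed
  define \<kappa> where "\<kappa> k = unit_ball_vol (real k)" for k :: nat
  let ?c = "\<lambda>j. \<kappa> (?n - j) * ?V j * (pi * s) powr - (real (?n - j) / 2)"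
  let ?g = "\<lambda>j t. t powr (real (?n - j) / 2) / exp t"
  have \<kappa>: "0 \<le> \<kappa> k" for k by (simp add: \<kappa>_def)
  have "(\<integral>\<^sup>+x. ennreal (exp (- b x)) \<partial>lborel)
      = (\<integral>\<^sup>+x. (\<integral>\<^sup>+t. ennreal (exp (- t)) * indicator {b x..} t \<partial>lborel) \<partial>lborel)"
    by (intro nn_integral_cong exp_b)
  also have "\<dots> = (\<integral>\<^sup>+t. (\<integral>\<^sup>+x. ennreal (exp (- t)) * indicator {b x..} t \<partial>lborel) \<partial>lborel)"
  proof (rule lborel_pair.Fubini'[symmetric])
    have "(\<lambda>p :: (real^'n) \<times> real. ennreal (exp (- snd p)) * indicator {p. b (fst p) \<le> snd p} p) \<in> borel_measurable (lborel \<Otimes>\<^sub>M lborel)"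
      by measurable
    then show "(\<lambda>(x, t). ennreal (exp (- t)) * indicator {b x..} t) \<in> borel_measurable (lborel \<Otimes>\<^sub>M lborel)"
      by (simp add: split_beta' indicator_def)
  qed
  also have "\<dots> = (\<integral>\<^sup>+t. (\<Sum>j\<le>?n. ennreal (?c j)
      * (ennreal (?g j t) * indicator {0..} t)) \<partial>lborel)"
  proof (rule nn_integral_cong_AE)
    \<comment> \<open>The Steiner formula above is for positive radii; \<open>t = 0\<close> is a
      null set, and for negative \<open>t\<close> both sides vanish.\<close>
    have "AE t in lborel. t \<noteq> (0::real)" by (rule AE_lborel_singleton)
    then show "AE t in lborel. (\<integral>\<^sup>+x. ennreal (exp (- t)) * indicator {b x..} t \<partial>lborel)
        = (\<Sum>j\<le>?n. ennreal (?c j)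
          * (ennreal (?g j t) * indicator {0..} t))"
    proof (rule AE_mp, intro AE_I2 impI)
      fix t :: real assume "t \<noteq> 0"
      then consider "t < 0" | "0 < t" by linarith
      then show "(\<integral>\<^sup>+x. ennreal (exp (- t)) * indicator {b x..} t \<partial>lborel)
          = (\<Sum>j\<le>?n. ennreal (?c j)
            * (ennreal (?g j t) * indicator {0..} t))"
      proof cases
        case 1
        have "indicator {b x..} t = (0::ennreal)" for x
        proof -
          have "0 \<le> b x" using s by (simp add: b_def)
          then show ?thesis using 1 by (simp add: indicator_def)
        qed
        then show ?thesis using 1 by simp
      next
        case 2
        define r where "r = sqrt (t / (pi * s))"
        have r: "0 < r" "r\<^sup>2 = t / (pi * s)" using 2 s by (auto simp: r_def)
        have "indicator {b x..} t = (indicator (parallel_body K r) x :: ennreal)" for x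
        proof -
          have "b x \<le> t \<longleftrightarrow> (infdist x K)\<^sup>2 \<le> r\<^sup>2"
            using s by (simp add: b_def r(2) pos_le_divide_eq mult_ac)
          also have "\<dots> \<longleftrightarrow> infdist x K \<le> r"
            using r(1) infdist_nonneg[of x K] by (simp add: power2_le_iff_abs_le)
          finally show ?thesis by (simp add: parallel_body_def indicator_def)
        qed
        then have "(\<integral>\<^sup>+x. ennreal (exp (- t)) * indicator {b x..} t \<partial>lborel)
            = (\<integral>\<^sup>+x. ennreal (exp (- t)) * indicator (parallel_body K r) x \<partial>lborel)"
          by (simp only:)
        also have "\<dots> = ennreal (exp (- t)) * emeasure lborel (parallel_body K r)"
          using borel_compact[OF compact_parallel_body[OF K(1,3), of r]] by (simp add: nn_integral_cmult_indicator)
        also have "emeasure lborel (parallel_body K r) = ennreal (measure lborel (parallel_body K r))"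
          using emeasure_compact_finite[OF compact_parallel_body[OF K(1,3), of r]]
          by (intro emeasure_eq_ennreal_measure) auto
        also have "\<dots> = ennreal (\<Sum>j\<le>?n. \<kappa> (?n - j) * ?V j * r ^ (?n - j))"
          unfolding steiner_formula[OF P K r(1)] \<kappa>_def ..
        also have "ennreal (exp (- t)) * \<dots> = ennreal (\<Sum>j\<le>?n. (?c j)
            * (?g j t))"
        proof -
          have r_pow: "r ^ k = t powr (real k / 2) * (pi * s) powr - (real k / 2)" for k
          proof -
            have "r ^ k = r powr real k" using r(1) by (simp add: powr_realpow)
            also have "\<dots> = ((t / (pi * s)) powr (1 / 2)) powr real k" using 2 s by (simp add: r_def powr_half_sqrt)
            also have "\<dots> = (t / (pi * s)) powr (real k / 2)" by (simp add: powr_powr)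
            also have "\<dots> = t powr (real k / 2) * (pi * s) powr - (real k / 2)"
              using 2 s by (simp add: powr_divide powr_minus_divide)
            finally show ?thesis .
          qed
          have div_exp: "x / exp t = x * exp (- t)" for x :: real
            by (simp add: exp_minus field_simps)
          have "exp (- t) * (\<Sum>j\<le>?n. \<kappa> (?n - j) * ?V j * r ^ (?n - j))
              = (\<Sum>j\<le>?n. (?c j) * (?g j t))"
            unfolding sum_distrib_left r_pow div_exp by (simp only: mult_ac)
          moreover have "ennreal (exp (- t)) * ennreal y = ennreal (exp (- t) * y)" for y
            by (rule ennreal_mult'[symmetric]) simp
          ultimately show ?thesis by (simp only:)
        qed
        also have "\<dots> = (\<Sum>j\<le>?n. ennreal ((?c j)
            * (?g j t)))"
          using \<kappa> intrinsic_volume_nonneg by (intro sum_ennreal[symmetric]) auto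
        also have "\<dots> = (\<Sum>j\<le>?n. ennreal (?c j)
            * ennreal (?g j t))"
          using \<kappa> intrinsic_volume_nonneg by (intro sum.cong refl ennreal_mult) auto
        finally show ?thesis using 2 by simp
      qed
    qed
  qed
  also have "\<dots> = (\<Sum>j\<le>?n. ennreal (?c j)
      * (\<integral>\<^sup>+t. ennreal (?g j t) * indicator {0..} t \<partial>lborel))"
  proof (subst nn_integral_sum)
    show "(\<Sum>j\<le>?n. \<integral>\<^sup>+t. ennreal (?c j)
          * (ennreal (?g j t) * indicator {0..} t) \<partial>lborel)
        = (\<Sum>j\<le>?n. ennreal (?c j)
          * (\<integral>\<^sup>+t. ennreal (?g j t) * indicator {0..} t \<partial>lborel))"
      by (intro sum.cong refl nn_integral_cmult) measurable
  qed measurable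
  also have "\<dots> = (\<Sum>j\<le>?n. ennreal (?V j * s powr - (real (?n - j) / 2)))"
  proof (intro sum.cong refl)
    fix j
    define k where "k = real (?n - j) / 2"
    have k: "0 \<le> k" by (simp add: k_def)
    have "(\<integral>\<^sup>+t. ennreal (t powr k / exp t) * indicator {0..} t \<partial>lborel) = ennreal (Gamma (k + 1))"
      using Gamma_integral_real[of "k + 1"] k by (intro nn_integral_has_integral_lebesgue') auto
    \<comment> \<open>The cancellation for which the weight carries the factor pi.\<close>
    moreover have "\<kappa> (?n - j) * Gamma (k + 1) * (pi * s) powr - k = s powr - k"
    proof -
      have "Gamma (k + 1) \<noteq> 0" using Gamma_real_pos[of "k + 1"] k by linarith
      moreover have "\<kappa> (?n - j) = pi powr k / Gamma (k + 1)" by (simp add: \<kappa>_def unit_ball_vol_def k_def)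
      ultimately show ?thesis using s by (simp add: powr_mult powr_minus)
    qed
    ultimately show "ennreal (?c j)
        * (\<integral>\<^sup>+t. ennreal (?g j t) * indicator {0..} t \<partial>lborel)
        = ennreal (?V j * s powr - (real (?n - j) / 2))"
      using k \<kappa> intrinsic_volume_nonneg unfolding k_def[symmetric]
      by (simp add: ennreal_mult[symmetric] Gamma_real_nonneg mult_ac)
  qed
  also have "\<dots> = ennreal (\<Sum>j\<le>?n. ?V j * s powr - (real (?n - j) / 2))"
    using intrinsic_volume_nonneg by (intro sum_ennreal) auto
  finally show ?thesis by (simp add: b_def)
qed

section \<open>Log-concavity in the scaling parameter\<close>

lemma infdist_scaleR:
  fixes K :: "'a::euclidean_space set"
  assumes s: "0 < s" and K: "compact K" "K \<noteq> {}"
  shows "infdist (s *\<^sub>R x) ((*\<^sub>R) s ` K) = s * infdist x K"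
proof (rule antisym)
  have sK: "compact ((*\<^sub>R) s ` K)" "(*\<^sub>R) s ` K \<noteq> {}" using K by (auto intro: compact_scaling)
  obtain a where a: "a \<in> K" "infdist x K = dist x a"
    by (rule infdist_attains_inf[OF compact_imp_closed[OF K(1)] K(2)])
  have "infdist (s *\<^sub>R x) ((*\<^sub>R) s ` K) \<le> dist (s *\<^sub>R x) (s *\<^sub>R a)" using a by (intro infdist_le) auto
  then show "infdist (s *\<^sub>R x) ((*\<^sub>R) s ` K) \<le> s * infdist x K"
    using s by (simp add: a(2) dist_norm scaleR_diff_right[symmetric])
  obtain c where c: "c \<in> (*\<^sub>R) s ` K" "infdist (s *\<^sub>R x) ((*\<^sub>R) s ` K) = dist (s *\<^sub>R x) c"
    by (rule infdist_attains_inf[OF compact_imp_closed[OF sK(1)] sK(2)])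
  then obtain a' where a': "c = s *\<^sub>R a'" "a' \<in> K" by auto
  have "s * infdist x K \<le> s * dist x a'" using a' s by (intro mult_left_mono infdist_le) auto
  then show "s * infdist x K \<le> infdist (s *\<^sub>R x) ((*\<^sub>R) s ` K)"
    using s by (simp add: c(2) a'(1) dist_norm scaleR_diff_right[symmetric])
qed

lemma gaussian_integral_scaled_body:
  assumes P: "projector_family P" and K: "compact K" "convex K" "K \<noteq> {}" and s: "0 < s"
  shows "(\<integral>\<^sup>+y. ennreal (exp (- (pi * (infdist y ((*\<^sub>R) s ` K))\<^sup>2 / s))) \<partial>lborel)
    = ennreal (\<Sum>j\<le>CARD('n). intrinsic_volume H P j K * s powr ((real CARD('n) + real j) / 2))"
proof -
  let ?n = "CARD('n)"
  define f where "f y = ennreal (exp (- (pi * (infdist y ((*\<^sub>R) s ` K))\<^sup>2 / s)))" for y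
  have [measurable]: "f \<in> borel_measurable borel"
    unfolding f_def using s
    by (intro measurable_compose[OF _ measurable_ennreal] borel_measurable_continuous_onI continuous_intros) auto
  have "(\<integral>\<^sup>+y. f y \<partial>lborel)
      = (\<integral>\<^sup>+y. f y \<partial>density (distr lborel borel (\<lambda>x. 0 + s *\<^sub>R x)) (\<lambda>_. ennreal (\<bar>s\<bar> ^ DIM(real^'n))))"
    by (rule arg_cong[OF lborel_affine[of s 0], of "\<lambda>M. nn_integral M f"]) (use s in simp)
  also have "\<dots> = ennreal (s ^ ?n) * (\<integral>\<^sup>+x. f (s *\<^sub>R x) \<partial>lborel)"
    using s by (simp add: nn_integral_density nn_integral_distr nn_integral_cmult)
  also have "(\<integral>\<^sup>+x. f (s *\<^sub>R x) \<partial>lborel) = (\<integral>\<^sup>+x. ennreal (exp (- (pi * s * (infdist x K)\<^sup>2))) \<partial>lborel)"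
    using s by (intro nn_integral_cong)
      (simp add: f_def infdist_scaleR[OF s K(1,3)] power2_eq_square)
  also have "\<dots> = ennreal (\<Sum>j\<le>?n. intrinsic_volume H P j K * s powr - (real (?n - j) / 2))"
    by (rule gaussian_integral_infdist[OF assms])
  also have "ennreal (s ^ ?n) * \<dots> = ennreal (s ^ ?n * (\<Sum>j\<le>?n. intrinsic_volume H P j K * s powr - (real (?n - j) / 2)))"
    using s by (simp add: ennreal_mult')
  also have "s ^ ?n * (\<Sum>j\<le>?n. intrinsic_volume H P j K * s powr - (real (?n - j) / 2))
      = (\<Sum>j\<le>?n. intrinsic_volume H P j K * s powr ((real ?n + real j) / 2))"
    unfolding sum_distrib_left
  proof (intro sum.cong refl)
    fix j assume "j \<in> {..?n}"
    then have "real ?n + - (real (?n - j) / 2) = (real ?n + real j) / 2" by (simp add: of_nat_diff field_simps)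
    then have "s powr ((real ?n + real j) / 2) = s powr real ?n * s powr - (real (?n - j) / 2)"
      by (metis powr_add)
    then show "s ^ ?n * (intrinsic_volume H P j K * s powr - (real (?n - j) / 2))
        = intrinsic_volume H P j K * s powr ((real ?n + real j) / 2)"
      using s by (simp add: powr_realpow)
  qed
  finally show ?thesis by (simp add: f_def)
qed

text \<open>Subadditivity of the perspective function \<open>p\<^sup>2 / s\<close>; with its
  homogeneity this is the joint convexity from which log-concavity in \<open>s\<close>
  arises.\<close>

lemma sum_squares_divide_le:
  fixes p q s t :: real
  assumes "0 < s" "0 < t"
  shows "(p + q)\<^sup>2 / (s + t) \<le> p\<^sup>2 / s + q\<^sup>2 / t"
proof -
  have "0 \<le> (p * t - q * s)\<^sup>2" by simp
  then have "(p + q)\<^sup>2 * (s * t) \<le> (p\<^sup>2 * t + q\<^sup>2 * s) * (s + t)"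
    by (simp add: power2_eq_square algebra_simps)
  then have "(p + q)\<^sup>2 / (s + t) \<le> (p\<^sup>2 * t + q\<^sup>2 * s) / (s * t)"
    using assms by (simp add: divide_le_eq pos_le_divide_eq)
  also have "\<dots> = p\<^sup>2 / s + q\<^sup>2 / t" using assms by (simp add: field_simps)
  finally show ?thesis .
qed

lemma intrinsic_volume_polynomial_midpoint:
  fixes P :: "nat \<Rightarrow> real^'n^'n" and K :: "(real^'n) set"
  defines "W \<equiv> \<lambda>s. \<Sum>j\<le>CARD('n). intrinsic_volume H P j K * s powr ((real CARD('n) + real j) / 2)"
  assumes P: "projector_family P" and K: "compact K" "convex K" "K \<noteq> {}" and st: "0 < s" "0 < t"
  shows "W s * W t \<le> (W ((s + t) / 2))\<^sup>2"
proof -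
  define f where "f s y = ennreal (exp (- (pi * (infdist y ((*\<^sub>R) s ` K))\<^sup>2 / s)))" for s :: real and y :: "real^'n"
  have W_nonneg: "0 \<le> W r" for r
    unfolding W_def by (intro sum_nonneg mult_nonneg_nonneg intrinsic_volume_nonneg) auto
  have int: "(\<integral>\<^sup>+y. f r y \<partial>lborel) = ennreal (W r)" if "0 < r" for r
    unfolding f_def W_def by (rule gaussian_integral_scaled_body[OF P K that])
  have meas: "f r \<in> borel_measurable borel" if "0 < r" for r
    unfolding f_def using that
    by (intro measurable_compose[OF _ measurable_ennreal] borel_measurable_continuous_onI continuous_intros) auto
  let ?r = "(s + t) / 2"
  have r: "0 < ?r" using st by simp
  have "(\<integral>\<^sup>+y. f s y \<partial>lborel) * (\<integral>\<^sup>+y. f t y \<partial>lborel) \<le> (\<integral>\<^sup>+y. f ?r y \<partial>lborel)\<^sup>2"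
  proof (rule prekopa_leindler_midpoint[OF meas[OF st(1)] meas[OF st(2)] meas[OF r]])
    fix x y
    have sK: "compact ((*\<^sub>R) c ` K)" "(*\<^sub>R) c ` K \<noteq> {}" for c :: real using K by (auto intro: compact_scaling)
    obtain a where a: "a \<in> (*\<^sub>R) s ` K" "infdist x ((*\<^sub>R) s ` K) = dist x a"
      by (rule infdist_attains_inf[OF compact_imp_closed[OF sK(1)] sK(2)])
    obtain b where b: "b \<in> (*\<^sub>R) t ` K" "infdist y ((*\<^sub>R) t ` K) = dist y b"
      by (rule infdist_attains_inf[OF compact_imp_closed[OF sK(1)] sK(2)])
    obtain k l where kl: "a = s *\<^sub>R k" "k \<in> K" "b = t *\<^sub>R l" "l \<in> K" using a b by auto
    \<comment> \<open>The midpoint of points of \<open>s K\<close> and \<open>t K\<close> is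
      \<open>?r\<close> times this convex combination, so it lies in the body scaled by
      \<open>?r\<close>.\<close>
    let ?m = "(s / (s + t)) *\<^sub>R k + (t / (s + t)) *\<^sub>R l"
    have "?m \<in> K"
      using K(2) kl st by (intro convexD) (auto simp: add_divide_distrib[symmetric])
    moreover have "(a + b) /\<^sub>R 2 = ?r *\<^sub>R ?m"
    proof -
      have "?r * (s / (s + t)) = s / 2" "?r * (t / (s + t)) = t / 2" using st by (simp_all add: field_simps)
      then have "?r *\<^sub>R ?m = (s / 2) *\<^sub>R k + (t / 2) *\<^sub>R l" by (simp only: scaleR_add_right scaleR_scaleR)
      then show ?thesis by (simp add: kl scaleR_add_right)
    qed
    ultimately have "(a + b) /\<^sub>R 2 \<in> (*\<^sub>R) ?r ` K" by (metis imageI)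
    then have "infdist ((x + y) /\<^sub>R 2) ((*\<^sub>R) ?r ` K) \<le> dist ((x + y) /\<^sub>R 2) ((a + b) /\<^sub>R 2)" by (rule infdist_le)
    also have "\<dots> = norm ((x - a) + (y - b)) / 2"
    proof -
      have "(x + y) /\<^sub>R 2 - (a + b) /\<^sub>R 2 = ((x - a) + (y - b)) /\<^sub>R 2"
        unfolding scaleR_diff_right[symmetric] by (simp add: algebra_simps)
      then show ?thesis unfolding dist_norm by simp
    qed
    also have "\<dots> \<le> (dist x a + dist y b) / 2"
      using norm_triangle_ineq[of "x - a" "y - b"] by (simp add: dist_norm)
    finally have le: "infdist ((x + y) /\<^sub>R 2) ((*\<^sub>R) ?r ` K) \<le> (dist x a + dist y b) / 2" .
    \<comment> \<open>The 2 accounts for the square on the right of the Prekopa-Leindler hypothesis;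
      with \<open>?r = (s + t) / 2\<close> it produces the denominator \<open>s + t\<close>.\<close>
    have "2 * (infdist ((x + y) /\<^sub>R 2) ((*\<^sub>R) ?r ` K))\<^sup>2 / ?r \<le> 2 * ((dist x a + dist y b) / 2)\<^sup>2 / ?r"
      using r by (intro divide_right_mono mult_left_mono power_mono le infdist_nonneg) auto
    also have "\<dots> = (dist x a + dist y b)\<^sup>2 / (s + t)" by (simp add: power_divide)
    also have "\<dots> \<le> (dist x a)\<^sup>2 / s + (dist y b)\<^sup>2 / t" by (rule sum_squares_divide_le[OF st])
    finally have "pi * (2 * (infdist ((x + y) /\<^sub>R 2) ((*\<^sub>R) ?r ` K))\<^sup>2 / ?r) \<le> pi * ((dist x a)\<^sup>2 / s + (dist y b)\<^sup>2 / t)"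
      by (rule mult_left_mono) simp
    then have "exp (- (pi * (infdist x ((*\<^sub>R) s ` K))\<^sup>2 / s)) * exp (- (pi * (infdist y ((*\<^sub>R) t ` K))\<^sup>2 / t))
        \<le> (exp (- (pi * (infdist ((x + y) /\<^sub>R 2) ((*\<^sub>R) ?r ` K))\<^sup>2 / ?r)))\<^sup>2"
      by (simp add: a(2) b(2) exp_add[symmetric] exp_double[symmetric] distrib_left mult_ac)
    then show "f s x * f t y \<le> (f ?r ((x + y) /\<^sub>R 2))\<^sup>2"
      unfolding f_def by (simp add: ennreal_mult'[symmetric] ennreal_power)
  qed
  then have "ennreal (W s * W t) \<le> ennreal ((W ?r)\<^sup>2)"
    unfolding int[OF st(1)] int[OF st(2)] int[OF r]
    using W_nonneg by (simp add: ennreal_mult' ennreal_power)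
  then show ?thesis by (subst (asm) ennreal_le_iff) auto
qed

end

section \<open>Transfer to the random variable\<close>

lemma (in prob_space) expectation_finite_nat:
  fixes Z :: "'a \<Rightarrow> nat" and \<phi> :: "nat \<Rightarrow> real"
  assumes Z: "Z \<in> M \<rightarrow>\<^sub>M count_space {0..n}"
  shows "expectation (\<lambda>\<omega>. \<phi> (Z \<omega>)) = (\<Sum>i\<le>n. \<phi> i * \<P>(\<omega> in M. Z \<omega> = i))"
proof -
  have [measurable]: "{\<omega> \<in> space M. Z \<omega> = i} \<in> events" for i
  proof -
    have "{\<omega> \<in> space M. Z \<omega> = i} = Z -` ({i} \<inter> {0..n}) \<inter> space M"
      using measurable_space[OF Z] by auto
    also have "\<dots> \<in> events" by (rule measurable_sets[OF Z]) auto
    finally show ?thesis .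
  qed
  have "expectation (\<lambda>\<omega>. \<phi> (Z \<omega>)) = expectation (\<lambda>\<omega>. \<Sum>i\<le>n. \<phi> i * indicator {\<omega> \<in> space M. Z \<omega> = i} \<omega>)"
  proof (intro Bochner_Integration.integral_cong refl)
    fix \<omega> assume \<omega>: "\<omega> \<in> space M"
    then have "Z \<omega> \<le> n" using measurable_space[OF Z] by auto
    moreover have "(\<Sum>i\<le>n. \<phi> i * indicator {\<omega> \<in> space M. Z \<omega> = i} \<omega>) = (\<Sum>i\<le>n. if i = Z \<omega> then \<phi> i else 0)"
      using \<omega> by (intro sum.cong refl) (auto simp: indicator_def)
    ultimately show "\<phi> (Z \<omega>) = (\<Sum>i\<le>n. \<phi> i * indicator {\<omega> \<in> space M. Z \<omega> = i} \<omega>)" by simp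
  qed
  also have "\<dots> = (\<Sum>i\<le>n. \<phi> i * \<P>(\<omega> in M. Z \<omega> = i))"
    by (subst Bochner_Integration.integral_sum) (auto simp: emeasure_eq_measure)
  finally show ?thesis .
qed

theorem theorem1p11:
  fixes H :: "(real ^ 'n ^ 'n) measure" and P :: "nat \<Rightarrow> real ^ 'n ^ 'n"
    and K :: "(real ^ 'n) set" and M :: "'w measure" and Z :: "'w \<Rightarrow> nat"
  assumes "haar_prob_SO H" and "projector_family P"
    and "compact K" and "convex K" and "K \<noteq> {}"
    and "intrinsic_volume_rv H P K M Z"
  shows "prob_space.variance M (\<lambda>\<omega>. real (Z \<omega>)) \<le> 4 * real CARD('n) \<and>
    (\<forall>t::real. 0 \<le> t \<and> t \<le> sqrt (real CARD('n)) \<longrightarrow>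
       \<P>(\<omega> in M. \<bar>real (Z \<omega>) - prob_space.expectation M (\<lambda>\<omega>. real (Z \<omega>))\<bar> \<ge> t * sqrt (real CARD('n)))
         \<le> 2 * exp (- 3 * t\<^sup>2 / 28))"
proof -
  interpret haar H by unfold_locales fact
  let ?n = "CARD('n)"
  let ?W = "total_intrinsic_volume H P K"
  have Z: "Z \<in> M \<rightarrow>\<^sub>M count_space {0..?n}"
    and dist: "\<And>j. j \<le> ?n \<Longrightarrow> \<P>(\<omega> in M. Z \<omega> = j) = intrinsic_volume H P j K / ?W"
    using assms(6) by (auto simp: intrinsic_volume_rv_def)
  interpret M: prob_space M using assms(6) by (simp add: intrinsic_volume_rv_def)
  note expect = M.expectation_finite_nat[OF Z]
  define p where "p i = \<P>(\<omega> in M. Z \<omega> = i)" for i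
  define a where "a i = (real ?n + real i) / 2" for i
  define \<mu> where "\<mu> = M.expectation (\<lambda>\<omega>. real (Z \<omega>))"
  define m where "m = (\<Sum>i\<le>?n. p i * a i)"
  have p: "0 \<le> p i" for i by (simp add: p_def)
  have p_sum: "(\<Sum>i\<le>?n. p i) = 1"
    using expect[of "\<lambda>_. 1"] by (simp add: p_def M.prob_space)
  have \<mu>: "\<mu> = (\<Sum>i\<le>?n. real i * p i)" unfolding \<mu>_def p_def by (rule expect)
  have m: "m = (real ?n + \<mu>) / 2"
    using p_sum by (simp add: m_def a_def \<mu> sum.distrib distrib_left add_divide_distrib
        sum_divide_distrib[symmetric] sum_distrib_right[symmetric] mult.commute)
  have \<mu>_bounds: "0 \<le> \<mu>" "\<mu> \<le> real ?n"
  proof -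
    show "0 \<le> \<mu>" unfolding \<mu> by (intro sum_nonneg mult_nonneg_nonneg p) auto
    have "\<mu> \<le> (\<Sum>i\<le>?n. real ?n * p i)" unfolding \<mu> by (intro sum_mono mult_right_mono p) auto
    then show "\<mu> \<le> real ?n" by (simp add: sum_distrib_left[symmetric] p_sum)
  qed
  have centered: "a i - m = (real i - \<mu>) / 2" for i by (simp add: a_def m field_simps)
  have moments: "(\<Sum>i\<le>?n. p i * s powr a i) \<le> exp ((s - 1) * m)" if "0 < s" for s
    unfolding m_def
  proof (rule power_moment_le_exp[OF p p_sum _ that])
    fix s t :: real assume st: "0 < s" "0 < t"
    let ?S = "\<lambda>s. \<Sum>j\<le>?n. intrinsic_volume H P j K * s powr ((real ?n + real j) / 2)"
    have S: "(\<Sum>i\<le>?n. p i * r powr a i) = ?S r / ?W" for r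
      by (simp add: p_def a_def dist sum_divide_distrib)
    have "?S s * ?S t / ?W\<^sup>2 \<le> (?S ((s + t) / 2))\<^sup>2 / ?W\<^sup>2"
      using intrinsic_volume_polynomial_midpoint[OF assms(2-5) st] by (rule divide_right_mono) simp
    then show "(\<Sum>i\<le>?n. p i * s powr a i) * (\<Sum>i\<le>?n. p i * t powr a i) \<le> (\<Sum>i\<le>?n. p i * ((s + t) / 2) powr a i)\<^sup>2"
      unfolding S by (simp add: power_divide power2_eq_square)
  qed
  have n_pos: "0 < real ?n" by simp
  \<comment> \<open>\<open>Z\<close> is at most \<open>?n\<close>, hence so is the mean of
    \<open>a\<close>; this allows \<open>N = ?n\<close> in the tail bounds.\<close>
  have m_bounds: "0 \<le> m" "m \<le> real ?n" using \<mu>_bounds by (auto simp: m)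
  note conc = variance_le_mean[OF p p_sum m_def m_bounds n_pos moments]
    upper_tail[OF p p_sum m_def m_bounds n_pos moments] lower_tail[OF p p_sum m_def m_bounds n_pos moments]
  have "M.variance (\<lambda>\<omega>. real (Z \<omega>)) = (\<Sum>i\<le>?n. (real i - \<mu>)\<^sup>2 * p i)"
    unfolding \<mu>_def[symmetric] p_def by (rule expect)
  \<comment> \<open>The factor 4 undoes the halving in \<open>a\<close>.\<close>
  also have "\<dots> = 4 * (\<Sum>i\<le>?n. p i * (a i - m)\<^sup>2)"
    unfolding centered by (simp add: sum_distrib_left power_divide mult.commute)
  also have "\<dots> \<le> 4 * m" using conc(1) by simp
  also have "\<dots> \<le> 4 * real ?n" using m_bounds by simp
  finally have var: "M.variance (\<lambda>\<omega>. real (Z \<omega>)) \<le> 4 * real ?n" .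
  have tail: "\<P>(\<omega> in M. \<bar>real (Z \<omega>) - \<mu>\<bar> \<ge> t * sqrt (real ?n)) \<le> 2 * exp (- 3 * t\<^sup>2 / 28)"
    if t: "0 \<le> t" "t \<le> sqrt (real ?n)" for t
  proof -
    \<comment> \<open>Chosen so that \<open>?n * u\<close> is half of \<open>t * sqrt ?n\<close>,
      the deviation of \<open>a\<close> that corresponds to the given deviation of \<open>Z\<close>.
      The range of \<open>t\<close> becomes \<open>u \<le> 1 / 2\<close>.\<close>
    define u where "u = t / (2 * sqrt (real ?n))"
    have u: "0 \<le> u" "u \<le> 1 / 2" using t by (auto simp: u_def divide_simps)
    have nu: "real ?n * u = t * sqrt (real ?n) / 2"
      by (simp add: u_def real_div_sqrt field_simps)
    have nu2: "- 3 / 7 * real ?n * u\<^sup>2 = - 3 * t\<^sup>2 / 28"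
      by (simp add: u_def power_divide power_mult_distrib)
    let ?A = "{i. i \<le> ?n \<and> real ?n * u \<le> a i - m}" and ?B = "{i. i \<le> ?n \<and> real ?n * u \<le> m - a i}"
    let ?I = "{i. \<bar>real i - \<mu>\<bar> \<ge> t * sqrt (real ?n)}"
    have m_a: "m - a i = (\<mu> - real i) / 2" for i using centered[of i] by simp
    have iff: "i \<in> ?I \<and> i \<le> ?n \<longleftrightarrow> i \<in> ?A \<or> i \<in> ?B" for i
      unfolding nu centered m_a by auto
    have "\<P>(\<omega> in M. \<bar>real (Z \<omega>) - \<mu>\<bar> \<ge> t * sqrt (real ?n)) = M.expectation (\<lambda>\<omega>. indicator {\<omega> \<in> space M. Z \<omega> \<in> ?I} \<omega>)"
      by (simp add: Int_absorb2 subset_iff)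
    also have "\<dots> = M.expectation (\<lambda>\<omega>. indicator ?I (Z \<omega>))"
      by (intro Bochner_Integration.integral_cong refl) (auto simp: indicator_def)
    also have "\<dots> = (\<Sum>i\<le>?n. indicator ?I i * p i)" unfolding p_def by (rule expect)
    also have "\<dots> = sum p ({..?n} \<inter> ?I)" by (simp add: indicator_times_eq_if(1) sum.inter_restrict)
    also have "{..?n} \<inter> ?I = ?A \<union> ?B" using iff by blast
    also have "sum p (?A \<union> ?B) \<le> sum p ?A + sum p ?B"
    proof -
      have "sum p (?A \<union> ?B) + sum p (?A \<inter> ?B) = sum p ?A + sum p ?B" by (rule sum.union_inter) auto
      then show ?thesis using sum_nonneg[of "?A \<inter> ?B" p] p by simp
    qed
    also have "\<dots> \<le> exp (- 3 / 7 * real ?n * u\<^sup>2) + exp (- 3 / 7 * real ?n * u\<^sup>2)"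
      by (intro add_mono conc(2,3) u)
    finally show ?thesis unfolding nu2 by simp
  qed
  show ?thesis
    using var tail unfolding \<mu>_def by blast
qed

end
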